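(* Let $(W,S)$ be a Coxeter system, $s\in S$, and $u,w\in W$ with $u<us$, $w<ws$ and $u<w$ in Bruhat order. If $us\notin[u,w]$, then $\Psi_{[u,ws]}=\Psi_{\mathrm{Pyr}[u,w]}$ and $\Psi_{[us,ws]}=\Psi_{[u,w]}$. If $us\in[u,w]$, then $$\Psi_{[u,ws]}=\Psi_{\mathrm{Pyr}[u,w]}-\sum_{v\in(u,w):\,vs<v}\Psi_{[u,v]}\cdot d\cdot\Psi_{[v,w]}$$ $$=\frac12\Big(\Psi_{[u,w]}\cdot c+c\cdot\Psi_{[u,w]}+\sum_{v\in(u,w)}\sigma_s(v)\,\Psi_{[u,v]}\cdot d\cdot\Psi_{[v,w]}\Big)$$ and $$\Psi_{[us,ws]}=\Psi_{\mathrm{Sh}_{us}[u,w]}-\sum_{v\in(us,w):\,vs<v}\Psi_{[us,v]}\cdot d\cdot\Psi_{[v,w]}$$ $$=\Psi_{[u,w]}+\frac12\Big(\Psi_{[us,w]}\cdot c-c\cdot\Psi_{[us,w]}+\sum_{v\in(us,w)}\sigma_s(v)\,\Psi_{[us,v]}\cdot d\cdot\Psi_{[v,w]}\Big).$$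
   Context: All intervals are intervals in Bruhat order on $W$ (fixing a reduced word for $w$, $v\le w$ iff some subword is a reduced word for $v$). $l$ is the length function and $\sigma_s(v)=l(vs)-l(v)\in\{1,-1\}$. cd-index. For a finite graded poset $P$ of rank $n+1\ge1$ with minimum $\hat0$ and maximum $\hat1$ and $S\subseteq[n]=\{1,\dots,n\}$, let $\alpha_P(S)$ be the number of chains in $P\setminus\{\hat0,\hat1\}$ whose set of ranks is $S$, and $\beta_P(S)=\sum_{T\subseteq S}(-1)^{|S\setminus T|}\alpha_P(T)$. Let $u_S=u_1\cdots u_n$ be the monomial in non-commuting variables $a,b$ with $u_i=b$ if $i\in S$ and $u_i=a$ otherwise; set $\Psi_P=\sum_{S\subseteq[n]}\beta_P(S)u_S$. Put $c=a+b$, $d=ab+ba$. If $P$ is Eulerian (in particular if $P$ is a Bruhat interval), $\Psi_P$ is a polynomial in $c,d$, the cd-index of $P$. $\mathrm{Pyr}(P)$ is the product of $P$ with a two-element chain (the paper writes $\mathrm{Pyr}\Psi_P$ for $\Psi_{\mathrm{Pyr}(P)}$ and $\mathrm{Sh}_a\Psi_P$ for $\Psi_{\mathrm{Sh}_a(P)}$). For an atom $a$ of $P$, $\mathrm{Sh}_a(P)$ is the induced subposet of $P\times[\hat0,a]$ on $\big((P\setminus\{\hat0,a\})\times\{a\}\big)\cup\big((a,\hat1]\times\{\hat0\}\big)\cup\{(\hat0,\hat0)\}$. When $us\in[u,w]$, $us$ is an atom of $[u,w]$. *)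

theory Defs
  imports Complex_Main "HOL-Algebra.Generated_Groups" "HOL-Library.Poly_Mapping" "HOL-Library.Sublist"
begin

section \<open>Coxeter systems\<close>

definition word_prod :: "('a, 'b) monoid_scheme \<Rightarrow> 'a list \<Rightarrow> 'a" where
  "word_prod W xs = foldr (mult W) xs (one W)"

text \<open>
  The congruence on words over \<open>S\<close> generated by the relations \<open>(s t)^m(s,t) = 1\<close>. The value
  \<open>m s t = 0\<close> encodes \<open>m(s,t) = \<infinity>\<close>: the relation is then vacuous. Since \<open>m(s,s) = 1\<close> for a Coxeter
  matrix, every generator is its own inverse, so that words without formal inverses suffice to
  describe the group with this presentation.
\<close>

inductive coxeter_cong :: "'a set \<Rightarrow> ('a \<Rightarrow> 'a \<Rightarrow> nat) \<Rightarrow> 'a list \<Rightarrow> 'a list \<Rightarrow> bool"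
  for S :: "'a set" and m :: "'a \<Rightarrow> 'a \<Rightarrow> nat" where
  refl: "xs \<in> lists S \<Longrightarrow> coxeter_cong S m xs xs"
| rel: "\<lbrakk>s \<in> S; t \<in> S; xs \<in> lists S; ys \<in> lists S\<rbrakk>
    \<Longrightarrow> coxeter_cong S m (xs @ concat (replicate (m s t) [s, t]) @ ys) (xs @ ys)"
| sym: "coxeter_cong S m xs ys \<Longrightarrow> coxeter_cong S m ys xs"
| trans: "\<lbrakk>coxeter_cong S m xs ys; coxeter_cong S m ys zs\<rbrakk> \<Longrightarrow> coxeter_cong S m xs zs"

definition coxeter_matrix :: "'a set \<Rightarrow> ('a \<Rightarrow> 'a \<Rightarrow> nat) \<Rightarrow> bool" where
  "coxeter_matrix S m \<longleftrightarrow>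
    (\<forall>s\<in>S. \<forall>t\<in>S. m s t = m t s \<and> (m s t = 1 \<longleftrightarrow> s = t))"

locale coxeter_system = group W for W :: "('a, 'b) monoid_scheme" (structure) +
  fixes S :: "'a set"
  assumes gens_closed: "S \<subseteq> carrier W"
    and gens_generate: "generate W S = carrier W"
    and presentation: "\<exists>m. coxeter_matrix S m \<and>
      (\<forall>xs\<in>lists S. \<forall>ys\<in>lists S. word_prod W xs = word_prod W ys \<longleftrightarrow> coxeter_cong S m xs ys)"

definition cox_length :: "('a, 'b) monoid_scheme \<Rightarrow> 'a set \<Rightarrow> 'a \<Rightarrow> nat" where
  "cox_length W S v = (LEAST n. \<exists>xs\<in>lists S. length xs = n \<and> word_prod W xs = v)"

definition reduced_word :: "('a, 'b) monoid_scheme \<Rightarrow> 'a set \<Rightarrow> 'a list \<Rightarrow> 'a \<Rightarrow> bool" where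
  "reduced_word W S xs v \<longleftrightarrow>
    xs \<in> lists S \<and> word_prod W xs = v \<and> length xs = cox_length W S v"

text \<open>The relation does not depend on which reduced word \<open>ys\<close> of \<open>w\<close> is chosen.\<close>

definition bruhat :: "('a, 'b) monoid_scheme \<Rightarrow> 'a set \<Rightarrow> 'a rel" where
  "bruhat W S =
    {(v, w). \<exists>ys. reduced_word W S ys w \<and> (\<exists>xs. subseq xs ys \<and> reduced_word W S xs v)}"

abbreviation bruhat_less :: "('a, 'b) monoid_scheme \<Rightarrow> 'a set \<Rightarrow> 'a \<Rightarrow> 'a \<Rightarrow> bool" where
  "bruhat_less W S v w \<equiv> (v, w) \<in> bruhat W S \<and> v \<noteq> w"

definition cox_sign :: "('a, 'b) monoid_scheme \<Rightarrow> 'a set \<Rightarrow> 'a \<Rightarrow> 'a \<Rightarrow> int" where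
  "cox_sign W S s v = int (cox_length W S (v \<otimes>\<^bsub>W\<^esub> s)) - int (cox_length W S v)"


section \<open>Posets\<close>

text \<open>
  A poset is represented by its reflexive order relation \<open>r\<close>; its underlying set is \<open>Field r\<close>.
\<close>

definition closed_ival :: "'a rel \<Rightarrow> 'a \<Rightarrow> 'a \<Rightarrow> 'a set" where
  "closed_ival r x y = {z. (x, z) \<in> r \<and> (z, y) \<in> r}"

definition open_ival :: "'a rel \<Rightarrow> 'a \<Rightarrow> 'a \<Rightarrow> 'a set" where
  "open_ival r x y = closed_ival r x y - {x, y}"

definition ival :: "'a rel \<Rightarrow> 'a \<Rightarrow> 'a \<Rightarrow> 'a rel" where
  "ival r x y = Restr r (closed_ival r x y)"

definition bot_of :: "'a rel \<Rightarrow> 'a" where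
  "bot_of r = (THE x. x \<in> Field r \<and> (\<forall>y\<in>Field r. (x, y) \<in> r))"

definition top_of :: "'a rel \<Rightarrow> 'a" where
  "top_of r = (THE x. x \<in> Field r \<and> (\<forall>y\<in>Field r. (y, x) \<in> r))"

text \<open>
  The rank of \<open>x\<close> is the number of elements of a longest chain strictly below \<open>x\<close>; in a graded
  poset with minimum this is the length of every maximal chain from the minimum to \<open>x\<close>.
\<close>

definition rank_of :: "'a rel \<Rightarrow> 'a \<Rightarrow> nat" where
  "rank_of r x = Max (card ` {C \<in> Chains r. C \<subseteq> {y. (y, x) \<in> r \<and> y \<noteq> x}})"

definition rel_product :: "'a rel \<Rightarrow> 'b rel \<Rightarrow> ('a \<times> 'b) rel" where
  "rel_product r q = {((x, i), (y, j)). (x, y) \<in> r \<and> (i, j) \<in> q}"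

definition Pyr :: "'a rel \<Rightarrow> ('a \<times> bool) rel" where
  "Pyr r = rel_product r {(i, j). i \<le> j}"

definition Sh :: "'a \<Rightarrow> 'a rel \<Rightarrow> ('a \<times> 'a) rel" where
  "Sh a r = Restr (rel_product r (ival r (bot_of r) a))
     ((Field r - {bot_of r, a}) \<times> {a}
      \<union> (closed_ival r a (top_of r) - {a}) \<times> {bot_of r}
      \<union> {(bot_of r, bot_of r)})"


section \<open>The cd-index\<close>

text \<open>
  Polynomials in the non-commuting variables \<open>a\<close>, \<open>b\<close> form the monoid algebra, over the rationals, of the
  free monoid on two letters. A copy of the type of lists carries the (additively written)
  concatenation monoid, so that \<open>*\<close> on \<open>ab_poly\<close> is the non-commutative product.
\<close>

datatype ab_letter = La | Lb

datatype ab_word = Word (letters: "ab_letter list")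

instantiation ab_word :: monoid_add
begin

definition zero_ab_word :: ab_word where
  "0 = Word []"

definition plus_ab_word :: "ab_word \<Rightarrow> ab_word \<Rightarrow> ab_word" where
  "x + y = Word (letters x @ letters y)"

instance
  by standard (simp_all add: zero_ab_word_def plus_ab_word_def)

end

type_synonym ab_poly = "ab_word \<Rightarrow>\<^sub>0 rat"

definition ab_const :: "rat \<Rightarrow> ab_poly" where
  "ab_const q = Poly_Mapping.single 0 q"

definition var_a :: ab_poly where
  "var_a = Poly_Mapping.single (Word [La]) 1"

definition var_b :: ab_poly where
  "var_b = Poly_Mapping.single (Word [Lb]) 1"

definition cd_c :: ab_poly where
  "cd_c = var_a + var_b"

definition cd_d :: ab_poly where
  "cd_d = var_a * var_b + var_b * var_a"

definition flag_alpha :: "'a rel \<Rightarrow> nat set \<Rightarrow> nat" where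
  "flag_alpha r T =
    card {C \<in> Chains r. C \<subseteq> Field r - {bot_of r, top_of r} \<and> rank_of r ` C = T}"

definition flag_beta :: "'a rel \<Rightarrow> nat set \<Rightarrow> int" where
  "flag_beta r T = (\<Sum>U\<in>Pow T. (- 1) ^ card (T - U) * int (flag_alpha r U))"

definition ab_monom :: "nat \<Rightarrow> nat set \<Rightarrow> ab_poly" where
  "ab_monom n T = prod_list (map (\<lambda>i. if i \<in> T then var_b else var_a) [1..<n + 1])"

definition Psi :: "'a rel \<Rightarrow> ab_poly" where
  "Psi r = (let n = rank_of r (top_of r) - 1 in
     (\<Sum>T\<in>Pow {1..n}. of_int (flag_beta r T) * ab_monom n T))"

end

theory Submission
  imports Defs
begin

text \<open>
  Write \<open>e = a - b\<close> and \<open>E(x,y) = e^(rank y - rank x - 1)\<close>. Expanding the flag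
  \<open>\<beta>\<close>-numbers gives \<open>\<Psi>\<close> as a sum over chains in which an element of rank \<open>i\<close> contributes a
  letter \<open>b\<close> in position \<open>i\<close> and every unoccupied position contributes \<open>e\<close>. Splitting off the
  largest element of a chain yields, in every graded poset,
  \<open>\<Psi>[x,y] = E(x,y) + \<Sum>x<t<y. \<Psi>[x,t] b E(t,y)\<close> (\<open>Psi_rec\<close>), and the whole proof rests on this
  recursion.

  Consider \<open>[u,ws]\<close>. By the lifting property it consists of the ascents \<open>x\<close> of \<open>s\<close> in \<open>[u,w]\<close> and
  their products \<open>xs\<close>. The poset is therefore two copies of the ascents in \<open>[u,w]\<close>,
  whereas the pyramid over \<open>[u,w]\<close> is two copies of all of \<open>[u,w]\<close>. The other interval \<open>[us,ws]\<close>
  compares in the same way with the shaving of \<open>[u,w]\<close> at the atom \<open>us\<close>. All four posets thus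
  satisfy one recursion along \<open>[u,w]\<close>, with descents left out of the sums in the Bruhat
  case. The theorem \<open>doubling_formula\<close> solves that recursion: each ascent \<open>x\<close> contributes
  \<open>\<psi>(x) ba \<Psi>[x,w]\<close> and each descent contributes \<open>- \<psi>(x) ab \<Psi>[x,w]\<close>, where \<open>\<psi>(x)\<close> is the
  \<open>ab\<close>-index of the interval ending at the lower copy of \<open>x\<close>. Without descents this evaluates
  the pyramid and the shaving. With descents it evaluates the two Bruhat intervals, and the
  difference is the sum of \<open>\<psi>(x) d \<Psi>[x,w]\<close> over the descents, because \<open>ba + ab = d\<close>.

  The recursion cannot be solved over the ascents alone, since \<open>\<Psi>[x,w]\<close> sees the descents between
  \<open>x\<close> and \<open>w\<close>. The induction therefore carries a second identity, valid at descents \<open>y\<close>: the same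
  expression then equals \<open>\<psi>(y) c\<close>. It holds because the ascents below \<open>y\<close> are exactly
  the ascents below or equal to \<open>ys\<close>.

  The formulas with the factor \<open>1/2\<close> follow from the identity
  \<open>\<Psi>b + a\<Psi> + \<Sum>\<Psi> ba \<Psi> = b\<Psi> + \<Psi>a + \<Sum>\<Psi> ab \<Psi>\<close> (\<open>Psi_flip\<close>), whose two sides are mirror
  images of each other.

  On the Coxeter side the lifting property and gradedness have to be derived from the presentation.
  Both come from the strong exchange property, and that property holds because the defining
  relations preserve, for each reflection, the parity of its number of occurrences
  among the reflections attached to a word.
\<close>

section \<open>Words, length and the strong exchange property\<close>

context coxeter_system
begin

abbreviation wp :: "'a list \<Rightarrow> 'a" where "wp \<equiv> word_prod W"
abbreviation len :: "'a \<Rightarrow> nat" where "len \<equiv> cox_length W S"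

lemma gen_closed [simp]: "s \<in> S \<Longrightarrow> s \<in> carrier W"
  using gens_closed by blast

text \<open>
  Inclusions of letter sets split along appends and reversals under simplification.
\<close>

lemma in_lists_iff [simp]: "xs \<in> lists S \<longleftrightarrow> set xs \<subseteq> S"
  by auto

declare in_lists_conv_set [simp del]

lemma wp_Nil [simp]: "wp [] = \<one>"
  by (simp add: word_prod_def)

lemma wp_Cons [simp]: "wp (x # xs) = x \<otimes> wp xs"
  by (simp add: word_prod_def)

lemma wp_closed [simp]: "set xs \<subseteq> S \<Longrightarrow> wp xs \<in> carrier W"
  by (induction xs) auto

lemma wp_append: "set xs \<subseteq> S \<Longrightarrow> set ys \<subseteq> S \<Longrightarrow> wp (xs @ ys) = wp xs \<otimes> wp ys"
  by (induction xs) (auto simp: m_assoc)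

lemma wp_append_Cons:
  "set xs \<subseteq> S \<Longrightarrow> s \<in> S \<Longrightarrow> set ys \<subseteq> S \<Longrightarrow> wp (xs @ s # ys) = wp xs \<otimes> (s \<otimes> wp ys)"
  by (subst wp_append) auto

lemma gen_square [simp]: assumes "s \<in> S" shows "s \<otimes> s = \<one>"
proof -
  obtain m where m: "coxeter_matrix S m"
    "\<And>xs ys. set xs \<subseteq> S \<Longrightarrow> set ys \<subseteq> S \<Longrightarrow> wp xs = wp ys \<longleftrightarrow> coxeter_cong S m xs ys"
    using presentation by (auto simp: Ball_def)
  have "m s s = 1" using m(1) assms by (auto simp: coxeter_matrix_def)
  hence "coxeter_cong S m [s, s] []"
    using coxeter_cong.rel[of s S s "[]" "[]" m] assms by simp
  hence "wp [s, s] = wp []" using m(2)[of "[s,s]" "[]"] assms by simp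
  thus ?thesis using assms by simp
qed

lemma gen_inv [simp]: "s \<in> S \<Longrightarrow> inv s = s"
  by (rule inv_equality) auto

lemma gen_cancel [simp]: "s \<in> S \<Longrightarrow> x \<in> carrier W \<Longrightarrow> s \<otimes> (s \<otimes> x) = x"
  by (metis gen_closed gen_square l_one m_assoc)

lemma gen_cancel_right [simp]: "s \<in> S \<Longrightarrow> x \<in> carrier W \<Longrightarrow> x \<otimes> s \<otimes> s = x"
  by (simp add: m_assoc)

lemma ex_word: assumes "w \<in> carrier W" shows "\<exists>xs. set xs \<subseteq> S \<and> wp xs = w"
proof -
  have "w \<in> generate W S" using assms gens_generate by simp
  thus ?thesis
  proof induction
    case one show ?case by (intro exI[of _ "[]"]) auto
  next
    case (incl h) thus ?case by (intro exI[of _ "[h]"]) auto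
  next
    case (inv h) thus ?case by (intro exI[of _ "[h]"]) auto
  next
    case (eng g h)
    then obtain xs ys where "set xs \<subseteq> S" "set ys \<subseteq> S" "wp xs = g" "wp ys = h" by blast
    thus ?case by (intro exI[of _ "xs @ ys"]) (auto simp: wp_append)
  qed
qed

lemma reduced_word_iff: "reduced_word W S xs v \<longleftrightarrow> set xs \<subseteq> S \<and> wp xs = v \<and> length xs = len v"
  by (simp add: reduced_word_def)

lemma ex_reduced: assumes "w \<in> carrier W" shows "\<exists>xs. set xs \<subseteq> S \<and> wp xs = w \<and> length xs = len w"
  unfolding cox_length_def
  using LeastI_ex[of "\<lambda>n. \<exists>xs\<in>lists S. length xs = n \<and> wp xs = w"] ex_word[OF assms]
  by (auto simp: Bex_def)

lemma len_le: "set xs \<subseteq> S \<Longrightarrow> len (wp xs) \<le> length xs"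
  unfolding cox_length_def by (rule Least_le) auto

text \<open>
  Every defining relation has even length.
\<close>

lemma word_parity:
  assumes "set xs \<subseteq> S" "set ys \<subseteq> S" "wp xs = wp ys"
  shows "even (length xs + length ys)"
proof -
  obtain m where m: "coxeter_matrix S m"
    "\<And>xs ys. set xs \<subseteq> S \<Longrightarrow> set ys \<subseteq> S \<Longrightarrow> wp xs = wp ys \<longleftrightarrow> coxeter_cong S m xs ys"
    using presentation by (auto simp: Ball_def)
  have "coxeter_cong S m xs ys" using m(2) assms by blast
  thus ?thesis
    by induction (auto simp: length_concat sum_list_replicate)
qed

lemma len_parity: assumes "set xs \<subseteq> S" shows "even (len (wp xs) + length xs)"
proof -
  obtain ys where "set ys \<subseteq> S \<and> wp ys = wp xs \<and> length ys = len (wp xs)"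
    using ex_reduced[of "wp xs"] assms by auto
  thus ?thesis using word_parity[of ys xs] assms by auto
qed

lemma len_gen_le: assumes "w \<in> carrier W" "s \<in> S" shows "len (w \<otimes> s) \<le> len w + 1"
proof -
  obtain ys where "set ys \<subseteq> S \<and> wp ys = w \<and> length ys = len w" using ex_reduced assms by auto
  thus ?thesis using len_le[of "ys @ [s]"] assms by (auto simp: wp_append)
qed

lemma len_gen_le2: assumes "w \<in> carrier W" "s \<in> S" shows "len w \<le> len (w \<otimes> s) + 1"
  using len_gen_le[of "w \<otimes> s" s] assms by simp

definition conjug :: "'a \<Rightarrow> 'a \<Rightarrow> 'a" where
  "conjug g t = g \<otimes> t \<otimes> inv g"

lemma conjug_closed [simp]: "g \<in> carrier W \<Longrightarrow> t \<in> carrier W \<Longrightarrow> conjug g t \<in> carrier W"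
  by (simp add: conjug_def)

lemma conjug_mult [simp]:
  "g \<in> carrier W \<Longrightarrow> h \<in> carrier W \<Longrightarrow> t \<in> carrier W \<Longrightarrow> conjug (g \<otimes> h) t = conjug g (conjug h t)"
  by (simp add: conjug_def m_assoc inv_mult_group)

lemma conjug_one [simp]: "t \<in> carrier W \<Longrightarrow> conjug \<one> t = t"
  by (simp add: conjug_def)

lemma conjug_self [simp]: "g \<in> carrier W \<Longrightarrow> conjug g g = g"
  by (simp add: conjug_def m_assoc)

lemma conjug_inv_cancel [simp]: "g \<in> carrier W \<Longrightarrow> t \<in> carrier W \<Longrightarrow> conjug g (conjug (inv g) t) = t"
  using conjug_mult[of g "inv g" t] by simp

lemma conjug_inv_cancel2 [simp]: "g \<in> carrier W \<Longrightarrow> t \<in> carrier W \<Longrightarrow> conjug (inv g) (conjug g t) = t"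
  using conjug_mult[of "inv g" g t] by simp

lemma conjug_eq_iff:
  "g \<in> carrier W \<Longrightarrow> t \<in> carrier W \<Longrightarrow> x \<in> carrier W \<Longrightarrow> conjug g x = t \<longleftrightarrow> x = conjug (inv g) t"
  by auto

lemma conjug_involution:
  assumes "g \<in> carrier W" "s \<in> S" shows "conjug g s \<otimes> conjug g s = \<one>"
proof -
  have "conjug g s \<otimes> conjug g s = g \<otimes> (s \<otimes> (inv g \<otimes> g) \<otimes> s) \<otimes> inv g"
    using assms by (simp only: conjug_def m_assoc gen_closed inv_closed m_closed)
  thus ?thesis using assms by simp
qed

definition reflections :: "'a set" where
  "reflections = {conjug g s | g s. g \<in> carrier W \<and> s \<in> S}"

text \<open>
  The reflections \<open>s\<^sub>1 \<cdots> s\<^sub>i \<cdots> s\<^sub>1\<close> attached to the positions of a word. Left multiplication by the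
  \<open>i\<close>-th one deletes the \<open>i\<close>-th letter.
\<close>

fun refls :: "'a list \<Rightarrow> 'a list" where
  "refls [] = []"
| "refls (s # xs) = s # map (conjug s) (refls xs)"

lemma refls_closed: "set xs \<subseteq> S \<Longrightarrow> set (refls xs) \<subseteq> carrier W"
  by (induction xs) auto

lemma reflections_closed: "t \<in> reflections \<Longrightarrow> t \<in> carrier W"
  by (auto simp: reflections_def)

lemma map_conjug_mult:
  "g \<in> carrier W \<Longrightarrow> h \<in> carrier W \<Longrightarrow> set l \<subseteq> carrier W \<Longrightarrow>
    map (conjug (g \<otimes> h)) l = map (conjug g) (map (conjug h) l)"
  by (auto simp: subset_iff)

lemma map_conjug_one: "set l \<subseteq> carrier W \<Longrightarrow> map (conjug \<one>) l = l"
  by (auto intro!: map_idI)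

lemma refls_append:
  assumes "set xs \<subseteq> S" "set ys \<subseteq> S"
  shows "refls (xs @ ys) = refls xs @ map (conjug (wp xs)) (refls ys)"
  using assms(1)
proof (induction xs)
  case Nil
  thus ?case using refls_closed[OF assms(2)] by (simp add: map_conjug_one)
next
  case (Cons s xs)
  thus ?case using refls_closed[OF assms(2)] by (simp add: map_conjug_mult del: map_map)
qed

lemma count_conj:
  assumes "g \<in> carrier W" "t \<in> carrier W" "set l \<subseteq> carrier W"
  shows "count_list (map (conjug g) l) t = count_list l (conjug (inv g) t)"
  using assms(3)
proof (induction l)
  case (Cons x l)
  thus ?case using assms conjug_eq_iff[of g t x] by simp
qed auto

lemma refls_alternating:
  assumes "s \<in> S" "t \<in> S"
  shows "refls (concat (replicate m [s, t])) = map (\<lambda>i. (s \<otimes> t) [^] i \<otimes> s) [0..<2 * m]"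
proof (induction m)
  case (Suc m)
  have *: "conjug s (conjug t ((s \<otimes> t) [^] i \<otimes> s)) = (s \<otimes> t) [^] (Suc (Suc i)) \<otimes> s" for i :: nat
  proof -
    have "(s \<otimes> t) [^] (Suc (Suc i)) = (s \<otimes> t) \<otimes> (s \<otimes> t) [^] i \<otimes> (s \<otimes> t)"
      using assms by (metis gen_closed m_closed nat_pow_Suc nat_pow_Suc2)
    thus ?thesis using assms by (simp add: m_assoc conjug_def)
  qed
  have "[0..<2 * Suc m] = [0, 1] @ map (\<lambda>i. i + 2) [0..<2 * m]"
    unfolding map_add_upt by (simp add: upt_conv_Cons numeral_2_eq_2 del: upt_Suc)
  thus ?case using Suc assms *
    by (simp add: o_def conjug_def m_assoc del: upt_Suc nat_pow_Suc)
qed simp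

text \<open>
  When \<open>(st)^m = 1\<close>, the reflections \<open>(st)^i s\<close> of the relator are periodic in \<open>i\<close> with period \<open>m\<close>, and
  \<open>i\<close> runs through two periods.
\<close>

lemma refls_alternating_even:
  assumes "s \<in> S" "t \<in> S" "wp (concat (replicate m [s, t])) = \<one>"
  shows "even (count_list (refls (concat (replicate m [s, t]))) x)"
proof -
  have "wp (concat (replicate n [s, t])) = (s \<otimes> t) [^] n" for n
  proof (induction n)
    case (Suc n)
    have "wp (concat (replicate (Suc n) [s, t])) = (s \<otimes> t) \<otimes> (s \<otimes> t) [^] n"
      using assms(1,2) Suc by (simp add: m_assoc)
    thus ?case using assms(1,2) nat_pow_Suc2[of "s \<otimes> t" n] by simp
  qed simp
  hence 1: "(s \<otimes> t) [^] m = \<one>" using assms(3) by simp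
  have "[0..<2 * m] = [0..<m] @ map (\<lambda>i. i + m) [0..<m]"
    by (simp add: map_add_upt mult_2 upt_add_eq_append[of 0 m m])
  moreover have "(s \<otimes> t) [^] (i + m) = (s \<otimes> t) [^] i" for i
    using 1 assms by (simp add: nat_pow_mult[symmetric])
  ultimately have "refls (concat (replicate m [s, t])) =
     map (\<lambda>i. (s \<otimes> t) [^] i \<otimes> s) [0..<m] @ map (\<lambda>i. (s \<otimes> t) [^] i \<otimes> s) [0..<m]"
    using assms by (simp add: refls_alternating)
  thus ?thesis by simp
qed

text \<open>
  Inserting a relator into a word adds a conjugate of the reflections of the relator and leaves the
  other reflections unchanged, because the relator represents the identity. Those extra
  reflections have even multiplicities.
\<close>

lemma refls_parity:
  assumes "set xs \<subseteq> S" "set ys \<subseteq> S" "wp xs = wp ys" "t \<in> carrier W"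
  shows "even (count_list (refls xs) t) \<longleftrightarrow> even (count_list (refls ys) t)"
proof -
  obtain m where m: "coxeter_matrix S m"
    "\<And>xs ys. set xs \<subseteq> S \<Longrightarrow> set ys \<subseteq> S \<Longrightarrow> wp xs = wp ys \<longleftrightarrow> coxeter_cong S m xs ys"
    using presentation by (auto simp: Ball_def)
  have "coxeter_cong S m xs ys" using m(2) assms by blast
  thus ?thesis
  proof induction
    case (rel s t' xs ys)
    let ?R = "concat (replicate (m s t') [s, t'])"
    have R: "set ?R \<subseteq> S" using rel by (auto split: if_splits)
    have "coxeter_cong S m ?R []"
      using coxeter_cong.rel[of s S t' "[]" "[]" m] rel by simp
    hence one: "wp ?R = \<one>" using m(2)[of ?R "[]"] R by simp
    have xy: "set xs \<subseteq> S" "set ys \<subseteq> S" using rel by auto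
    have sub: "set (?R @ ys) \<subseteq> S" using R xy by simp
    have "refls (?R @ ys) = refls ?R @ refls ys"
      unfolding refls_append[OF R xy(2)] one using map_conjug_one[OF refls_closed[OF xy(2)]] by simp
    hence "refls (xs @ ?R @ ys) = refls xs @ map (conjug (wp xs)) (refls ?R) @ map (conjug (wp xs)) (refls ys)"
      unfolding refls_append[OF xy(1) sub] by simp
    hence "count_list (refls (xs @ ?R @ ys)) t = count_list (refls (xs @ ys)) t
       + count_list (refls ?R) (conjug (inv (wp xs)) t)"
      unfolding refls_append[OF xy] using xy assms(4) refls_closed[OF R]
      by (simp add: count_conj del: count_list_map_conv)
    thus ?case using refls_alternating_even[OF rel(1,2) one] by simp
  qed auto
qed

lemma delete_letter:
  assumes "set xs \<subseteq> S" "t \<in> set (refls xs)"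
  shows "\<exists>ys a zs. xs = ys @ a # zs \<and> t \<otimes> wp xs = wp (ys @ zs)"
  using assms
proof (induction xs arbitrary: t)
  case (Cons s xs)
  show ?case
  proof (cases "t = s")
    case True
    have "s \<in> S" "set xs \<subseteq> S" using Cons.prems by auto
    hence "t \<otimes> wp (s # xs) = wp ([] @ xs)" using True by simp
    thus ?thesis by (metis append_Nil)
  next
    case False
    then obtain t' where t': "t' \<in> set (refls xs)" "t = conjug s t'" using Cons.prems by auto
    then obtain ys a zs where *: "xs = ys @ a # zs" "t' \<otimes> wp xs = wp (ys @ zs)"
      using Cons.IH[of t'] Cons.prems by auto
    have "t' \<in> carrier W" using refls_closed[of xs] Cons.prems t' by auto
    hence "t \<otimes> wp (s # xs) = wp ((s # ys) @ zs)"
      using t' Cons.prems *(2) by (simp add: m_assoc conjug_def)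
    thus ?thesis using *(1) by (metis append_Cons)
  qed
qed simp

lemma wp_rev: "set ys \<subseteq> S \<Longrightarrow> wp (rev ys) = inv (wp ys)"
  by (induction ys) (auto simp: wp_append inv_mult_group)

lemma refls_rev:
  assumes "set ys \<subseteq> S" shows "map (conjug (wp ys)) (refls (rev ys)) = rev (refls ys)"
  using assms
proof (induction ys)
  case (Cons a ys)
  have a: "a \<in> S" "set ys \<subseteq> S" using Cons.prems by auto
  have c: "set (refls (rev ys)) \<subseteq> carrier W" "set (refls ys) \<subseteq> carrier W"
    using refls_closed[of "rev ys"] refls_closed[of ys] a by auto
  have "map (conjug (wp (a # ys))) (refls (rev (a # ys)))
    = map (conjug a) (map (conjug (wp ys)) (refls (rev ys) @ [conjug (inv (wp ys)) a]))"
    using a c by (simp add: refls_append wp_rev map_conjug_mult del: map_map)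
  thus ?case using Cons.IH a by (simp add: rev_map del: map_map)
qed simp

text \<open>
  The reflections of this palindrome are those of \<open>xs\<close>, then \<open>t\<close>, then the conjugates by \<open>t\<close> of those
  of \<open>xs\<close>. Conjugation by \<open>t\<close> fixes \<open>t\<close>, so \<open>t\<close> occurs equally often in the two outer parts.
\<close>

lemma count_reflection_word:
  assumes xs: "set xs \<subseteq> S" and s: "s \<in> S" and "t = conjug (wp xs) s"
  shows "odd (count_list (refls (xs @ s # rev xs)) t) \<and> wp (xs @ s # rev xs) = t"
proof -
  have c: "set (refls xs) \<subseteq> carrier W" "set (refls (rev xs)) \<subseteq> carrier W"
    using refls_closed[of xs] refls_closed[of "rev xs"] xs by auto
  have t: "t \<in> carrier W" using assms by auto
  have tx: "wp xs \<otimes> s = t \<otimes> wp xs" using assms by (simp add: conjug_def m_assoc)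
  have "refls (xs @ s # rev xs) = refls (xs @ [s]) @ map (conjug (wp (xs @ [s]))) (refls (rev xs))"
    using refls_append[of "xs @ [s]" "rev xs"] assms by simp
  also have "wp (xs @ [s]) = t \<otimes> wp xs" using xs s tx by (simp add: wp_append)
  also have "map (conjug (t \<otimes> wp xs)) (refls (rev xs)) = map (conjug t) (rev (refls xs))"
    using xs t c refls_rev[OF xs] by (simp add: map_conjug_mult del: map_map)
  also have "refls (xs @ [s]) = refls xs @ [t]"
    using assms by (simp add: refls_append)
  finally have "count_list (refls (xs @ s # rev xs)) t = count_list (refls xs) t + 1 + count_list (rev (refls xs)) t"
    using t c conjug_inv_cancel2[of t t] by (simp add: count_conj del: rev_map)
  moreover have "wp (xs @ s # rev xs) = t"
    using assms by (simp add: wp_append_Cons wp_rev m_assoc conjug_def)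
  ultimately show ?thesis by simp
qed

text \<open>
  Left multiplication by \<open>t\<close> flips the parity of the occurrences of \<open>t\<close>, since a palindrome for \<open>t\<close>
  contains it an odd number of times. Hence \<open>t\<close> occurs in the words of \<open>w\<close> or in those of \<open>tw\<close>; the
  latter would allow a letter to be deleted from a reduced word of \<open>tw\<close> to reach \<open>w\<close>, which is longer.
\<close>

theorem strong_exchange:
  assumes "t \<in> reflections" "set xs \<subseteq> S" "len (t \<otimes> wp xs) < len (wp xs)"
  shows "\<exists>ys a zs. xs = ys @ a # zs \<and> t \<otimes> wp xs = wp (ys @ zs)"
proof -
  obtain g s where g: "g \<in> carrier W" and s: "s \<in> S" "t = conjug g s"
    using assms by (auto simp: reflections_def)
  then obtain gs where gs: "set gs \<subseteq> S" "wp gs = g" using ex_word by blast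
  let ?z = "gs @ s # rev gs"
  have z: "odd (count_list (refls ?z) t)" "wp ?z = t" "set ?z \<subseteq> S"
    using count_reflection_word[OF gs(1) s(1)] gs s by auto
  have t: "t \<in> carrier W" "t \<otimes> t = \<one>"
    using s g conjug_involution by auto
  have itt: "conjug (inv t) t = t" using conjug_inv_cancel2[of t t] t by simp
  obtain vs where vs: "set vs \<subseteq> S" "wp vs = t \<otimes> wp xs" "length vs = len (t \<otimes> wp xs)"
    using ex_reduced[of "t \<otimes> wp xs"] assms t by auto
  have zx: "set (?z @ xs) \<subseteq> S" "wp vs = wp (?z @ xs)"
    using z(2,3) vs(2) assms(2) wp_append[OF z(3) assms(2)] by auto
  have "even (count_list (refls vs) t) \<longleftrightarrow> even (count_list (refls (?z @ xs)) t)"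
    using refls_parity[OF vs(1) zx t(1)] .
  also have "count_list (refls (?z @ xs)) t = count_list (refls ?z) t + count_list (refls xs) t"
    unfolding refls_append[OF z(3) assms(2)] z(2)
    using t itt refls_closed[OF assms(2)] by (simp add: count_conj)
  finally have par: "even (count_list (refls vs) t) \<longleftrightarrow> odd (count_list (refls xs) t)"
    using z by simp
  show ?thesis
  proof (cases "t \<in> set (refls xs)")
    case True thus ?thesis using delete_letter assms by blast
  next
    case False
    hence "t \<in> set (refls vs)" using par by (metis count_list_0_iff even_zero)
    then obtain ys a zs where *: "vs = ys @ a # zs" "t \<otimes> wp vs = wp (ys @ zs)"
      using delete_letter vs by blast
    have "t \<otimes> wp vs = wp xs" using vs(2) t assms by (simp add: m_assoc[symmetric])
    hence "len (wp xs) \<le> length (ys @ zs)" using * vs len_le[of "ys @ zs"] by auto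
    also have "\<dots> < length vs" using * by simp
    finally show ?thesis using vs assms by simp
  qed
qed

abbreviation B :: "'a rel" where "B \<equiv> bruhat W S"

lemma subseq_set: "subseq xs ys \<Longrightarrow> set ys \<subseteq> S \<Longrightarrow> set xs \<subseteq> S"
  using set_nths_subset by (fastforce simp: subseq_conv_nths)

lemma subseq_delete: "subseq (xs @ ys) (xs @ a # ys)"
  by (simp add: subseq_append' subseq_Cons')

lemma reflection_right: assumes "g \<in> carrier W" "s \<in> S"
  shows "conjug g s \<in> reflections" "conjug g s \<otimes> g = g \<otimes> s"
  using assms by (force simp: reflections_def) (use assms in \<open>simp add: conjug_def m_assoc\<close>)

lemma reflection_cancel: assumes "t \<in> reflections" "g \<in> carrier W" shows "t \<otimes> (t \<otimes> g) = g"
proof -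
  have t: "t \<in> carrier W" "t \<otimes> t = \<one>" using assms conjug_involution by (auto simp: reflections_def)
  have "t \<otimes> (t \<otimes> g) = t \<otimes> t \<otimes> g" using t(1) assms(2) by (simp add: m_assoc)
  thus ?thesis using t assms by simp
qed

lemma reflection_len_parity:
  assumes "t \<in> reflections" "g \<in> carrier W" shows "odd (len (t \<otimes> g) + len g)"
proof -
  obtain h s where h: "h \<in> carrier W" "s \<in> S" "t = conjug h s" using assms by (auto simp: reflections_def)
  obtain hs where hs: "set hs \<subseteq> S" "wp hs = h" using ex_word h by blast
  obtain gs where gs: "set gs \<subseteq> S" "wp gs = g" using ex_word assms by blast
  let ?t = "hs @ s # rev hs"
  have t: "set ?t \<subseteq> S" "wp ?t = t" using count_reflection_word[of hs s t] hs h by auto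
  have "wp (?t @ gs) = t \<otimes> g" using wp_append[OF t(1) gs(1)] t gs by simp
  hence "even (len (t \<otimes> g) + length (?t @ gs))" using len_parity[of "?t @ gs"] t gs by simp
  moreover have "even (len g + length gs)" using len_parity[of gs] gs by simp
  ultimately show ?thesis by auto
qed

lemma len_gen_parity: assumes "g \<in> carrier W" "s \<in> S" shows "odd (len (g \<otimes> s) + len g)"
  using reflection_len_parity[OF reflection_right(1)[OF assms] assms(1)] reflection_right(2)[OF assms] by simp

lemma len_gen_cases:
  assumes "g \<in> carrier W" "s \<in> S"
  shows "len (g \<otimes> s) = len g + 1 \<or> len g = len (g \<otimes> s) + 1"
  using len_gen_parity[OF assms] len_gen_le[OF assms] len_gen_le2[OF assms] by presburger

text \<open>
  The deletion property, obtained by building the word letter by letter: either the new letter lengthens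
  the element, or exchange removes a letter already present.
\<close>

lemma reduced_subword:
  assumes "set xs \<subseteq> S"
  shows "\<exists>ys. subseq ys xs \<and> wp ys = wp xs \<and> length ys = len (wp xs)"
  using assms
proof (induction xs rule: rev_induct)
  case Nil
  show ?case using len_le[of "[]"] by simp
next
  case (snoc s xs)
  hence s: "s \<in> S" "set xs \<subseteq> S" by auto
  obtain ys where ys: "subseq ys xs" "wp ys = wp xs" "length ys = len (wp xs)" using snoc by auto
  have yS: "set ys \<subseteq> S" using subseq_set ys s by blast
  let ?w = "wp xs"
  have w: "?w \<in> carrier W" using s by simp
  consider "len (?w \<otimes> s) = len ?w + 1" | "len ?w = len (?w \<otimes> s) + 1" using len_gen_cases w s by blast
  thus ?case
  proof cases
    case 1
    thus ?thesis using ys s yS by (intro exI[of _ "ys @ [s]"]) (auto simp: wp_append)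
  next
    case 2
    have "\<exists>as a bs. ys = as @ a # bs \<and> conjug ?w s \<otimes> wp ys = wp (as @ bs)"
      using strong_exchange[OF reflection_right(1)[OF w s(1)] yS] reflection_right(2)[OF w s(1)] 2 ys by simp
    then obtain as a bs where ab: "ys = as @ a # bs" "?w \<otimes> s = wp (as @ bs)"
      using reflection_right(2)[OF w s(1)] ys by auto
    have "subseq (as @ bs) ys" unfolding ab(1) by (rule subseq_delete)
    hence "subseq (as @ bs) xs" using ys(1) by (rule subseq_order.order_trans)
    hence 1: "subseq (as @ bs) (xs @ [s])" by (rule subseq_rev_drop_many)
    have 3: "wp (as @ bs) = wp (xs @ [s])" using ab(2) s by (simp add: wp_append)
    have "length (as @ bs) = len (?w \<otimes> s)" using ab(1) ys(3) 2 by simp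
    thus ?thesis using 1 3 ab(2) by metis
  qed
qed

section \<open>The Bruhat order as a reflection order\<close>

text \<open>
  The edges of the Bruhat graph. Their reflexive transitive closure turns out to be the subword order,
  and unlike the latter it does not refer to a choice of reduced words.
\<close>

definition refl_step :: "'a rel" where
  "refl_step = {(v, t \<otimes> v) | v t. v \<in> carrier W \<and> t \<in> reflections \<and> len v < len (t \<otimes> v)}"

lemma refl_stepI: "v \<in> carrier W \<Longrightarrow> t \<in> reflections \<Longrightarrow> len v < len (t \<otimes> v) \<Longrightarrow> (v, t \<otimes> v) \<in> refl_step"
  by (auto simp: refl_step_def)

lemma refl_stepE:
  assumes "(x, y) \<in> refl_step"
  obtains t where "t \<in> reflections" "x \<in> carrier W" "y \<in> carrier W" "y = t \<otimes> x" "x = t \<otimes> y" "len x < len y"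
proof -
  obtain t where t: "y = t \<otimes> x" "x \<in> carrier W" "t \<in> reflections" "len x < len (t \<otimes> x)"
    using assms unfolding refl_step_def by blast
  have "y \<in> carrier W" unfolding t(1) using t(2) reflections_closed[OF t(3)] by simp
  moreover have "x = t \<otimes> y" unfolding t(1) using reflection_cancel[OF t(3,2)] by simp
  ultimately show thesis using that[OF t(3,2) _ t(1)] t(4) unfolding t(1)[symmetric] by blast
qed

lemma refl_step_right:
  assumes "g \<in> carrier W" "s \<in> S" "len g < len (g \<otimes> s)" shows "(g, g \<otimes> s) \<in> refl_step"
  using refl_stepI[OF assms(1) reflection_right(1)[OF assms(1,2)]] reflection_right(2)[OF assms(1,2)] assms by simp

lemma refl_steps_len: "(x, y) \<in> refl_step\<^sup>* \<Longrightarrow> x = y \<or> len x < len y"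
  by (induction rule: rtrancl_induct) (auto simp: refl_step_def)

text \<open>
  Going down along an edge deletes a letter by strong exchange. The word need not be reduced, which is
  what lets the deletions be iterated.
\<close>

lemma refl_steps_subword:
  assumes "(x, y) \<in> refl_step\<^sup>*" "set ys \<subseteq> S" "wp ys = y"
  shows "\<exists>xs. subseq xs ys \<and> wp xs = x"
  using assms
proof (induction rule: converse_rtrancl_induct)
  case base thus ?case by auto
next
  case (step x z)
  then obtain zs where zs: "subseq zs ys" "wp zs = z" by auto
  have zS: "set zs \<subseteq> S" using subseq_set zs step by blast
  obtain t where t: "t \<in> reflections" "x = t \<otimes> z" "len x < len z" using step(1) by (rule refl_stepE)
  then obtain as a bs where ab: "zs = as @ a # bs" "x = wp (as @ bs)"
    using strong_exchange[OF t(1) zS] zs by blast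
  have "subseq (as @ bs) zs" unfolding ab(1) by (rule subseq_delete)
  hence "subseq (as @ bs) ys" using zs(1) by (rule subseq_order.order_trans)
  thus ?case using ab(2) by blast
qed

text \<open>
  Right multiplication by \<open>s\<close> preserves the reflection that labels an edge, so only the orientation is
  in doubt. If it is reversed, the lengths force \<open>y\<close> to have a reduced word ending in \<open>s\<close>; the deletion
  that leads to \<open>x\<close> must then remove this last letter, because otherwise \<open>x\<close> would also have
  \<open>s\<close> as a descent.
\<close>

lemma refl_step_mult:
  assumes "(x, y) \<in> refl_step" "s \<in> S"
  shows "(x \<otimes> s, y \<otimes> s) \<in> refl_step \<or> y = x \<otimes> s"
proof -
  obtain t where t: "t \<in> reflections" "x \<in> carrier W" "y \<in> carrier W" "y = t \<otimes> x" "x = t \<otimes> y" "len x < len y"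
    using assms(1) by (rule refl_stepE)
  have ys: "y \<otimes> s = t \<otimes> (x \<otimes> s)"
    unfolding t(4) using t(2) assms(2) reflections_closed[OF t(1)] by (simp add: m_assoc)
  show ?thesis
  proof (cases "len (x \<otimes> s) < len (y \<otimes> s)")
    case True
    thus ?thesis using refl_stepI[of "x \<otimes> s" t] t(1,2) assms(2) ys by simp
  next
    case False
    have "odd (len (y \<otimes> s) + len (x \<otimes> s))"
      using reflection_len_parity[of t "x \<otimes> s"] ys t(1,2) assms(2) by simp
    \<comment> \<open>The orientation is reversed, so both inequalities between adjacent lengths are tight.\<close>
    hence lt: "len (y \<otimes> s) < len (x \<otimes> s)" using False by (metis even_add linorder_neqE_nat)
    have l: "len (x \<otimes> s) = len x + 1" "len y = len x + 1" "len (y \<otimes> s) = len x"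
      using lt t(6) len_gen_le[of x s] len_gen_le2[of y s] t(2,3) assms(2) by auto
    obtain zs where zs: "set zs \<subseteq> S" "wp zs = y \<otimes> s" "length zs = len (y \<otimes> s)"
      using ex_reduced[of "y \<otimes> s"] t(3) assms(2) by auto
    have y: "wp (zs @ [s]) = y" "set (zs @ [s]) \<subseteq> S" using zs t(3) assms(2) by (auto simp: wp_append)
    have "len (t \<otimes> wp (zs @ [s])) < len (wp (zs @ [s]))" unfolding y(1) t(5)[symmetric] by (rule t(6))
    from strong_exchange[OF t(1) y(2) this] obtain as a bs
      where ab: "zs @ [s] = as @ a # bs" "x = wp (as @ bs)" unfolding y(1) t(5)[symmetric] by blast
    show ?thesis
    proof (cases bs rule: rev_cases)
      case Nil
      hence "x = y \<otimes> s" using ab zs by simp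
      thus ?thesis using t(3) assms(2) by simp
    next
      case (snoc cs c)
      hence c: "zs = as @ a # cs" "c = s" using ab(1) by (auto simp: append_eq_append_conv2 Cons_eq_append_conv)
      have S: "set (as @ cs) \<subseteq> S" using zs(1) c by auto
      have "x = wp (as @ cs) \<otimes> s" using ab(2) snoc c wp_append[OF S, of "[s]"] assms by simp
      hence "x \<otimes> s = wp (as @ cs)" using S assms by simp
      hence "len (x \<otimes> s) \<le> length (as @ cs)" using len_le[OF S] by simp
      thus ?thesis using c zs(3) l by simp
    qed
  qed
qed

lemma refl_steps_mult:
  assumes "(x, y) \<in> refl_step\<^sup>*" "y \<in> carrier W" "s \<in> S" "len y < len (y \<otimes> s)"
  shows "(x \<otimes> s, y \<otimes> s) \<in> refl_step\<^sup>*"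
  using assms(1)
proof (induction rule: converse_rtrancl_induct)
  case (step x z)
  from refl_step_mult[OF step(1) assms(3)] show ?case
  proof
    assume "z = x \<otimes> s"
    thus ?thesis using step(2) refl_step_right[OF assms(2-4)] by auto
  qed (use step in auto)
qed simp

lemma subword_refl_steps:
  assumes "set ys \<subseteq> S" "length ys = len (wp ys)" "subseq xs ys"
  shows "(wp xs, wp ys) \<in> refl_step\<^sup>*"
  using assms
proof (induction ys arbitrary: xs rule: rev_induct)
  case (snoc s ys)
  hence s: "s \<in> S" "set ys \<subseteq> S" by auto
  have l: "len (wp ys \<otimes> s) = length ys + 1" using snoc.prems s by (auto simp: wp_append)
  hence l2: "len (wp ys) = length ys"
    using len_gen_le[of "wp ys" s] len_le[OF s(2)] s by simp
  have up: "(wp ys, wp ys \<otimes> s) \<in> refl_step" using refl_step_right[of "wp ys" s] s l l2 by simp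
  obtain as bs where ab: "xs = as @ bs" "subseq as ys" "subseq bs [s]"
    using snoc.prems(3) by (auto elim: subseq_appendE)
  have IH: "(wp as, wp ys) \<in> refl_step\<^sup>*" using snoc.IH[OF s(2) l2[symmetric] ab(2)] .
  have aS: "set as \<subseteq> S" using subseq_set ab s by blast
  have "bs = [] \<or> bs = [s]" using ab(3) by (cases bs) (auto split: if_splits)
  thus ?case
  proof
    assume "bs = []" thus ?thesis using IH up ab s by (auto simp: wp_append)
  next
    assume "bs = [s]"
    thus ?thesis using refl_steps_mult[OF IH _ s(1)] ab s aS l l2 by (simp add: wp_append)
  qed
qed (auto dest: list_emb_Nil2)

text \<open>
  In particular the choice of the reduced word is immaterial, and transitivity becomes evident.
\<close>

lemma bruhat_iff: "(x, y) \<in> B \<longleftrightarrow> x \<in> carrier W \<and> y \<in> carrier W \<and> (x, y) \<in> refl_step\<^sup>*"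
proof
  assume "(x, y) \<in> B"
  then obtain xs ys where "set ys \<subseteq> S" "wp ys = y" "length ys = len y" "subseq xs ys" "set xs \<subseteq> S" "wp xs = x"
    unfolding bruhat_def reduced_word_iff by blast
  thus "x \<in> carrier W \<and> y \<in> carrier W \<and> (x, y) \<in> refl_step\<^sup>*"
    using subword_refl_steps[of ys xs] by auto
next
  assume *: "x \<in> carrier W \<and> y \<in> carrier W \<and> (x, y) \<in> refl_step\<^sup>*"
  then obtain ys where ys: "set ys \<subseteq> S" "wp ys = y" "length ys = len y" using ex_reduced by blast
  then obtain xs where xs: "subseq xs ys" "wp xs = x" using refl_steps_subword * by blast
  have xS: "set xs \<subseteq> S" using subseq_set xs ys by blast
  then obtain zs where zs: "subseq zs xs" "wp zs = x" "length zs = len x" using reduced_subword xs by blast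
  have "set zs \<subseteq> S" using subseq_set[OF zs(1) xS] .
  thus "(x, y) \<in> B" unfolding bruhat_def reduced_word_iff
    using ys zs subseq_order.order_trans[OF zs(1) xs(1)] by blast
qed

lemma bruhat_closed: "(x, y) \<in> B \<Longrightarrow> x \<in> carrier W \<and> y \<in> carrier W"
  by (simp add: bruhat_iff)

lemma bruhat_refl: "x \<in> carrier W \<Longrightarrow> (x, x) \<in> B"
  by (simp add: bruhat_iff)

lemma bruhat_trans: "(x, y) \<in> B \<Longrightarrow> (y, z) \<in> B \<Longrightarrow> (x, z) \<in> B"
  by (auto simp: bruhat_iff)

lemma bruhat_len: "(x, y) \<in> B \<Longrightarrow> x = y \<or> len x < len y"
  by (auto simp: bruhat_iff refl_steps_len)

lemma finite_bruhat_below: "finite {x. (x, y) \<in> B}"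
proof (cases "y \<in> carrier W")
  case True
  then obtain ys where ys: "set ys \<subseteq> S" "wp ys = y" using ex_word by blast
  have "{x. (x, y) \<in> B} \<subseteq> wp ` set (subseqs ys)"
    using refl_steps_subword ys by (fastforce simp: bruhat_iff)
  thus ?thesis by (rule finite_subset) simp
qed (auto simp: bruhat_iff)

section \<open>Lifting\<close>

lemma bruhat_up: "x \<in> carrier W \<Longrightarrow> s \<in> S \<Longrightarrow> len x < len (x \<otimes> s) \<Longrightarrow> (x, x \<otimes> s) \<in> B"
  using refl_step_right by (auto simp: bruhat_iff)

lemma bruhat_down: "x \<in> carrier W \<Longrightarrow> s \<in> S \<Longrightarrow> len (x \<otimes> s) < len x \<Longrightarrow> (x \<otimes> s, x) \<in> B"
  using bruhat_up[of "x \<otimes> s" s] by simp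

lemma bruhat_mult:
  "(x, y) \<in> B \<Longrightarrow> s \<in> S \<Longrightarrow> len y < len (y \<otimes> s) \<Longrightarrow> (x \<otimes> s, y \<otimes> s) \<in> B"
  using refl_steps_mult by (auto simp: bruhat_iff)

text \<open>
  A reduced word of \<open>y\<close> can be chosen to end in \<open>s\<close>; a subword for \<open>x\<close> either avoids this last
  letter or uses it.
\<close>

lemma bruhat_descent_cases:
  assumes "(x, y) \<in> B" "s \<in> S" "len (y \<otimes> s) < len y"
  shows "(x, y \<otimes> s) \<in> B \<or> (x \<otimes> s, y \<otimes> s) \<in> B"
proof -
  have c: "x \<in> carrier W" "y \<in> carrier W" using assms bruhat_closed by auto
  obtain zs where zs: "set zs \<subseteq> S" "wp zs = y \<otimes> s" "length zs = len (y \<otimes> s)"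
    using ex_reduced[of "y \<otimes> s"] c assms by auto
  have "set (zs @ [s]) \<subseteq> S" "wp (zs @ [s]) = y" using zs c assms by (auto simp: wp_append)
  then obtain xs where xs: "subseq xs (zs @ [s])" "wp xs = x"
    using refl_steps_subword assms by (metis bruhat_iff)
  obtain as bs where ab: "xs = as @ bs" "subseq as zs" "subseq bs [s]"
    using xs(1) by (auto elim: subseq_appendE)
  have aS: "set as \<subseteq> S" using subseq_set ab zs by blast
  have le: "(wp as, y \<otimes> s) \<in> B" using subword_refl_steps[of zs as] zs ab aS c assms by (simp add: bruhat_iff)
  have "bs = [] \<or> bs = [s]" using ab(3) by (cases bs) (auto split: if_splits)
  thus ?thesis using le xs ab aS assms by (auto simp: wp_append)
qed

lemma bruhat_mult_below:
  assumes "(x, y) \<in> B" "s \<in> S" "len (y \<otimes> s) < len y"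
  shows "(x \<otimes> s, y) \<in> B"
  using bruhat_descent_cases[OF assms]
proof
  assume "(x, y \<otimes> s) \<in> B"
  thus ?thesis using bruhat_mult[of x "y \<otimes> s" s] assms bruhat_closed by auto
next
  assume "(x \<otimes> s, y \<otimes> s) \<in> B"
  thus ?thesis using bruhat_down[of y s] assms bruhat_closed bruhat_trans by blast
qed

lemma bruhat_lift_down:
  assumes "(x, y) \<in> B" "s \<in> S" "len (y \<otimes> s) < len y" "len x < len (x \<otimes> s)"
  shows "(x, y \<otimes> s) \<in> B"
  using bruhat_descent_cases[OF assms(1-3)] bruhat_up[of x s] assms bruhat_closed bruhat_trans by blast

lemma bruhat_lift_both:
  assumes "(x, y) \<in> B" "s \<in> S" "len (y \<otimes> s) < len y" "len (x \<otimes> s) < len x"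
  shows "(x \<otimes> s, y \<otimes> s) \<in> B"
  using bruhat_descent_cases[OF assms(1-3)] bruhat_down[of x s] assms bruhat_closed bruhat_trans by blast

text \<open>
  Gradedness of the Bruhat order. Choose a descent \<open>s\<close> of \<open>y\<close>. If \<open>s\<close> is an ascent of \<open>x\<close>, then \<open>ys\<close>
  lies strictly between. Otherwise an element between \<open>xs\<close> and \<open>ys\<close> exists by induction and is
  lifted back.
\<close>

lemma bruhat_gap:
  assumes "(x, y) \<in> B" "len x + 1 < len y"
  shows "\<exists>z. (x, z) \<in> B \<and> (z, y) \<in> B \<and> z \<noteq> x \<and> z \<noteq> y"
  using assms
proof (induction "len y" arbitrary: x y rule: less_induct)
  case less
  have c: "x \<in> carrier W" "y \<in> carrier W" using less.prems bruhat_closed by auto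
  obtain ys where ys: "set ys \<subseteq> S" "wp ys = y" "length ys = len y" using ex_reduced c by blast
  have "ys \<noteq> []" using ys less.prems by auto
  then obtain zs s where zs: "ys = zs @ [s]" by (metis rev_exhaust)
  have s: "s \<in> S" "set zs \<subseteq> S" using ys zs by auto
  hence "y \<otimes> s = wp zs" using ys zs by (auto simp: wp_append)
  hence ly: "len (y \<otimes> s) < len y" using len_le[OF s(2)] ys zs by simp
  have ysc: "y \<otimes> s \<in> carrier W" using c s by simp
  have below: "(y \<otimes> s, y) \<in> B" using bruhat_down c s ly by blast
  consider "len x < len (x \<otimes> s)" | "len (x \<otimes> s) < len x" using len_gen_cases[OF c(1) s(1)] by linarith
  thus ?case
  proof cases
    case 1
    have "len y \<le> len (y \<otimes> s) + 1" using len_gen_le2 c s by blast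
    hence "x \<noteq> y \<otimes> s" using less.prems(2) by auto
    thus ?thesis using bruhat_lift_down[OF less.prems(1) s(1) ly 1] below ly by auto
  next
    case 2
    have le: "(x \<otimes> s, y \<otimes> s) \<in> B" using bruhat_lift_both less.prems s ly 2 by blast
    have "len (x \<otimes> s) + 1 < len (y \<otimes> s)"
      using less.prems(2) len_gen_cases[OF c(1) s(1)] len_gen_cases[OF c(2) s(1)] ly 2 by linarith
    then obtain z where z: "(x \<otimes> s, z) \<in> B" "(z, y \<otimes> s) \<in> B" "z \<noteq> x \<otimes> s" "z \<noteq> y \<otimes> s"
      using less.hyps[OF ly le] by blast
    have zc: "z \<in> carrier W" using z bruhat_closed by blast
    consider "len z < len (z \<otimes> s)" | "len (z \<otimes> s) < len z" using len_gen_cases[OF zc s(1)] by linarith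
    thus ?thesis
    proof cases
      case 1
      have "(x \<otimes> s \<otimes> s, z \<otimes> s) \<in> B" using bruhat_mult[OF z(1) s(1) 1] .
      moreover have "(z \<otimes> s, y) \<in> B"
        using bruhat_mult_below[OF bruhat_trans[OF z(2) below] s(1) ly] .
      moreover have "z \<otimes> s \<noteq> x" "z \<otimes> s \<noteq> y" using z zc s by auto
      ultimately show ?thesis using c s by auto
    next
      case 2
      have xz: "(x, z) \<in> B" using bruhat_mult_below[OF z(1) s(1) 2] c s by simp
      have "(x, y \<otimes> s) \<in> B" "x \<noteq> y \<otimes> s"
        using bruhat_trans[OF xz z(2)] bruhat_len[OF z(2)] bruhat_len[OF xz] z(4) by auto
      thus ?thesis using below ly by auto
    qed
  qed
qed

end

section \<open>Expanding the ab-index over chains\<close>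

definition var_e :: ab_poly where "var_e = var_a - var_b"

text \<open>
  The contribution of a chain with set of ranks \<open>T\<close> to the \<open>ab\<close>-index.
\<close>

definition chain_wt :: "nat \<Rightarrow> nat set \<Rightarrow> ab_poly" where
  "chain_wt n T = prod_list (map (\<lambda>i. if i \<in> T then var_b else var_e) [1..<n + 1])"

lemma chain_wt_Suc: "chain_wt (Suc n) T = chain_wt n (T - {Suc n}) * (if Suc n \<in> T then var_b else var_e)"
proof -
  have "map (\<lambda>i. if i \<in> T then var_b else var_e) [1..<n + 1] = map (\<lambda>i. if i \<in> T - {Suc n} then var_b else var_e) [1..<n + 1]"
    by (rule map_cong) auto
  hence "chain_wt n T = chain_wt n (T - {Suc n})" by (simp only: chain_wt_def)
  thus ?thesis by (simp add: chain_wt_def)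
qed

lemma ab_monom_Suc: "T \<subseteq> {1..n} \<Longrightarrow> ab_monom (Suc n) T = ab_monom n T * var_a"
  by (auto simp: ab_monom_def)

lemma ab_monom_insert: "T \<subseteq> {1..n} \<Longrightarrow> ab_monom (Suc n) (insert (Suc n) T) = ab_monom n T * var_b"
proof -
  have "map (\<lambda>i. if i \<in> insert (Suc n) T then var_b else var_a) [1..<n + 1] = map (\<lambda>i. if i \<in> T then var_b else var_a) [1..<n + 1]"
    by (rule map_cong) auto
  hence "ab_monom n (insert (Suc n) T) = ab_monom n T" by (simp only: ab_monom_def)
  thus ?thesis by (simp add: ab_monom_def)
qed

text \<open>
  Inclusion-exclusion in each position outside \<open>U\<close> separately: the position contributes \<open>a\<close> if it is not
  chosen and \<open>- b\<close> if it is, hence \<open>e = a - b\<close> in total.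
\<close>

lemma sum_supersets_monom:
  assumes "U \<subseteq> {1..n}"
  shows "(\<Sum>T\<in>{T \<in> Pow {1..n}. U \<subseteq> T}. (- 1) ^ card (T - U) * ab_monom n T) = chain_wt n U"
  using assms
proof (induction n arbitrary: U)
  case 0
  hence "{T \<in> Pow {1..0::nat}. U \<subseteq> T} = {{}}" "U = {}" by auto
  thus ?case by (simp add: ab_monom_def chain_wt_def)
next
  case (Suc n)
  have Icc: "{1..Suc n} = insert (Suc n) {1..n}" by auto
  define F where "F = {T \<in> Pow {1..n}. U - {Suc n} \<subseteq> T}"
  have F: "finite F" "\<And>T. T \<in> F \<Longrightarrow> T \<subseteq> {1..n}" "\<And>T. T \<in> F \<Longrightarrow> Suc n \<notin> T" "\<And>T. T \<in> F \<Longrightarrow> finite T"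
    unfolding F_def by (auto intro: finite_subset)
  have IH: "(\<Sum>T\<in>F. (- 1) ^ card (T - (U - {Suc n})) * ab_monom n T) = chain_wt n (U - {Suc n})"
    unfolding F_def by (rule Suc.IH) (use Suc.prems Icc in blast)
  have inj: "inj_on (insert (Suc n)) F"
    using F(3) by (auto intro!: inj_onI simp: insert_ident)
  have ins: "T \<in> insert (Suc n) ` F \<longleftrightarrow> T \<in> Pow {1..Suc n} \<and> U \<subseteq> T \<and> Suc n \<in> T" for T
  proof
    assume T: "T \<in> Pow {1..Suc n} \<and> U \<subseteq> T \<and> Suc n \<in> T"
    hence "T = insert (Suc n) (T - {Suc n})" by blast
    moreover have "T - {Suc n} \<in> F" unfolding F_def using T Icc by blast
    ultimately show "T \<in> insert (Suc n) ` F" by (rule image_eqI)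
  next
    assume "T \<in> insert (Suc n) ` F"
    thus "T \<in> Pow {1..Suc n} \<and> U \<subseteq> T \<and> Suc n \<in> T" unfolding F_def Icc by blast
  qed
  show ?case
  proof (cases "Suc n \<in> U")
    case True
    have eq: "{T \<in> Pow {1..Suc n}. U \<subseteq> T} = insert (Suc n) ` F"
      by (intro Set.set_eqI, unfold ins mem_Collect_eq) (use True in blast)
    have "(\<Sum>T\<in>{T \<in> Pow {1..Suc n}. U \<subseteq> T}. (- 1) ^ card (T - U) * ab_monom (Suc n) T)
      = (\<Sum>T\<in>F. (- 1) ^ card (insert (Suc n) T - U) * ab_monom (Suc n) (insert (Suc n) T))"
      unfolding eq sum.reindex[OF inj] by (simp only: o_def)
    also have "\<dots> = (\<Sum>T\<in>F. (- 1) ^ card (T - (U - {Suc n})) * ab_monom n T * var_b)"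
    proof (rule sum.cong[OF HOL.refl])
      fix T assume T: "T \<in> F"
      have "insert (Suc n) T - U = T - (U - {Suc n})" using F(3)[OF T] True by auto
      thus "(- 1) ^ card (insert (Suc n) T - U) * ab_monom (Suc n) (insert (Suc n) T)
        = (- 1) ^ card (T - (U - {Suc n})) * ab_monom n T * var_b"
        using ab_monom_insert[OF F(2)[OF T]] by (simp add: mult.assoc)
    qed
    finally show ?thesis using IH True by (simp add: sum_distrib_right[symmetric] chain_wt_Suc)
  next
    case False
    have Fdis: "F \<inter> insert (Suc n) ` F = {}" using F(3) by auto
    have eq: "{T \<in> Pow {1..Suc n}. U \<subseteq> T} = F \<union> insert (Suc n) ` F"
    proof -
      have "T \<in> F \<longleftrightarrow> T \<in> Pow {1..Suc n} \<and> U \<subseteq> T \<and> Suc n \<notin> T" for T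
        using False Icc unfolding F_def by auto
      thus ?thesis by (intro Set.set_eqI, unfold Un_iff ins mem_Collect_eq) blast
    qed
    have "(\<Sum>T\<in>{T \<in> Pow {1..Suc n}. U \<subseteq> T}. (- 1) ^ card (T - U) * ab_monom (Suc n) T)
      = (\<Sum>T\<in>F. (- 1) ^ card (T - U) * ab_monom (Suc n) T)
       + (\<Sum>T\<in>F. (- 1) ^ card (insert (Suc n) T - U) * ab_monom (Suc n) (insert (Suc n) T))"
      unfolding eq sum.union_disjoint[OF F(1) finite_imageI[OF F(1)] Fdis] sum.reindex[OF inj] by (simp only: o_def)
    also have "(\<Sum>T\<in>F. (- 1) ^ card (T - U) * ab_monom (Suc n) T)
      = (\<Sum>T\<in>F. (- 1) ^ card (T - (U - {Suc n})) * ab_monom n T * var_a)"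
      using ab_monom_Suc F(2) False by (intro sum.cong) (auto simp: mult.assoc)
    also have "(\<Sum>T\<in>F. (- 1) ^ card (insert (Suc n) T - U) * ab_monom (Suc n) (insert (Suc n) T))
      = (\<Sum>T\<in>F. (- 1) ^ card (T - (U - {Suc n})) * ab_monom n T * (- var_b))"
    proof (rule sum.cong[OF HOL.refl])
      fix T assume T: "T \<in> F"
      have "insert (Suc n) T - U = insert (Suc n) (T - (U - {Suc n}))" using False by auto
      hence "card (insert (Suc n) T - U) = Suc (card (T - (U - {Suc n})))"
        using F(3,4)[OF T] by simp
      thus "(- 1) ^ card (insert (Suc n) T - U) * ab_monom (Suc n) (insert (Suc n) T)
        = (- 1) ^ card (T - (U - {Suc n})) * ab_monom n T * (- var_b)"
        using ab_monom_insert[OF F(2)[OF T]] by (simp add: mult.assoc)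
    qed
    finally have "(\<Sum>T\<in>{T \<in> Pow {1..Suc n}. U \<subseteq> T}. (- 1) ^ card (T - U) * ab_monom (Suc n) T)
      = chain_wt n (U - {Suc n}) * var_a + chain_wt n (U - {Suc n}) * (- var_b)"
      unfolding sum_distrib_right[symmetric] IH .
    also have "\<dots> = chain_wt (Suc n) U" using False by (simp add: chain_wt_Suc var_e_def right_diff_distrib)
    finally show ?thesis .
  qed
qed

lemma sum_beta_monom:
  fixes \<alpha> :: "nat set \<Rightarrow> nat"
  shows "(\<Sum>T\<in>Pow {1..n}. of_int (\<Sum>U\<in>Pow T. (- 1) ^ card (T - U) * int (\<alpha> U)) * ab_monom n T)
    = (\<Sum>U\<in>Pow {1..n}. of_nat (\<alpha> U) * chain_wt n U)"
proof -
  have comm: "of_nat k * ((- 1) ^ m * x) = (- 1) ^ m * (of_nat k * x)" for k m and x :: ab_poly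
    by (cases "even m") auto
  have "(\<Sum>T\<in>Pow {1..n}. of_int (\<Sum>U\<in>Pow T. (- 1) ^ card (T - U) * int (\<alpha> U)) * ab_monom n T)
    = (\<Sum>T\<in>Pow {1..n}. \<Sum>U\<in>{U \<in> Pow {1..n}. U \<subseteq> T}. of_nat (\<alpha> U) * ((- 1) ^ card (T - U) * ab_monom n T))"
  proof (rule sum.cong[OF HOL.refl])
    fix T assume "T \<in> Pow {1..n}"
    hence "{U \<in> Pow {1..n}. U \<subseteq> T} = Pow T" by auto
    thus "of_int (\<Sum>U\<in>Pow T. (- 1) ^ card (T - U) * int (\<alpha> U)) * ab_monom n T
      = (\<Sum>U\<in>{U \<in> Pow {1..n}. U \<subseteq> T}. of_nat (\<alpha> U) * ((- 1) ^ card (T - U) * ab_monom n T))"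
      by (simp add: sum_distrib_right comm mult.assoc)
  qed
  also have "\<dots> = (\<Sum>U\<in>Pow {1..n}. \<Sum>T\<in>{T \<in> Pow {1..n}. U \<subseteq> T}. of_nat (\<alpha> U) * ((- 1) ^ card (T - U) * ab_monom n T))"
    by (rule sum.swap_restrict) auto
  also have "\<dots> = (\<Sum>U\<in>Pow {1..n}. of_nat (\<alpha> U) * chain_wt n U)"
  proof (rule sum.cong[OF HOL.refl])
    fix U assume "U \<in> Pow {1..n}"
    hence "(\<Sum>T\<in>{T \<in> Pow {1..n}. U \<subseteq> T}. (- 1) ^ card (T - U) * ab_monom n T) = chain_wt n U"
      by (intro sum_supersets_monom) simp
    thus "(\<Sum>T\<in>{T \<in> Pow {1..n}. U \<subseteq> T}. of_nat (\<alpha> U) * ((- 1) ^ card (T - U) * ab_monom n T))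
      = of_nat (\<alpha> U) * chain_wt n U"
      by (simp only: sum_distrib_left[symmetric])
  qed
  finally show ?thesis .
qed

lemma chain_wt_empty: "chain_wt n {} = var_e ^ n"
  by (induction n) (simp_all add: chain_wt_Suc power_Suc2 del: power_Suc, simp add: chain_wt_def)

lemma chain_wt_insert:
  assumes "U \<subseteq> {1..<k}" "1 \<le> k" "k \<le> n"
  shows "chain_wt n (insert k U) = chain_wt (k - 1) U * var_b * var_e ^ (n - k)"
  using assms(3)
proof (induction n rule: dec_induct)
  case base
  have "insert k U - {k} = U" using assms by auto
  thus ?case using chain_wt_Suc[of "k - 1" "insert k U"] assms by simp
next
  case (step n)
  have "insert k U - {Suc n} = insert k U" "Suc n \<notin> insert k U" using step assms by auto
  thus ?case using chain_wt_Suc[of n "insert k U"] step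
    by (simp add: Suc_diff_le power_Suc2 mult.assoc del: power_Suc)
qed

section \<open>Graded orders\<close>

text \<open>
  Being graded is expressed by a given rank function that is strictly monotone and has no jumps along the
  order. Intervals need not be treated as separate posets: their ranks are differences of \<open>\<rho>\<close>.
\<close>

locale graded_order =
  fixes r :: "'a rel" and \<rho> :: "'a \<Rightarrow> nat"
  assumes rrefl: "x \<in> Field r \<Longrightarrow> (x, x) \<in> r"
    and rtrans: "(x, y) \<in> r \<Longrightarrow> (y, z) \<in> r \<Longrightarrow> (x, z) \<in> r"
    and rmono: "(x, y) \<in> r \<Longrightarrow> x \<noteq> y \<Longrightarrow> \<rho> x < \<rho> y"
    and rgap: "(x, y) \<in> r \<Longrightarrow> \<rho> x + 1 < \<rho> y \<Longrightarrow> \<exists>z. (x, z) \<in> r \<and> (z, y) \<in> r \<and> z \<noteq> x \<and> z \<noteq> y"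
    and rfin: "finite (closed_ival r x y)"
begin

lemma rreflI: "(x, y) \<in> r \<Longrightarrow> (x, x) \<in> r" "(x, y) \<in> r \<Longrightarrow> (y, y) \<in> r"
  using rrefl by (auto simp: Field_def)

lemma rantisym: "(x, y) \<in> r \<Longrightarrow> (y, x) \<in> r \<Longrightarrow> x = y"
  by (metis rmono less_asym)

lemma rmono_le: "(x, y) \<in> r \<Longrightarrow> \<rho> x \<le> \<rho> y"
  using rmono by (cases "x = y") (auto intro: less_imp_le)

lemma open_ival_iff: "z \<in> open_ival r x y \<longleftrightarrow> (x, z) \<in> r \<and> (z, y) \<in> r \<and> z \<noteq> x \<and> z \<noteq> y"
  by (auto simp: open_ival_def closed_ival_def)

lemma finite_open_ival: "finite (open_ival r x y)"
  using rfin by (simp add: open_ival_def)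

lemma ival_iff: "(a, b) \<in> ival r x y \<longleftrightarrow> (x, a) \<in> r \<and> (a, b) \<in> r \<and> (b, y) \<in> r"
  by (auto simp: ival_def closed_ival_def intro: rtrans)

lemma ival_refl: "z \<in> closed_ival r x y \<Longrightarrow> (z, z) \<in> ival r x y"
  using rreflI(1)[of z y] by (simp add: closed_ival_def ival_iff)

lemma Field_ival: "Field (ival r x y) = closed_ival r x y"
proof
  show "Field (ival r x y) \<subseteq> closed_ival r x y"
    unfolding Field_def ival_def by auto
  show "closed_ival r x y \<subseteq> Field (ival r x y)"
    using ival_refl by (auto simp: Field_def)
qed

lemma ends_closed_ival:
  assumes "(x, y) \<in> r" shows "x \<in> closed_ival r x y" "y \<in> closed_ival r x y"
  using assms rreflI by (auto simp: closed_ival_def)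

lemma bot_of_ival: assumes "(x, y) \<in> r" shows "bot_of (ival r x y) = x"
  unfolding bot_of_def Field_ival
proof (rule the_equality)
  show "x \<in> closed_ival r x y \<and> (\<forall>z\<in>closed_ival r x y. (x, z) \<in> ival r x y)"
    using ends_closed_ival[OF assms] by (auto simp: ival_iff closed_ival_def)
  fix z assume "z \<in> closed_ival r x y \<and> (\<forall>z'\<in>closed_ival r x y. (z, z') \<in> ival r x y)"
  thus "z = x" using ends_closed_ival[OF assms] rantisym by (auto simp: ival_iff closed_ival_def)
qed

lemma top_of_ival: assumes "(x, y) \<in> r" shows "top_of (ival r x y) = y"
  unfolding top_of_def Field_ival
proof (rule the_equality)
  show "y \<in> closed_ival r x y \<and> (\<forall>z\<in>closed_ival r x y. (z, y) \<in> ival r x y)"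
    using ends_closed_ival[OF assms] by (auto simp: ival_iff closed_ival_def)
  fix z assume "z \<in> closed_ival r x y \<and> (\<forall>z'\<in>closed_ival r x y. (z', z) \<in> ival r x y)"
  thus "z = y" using ends_closed_ival[OF assms] rantisym by (auto simp: ival_iff closed_ival_def)
qed

lemma ex_max_rank:
  assumes "finite A" "A \<noteq> {}" shows "\<exists>t\<in>A. \<forall>t'\<in>A. \<rho> t' \<le> \<rho> t"
proof -
  have "Max (\<rho> ` A) \<in> \<rho> ` A" using assms by (intro Max_in) auto
  then obtain t where "t \<in> A" "\<rho> t = Max (\<rho> ` A)" by force
  moreover have "\<rho> t' \<le> Max (\<rho> ` A)" if "t' \<in> A" for t' using assms that by (intro Max_ge) auto
  ultimately show ?thesis by (intro bexI[of _ t]) auto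
qed

lemma ex_coatom:
  assumes "(x, z) \<in> r" "x \<noteq> z"
  shows "\<exists>t. (x, t) \<in> r \<and> (t, z) \<in> r \<and> \<rho> z = \<rho> t + 1"
proof -
  let ?A = "closed_ival r x z - {z}"
  have "finite ?A" "x \<in> ?A" using rfin assms rreflI by (auto simp: closed_ival_def)
  then obtain t where t: "t \<in> ?A" "\<And>t'. t' \<in> ?A \<Longrightarrow> \<rho> t' \<le> \<rho> t"
    using ex_max_rank[of ?A] by blast
  have t2: "(x, t) \<in> r" "(t, z) \<in> r" "t \<noteq> z" using t(1) by (auto simp: closed_ival_def)
  have "\<not> \<rho> t + 1 < \<rho> z"
  proof
    assume "\<rho> t + 1 < \<rho> z"
    then obtain t' where t': "(t, t') \<in> r" "(t', z) \<in> r" "t' \<noteq> t" "t' \<noteq> z" using rgap t2 by blast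
    hence "t' \<in> ?A" using rtrans[OF t2(1) t'(1)] by (auto simp: closed_ival_def)
    thus False using t(2)[of t'] rmono[OF t'(1)] t'(3) by auto
  qed
  thus ?thesis using t2 rmono[OF t2(2,3)] by (intro exI[of _ t]) auto
qed

text \<open>
  This chain attains the maximum in the definition of the rank.
\<close>

lemma ex_saturated_chain:
  assumes "(x, z) \<in> r"
  shows "\<exists>C. C \<subseteq> closed_ival r x z - {z} \<and> (\<forall>a\<in>C. \<forall>b\<in>C. (a, b) \<in> r \<or> (b, a) \<in> r) \<and> card C = \<rho> z - \<rho> x"
  using assms
proof (induction "\<rho> z" arbitrary: z rule: less_induct)
  case less
  show ?case
  proof (cases "x = z")
    case False
    then obtain t where t: "(x, t) \<in> r" "(t, z) \<in> r" "\<rho> z = \<rho> t + 1" using ex_coatom less.prems by blast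
    then obtain C where C: "C \<subseteq> closed_ival r x t - {t}" "\<forall>a\<in>C. \<forall>b\<in>C. (a, b) \<in> r \<or> (b, a) \<in> r" "card C = \<rho> t - \<rho> x"
      using less.hyps[of t] by auto
    have "finite C" "t \<notin> C" using C(1) rfin by (auto intro: finite_subset)
    hence "card (insert t C) = \<rho> z - \<rho> x" using C(3) t rmono_le[OF t(1)] by simp
    moreover have "insert t C \<subseteq> closed_ival r x z - {z}"
    proof -
      have "c \<in> closed_ival r x z - {z}" if "c \<in> C" for c
      proof -
        have "(x, c) \<in> r" "(c, t) \<in> r" using that C(1) by (auto simp: closed_ival_def)
        thus ?thesis using rtrans[OF _ t(2)] rmono_le[of c t] t(3) by (auto simp: closed_ival_def)
      qed
      thus ?thesis using t by (auto simp: closed_ival_def)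
    qed
    moreover have "\<forall>a\<in>insert t C. \<forall>b\<in>insert t C. (a, b) \<in> r \<or> (b, a) \<in> r"
      using C(1,2) rreflI t(2) by (auto simp: closed_ival_def)
    ultimately show ?thesis by blast
  qed (auto intro!: exI[of _ "{}"])
qed

lemma rank_of_ival:
  assumes "(x, z) \<in> r" "(z, y) \<in> r"
  shows "rank_of (ival r x y) z = \<rho> z - \<rho> x"
proof -
  let ?P = "{C \<in> Chains (ival r x y). C \<subseteq> {t. (t, z) \<in> ival r x y \<and> t \<noteq> z}}"
  have sub: "{t. (t, z) \<in> ival r x y \<and> t \<noteq> z} = closed_ival r x z - {z}"
    using assms by (auto simp: ival_iff closed_ival_def)
  have "?P \<subseteq> Pow (closed_ival r x z)" unfolding sub by blast
  hence fin: "finite ?P" by (rule finite_subset) (simp add: rfin)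
  obtain C where C: "C \<subseteq> closed_ival r x z - {z}" "\<forall>a\<in>C. \<forall>b\<in>C. (a, b) \<in> r \<or> (b, a) \<in> r" "card C = \<rho> z - \<rho> x"
    using ex_saturated_chain[OF assms(1)] by metis
  have "C \<in> ?P" unfolding sub Chains_def
    using C(1,2) rtrans[OF _ assms(2)] by (auto simp: ival_iff closed_ival_def)
  hence in_img: "\<rho> z - \<rho> x \<in> card ` ?P" by (rule rev_image_eqI) (use C(3) in simp)
  have "card D \<le> \<rho> z - \<rho> x" if "D \<in> ?P" for D
  proof -
    have D: "D \<subseteq> closed_ival r x z - {z}" "\<forall>a\<in>D. \<forall>b\<in>D. (a, b) \<in> r \<or> (b, a) \<in> r"
      using that unfolding sub Chains_def by (auto simp: ival_iff)
    have "inj_on \<rho> D"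
    proof (rule inj_onI)
      fix a b assume "a \<in> D" "b \<in> D" "\<rho> a = \<rho> b"
      thus "a = b" using D(2) rmono[of a b] rmono[of b a] by auto
    qed
    moreover have "\<rho> ` D \<subseteq> {\<rho> x..<\<rho> z}"
    proof clarify
      fix d assume "d \<in> D"
      hence "(x, d) \<in> r" "(d, z) \<in> r" "d \<noteq> z" using D(1) by (auto simp: closed_ival_def)
      thus "\<rho> d \<in> {\<rho> x..<\<rho> z}" using rmono_le[of x d] rmono[of d z] by simp
    qed
    ultimately have "card D \<le> card {\<rho> x..<\<rho> z}" by (rule card_inj_on_le) simp
    thus ?thesis by simp
  qed
  thus ?thesis unfolding rank_of_def using fin in_img by (intro Max_eqI) auto
qed

definition open_chains :: "'a \<Rightarrow> 'a \<Rightarrow> 'a set set" where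
  "open_chains x y = {C. C \<subseteq> open_ival r x y \<and> (\<forall>a\<in>C. \<forall>b\<in>C. (a, b) \<in> r \<or> (b, a) \<in> r)}"

lemma finite_open_chains: "finite (open_chains x y)"
  by (rule finite_subset[of _ "Pow (open_ival r x y)"]) (auto simp: open_chains_def finite_open_ival)

lemma Psi_chains:
  assumes xy: "(x, y) \<in> r"
  shows "Psi (ival r x y) = (\<Sum>C\<in>open_chains x y. chain_wt (\<rho> y - \<rho> x - 1) ((\<lambda>z. \<rho> z - \<rho> x) ` C))"
proof -
  let ?I = "ival r x y" and ?n = "\<rho> y - \<rho> x - 1" and ?f = "\<lambda>C. (\<lambda>z. \<rho> z - \<rho> x) ` C"
  have n: "rank_of ?I (top_of ?I) - 1 = ?n"
    using rank_of_ival[OF xy] rreflI(2)[OF xy] top_of_ival[OF xy] by simp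
  have mem: "z \<in> C \<Longrightarrow> C \<subseteq> open_ival r x y \<Longrightarrow> rank_of ?I z = \<rho> z - \<rho> x" for z C
    using rank_of_ival by (auto simp: open_ival_iff)
  have sets: "{C \<in> Chains ?I. C \<subseteq> Field ?I - {bot_of ?I, top_of ?I} \<and> rank_of ?I ` C = T}
     = {C \<in> open_chains x y. ?f C = T}" for T
  proof -
    have 1: "C \<in> Chains ?I \<and> C \<subseteq> Field ?I - {bot_of ?I, top_of ?I} \<longleftrightarrow> C \<in> open_chains x y" for C
      unfolding Field_ival bot_of_ival[OF xy] top_of_ival[OF xy] open_ival_def[symmetric] open_chains_def Chains_def
      by (auto simp: ival_iff open_ival_iff subset_iff)
    have 2: "rank_of ?I ` C = ?f C" if "C \<in> open_chains x y" for C
      using mem that unfolding open_chains_def by (intro image_cong) auto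
    show ?thesis by (rule Collect_cong) (use 1 2 in metis)
  qed
  have alpha: "flag_alpha ?I T = card {C \<in> open_chains x y. ?f C = T}" for T
    unfolding flag_alpha_def sets ..
  have "Psi ?I = (\<Sum>U\<in>Pow {1..?n}. of_nat (flag_alpha ?I U) * chain_wt ?n U)"
    unfolding Psi_def Let_def n flag_beta_def by (rule sum_beta_monom)
  also have "\<dots> = (\<Sum>U\<in>Pow {1..?n}. \<Sum>C\<in>{C \<in> open_chains x y. ?f C = U}. chain_wt ?n (?f C))"
    unfolding alpha by (intro sum.cong) auto
  also have "\<dots> = (\<Sum>C\<in>open_chains x y. chain_wt ?n (?f C))"
  proof (rule sum.group)
    show "?f ` open_chains x y \<subseteq> Pow {1..?n}"
    proof clarsimp
      fix C z assume "C \<in> open_chains x y" "z \<in> C"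
      hence "(x, z) \<in> r" "(z, y) \<in> r" "z \<noteq> x" "z \<noteq> y" by (auto simp: open_chains_def open_ival_iff)
      thus "Suc 0 \<le> \<rho> z - \<rho> x \<and> \<rho> z - \<rho> x \<le> \<rho> y - Suc (\<rho> x)"
        using rmono[of x z] rmono[of z y] by auto
    qed
  qed (simp_all add: finite_open_chains)
  finally show ?thesis .
qed

lemma Psi_point: "(x, x) \<in> r \<Longrightarrow> Psi (ival r x x) = 1"
proof -
  assume "(x, x) \<in> r"
  moreover have "open_ival r x x = {}"
    using rantisym by (fastforce simp: open_ival_iff)
  hence "open_chains x x = {{}}" by (auto simp: open_chains_def)
  ultimately show ?thesis by (simp add: Psi_chains chain_wt_empty)
qed

lemma open_chains_by_top:
  "open_chains x y = insert {} (\<Union>t\<in>open_ival r x y. insert t ` open_chains x t)"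
proof (intro Set.set_eqI iffI)
  fix C assume C: "C \<in> open_chains x y"
  show "C \<in> insert {} (\<Union>t\<in>open_ival r x y. insert t ` open_chains x t)"
  proof (cases "C = {}")
    case False
    have CC: "C \<subseteq> open_ival r x y" "\<forall>a\<in>C. \<forall>b\<in>C. (a, b) \<in> r \<or> (b, a) \<in> r"
      using C by (auto simp: open_chains_def)
    have "finite C" using CC(1) finite_open_ival finite_subset by blast
    then obtain t where t: "t \<in> C" "\<And>z. z \<in> C \<Longrightarrow> \<rho> z \<le> \<rho> t"
      using ex_max_rank[of C] False by blast
    have "C - {t} \<in> open_chains x t"
    proof -
      have "(z, t) \<in> r" if "z \<in> C" "z \<noteq> t" for z
        proof -
        have "(z, t) \<in> r \<or> (t, z) \<in> r" using CC(2) t(1) that(1) by blast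
        thus ?thesis using rmono[of t z] t(2)[OF that(1)] that(2) by auto
      qed
      thus ?thesis using CC unfolding open_chains_def by (auto simp: open_ival_iff subset_iff)
    qed
    moreover have "C = insert t (C - {t})" using t by auto
    ultimately show ?thesis using t(1) CC(1) by blast
  qed simp
next
  fix C assume "C \<in> insert {} (\<Union>t\<in>open_ival r x y. insert t ` open_chains x t)"
  thus "C \<in> open_chains x y"
  proof
    assume "C \<in> (\<Union>t\<in>open_ival r x y. insert t ` open_chains x t)"
    then obtain t D where t: "t \<in> open_ival r x y" "D \<in> open_chains x t" "C = insert t D" by blast
    have D: "z \<in> D \<Longrightarrow> (x, z) \<in> r \<and> (z, t) \<in> r \<and> z \<noteq> x \<and> z \<noteq> t" for z
      using t(2) by (auto simp: open_chains_def open_ival_iff)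
    have ty: "(t, y) \<in> r" "t \<noteq> y" using t(1) by (auto simp: open_ival_iff)
    have "z \<in> open_ival r x y" if "z \<in> D" for z
      using D[OF that] rtrans[of z t y] rmono[OF ty] rmono_le[of z t] ty unfolding open_ival_iff by auto
    hence "C \<subseteq> open_ival r x y" using t by blast
    moreover have "\<forall>a\<in>C. \<forall>b\<in>C. (a, b) \<in> r \<or> (b, a) \<in> r"
      using t(2,3) D rreflI(1)[OF ty(1)] unfolding open_chains_def by auto
    ultimately show ?thesis by (simp add: open_chains_def)
  qed (auto simp: open_chains_def)
qed

text \<open>
  The contribution of the empty chain of the open interval between \<open>x\<close> and \<open>y\<close>.
\<close>

definition E :: "'a \<Rightarrow> 'a \<Rightarrow> ab_poly" where
  "E x y = var_e ^ (\<rho> y - \<rho> x - 1)"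

text \<open>
  The chains are sorted by their largest element \<open>t\<close>; the positions above \<open>t\<close> are unoccupied.
\<close>

theorem Psi_rec:
  assumes xy: "(x, y) \<in> r" "x \<noteq> y"
  shows "Psi (ival r x y) = E x y + (\<Sum>t\<in>open_ival r x y. Psi (ival r x t) * var_b * E t y)"
proof -
  let ?n = "\<rho> y - \<rho> x - 1" and ?f = "\<lambda>C. (\<lambda>z. \<rho> z - \<rho> x) ` C"
  have notin: "t \<notin> D" if "D \<in> open_chains x t" for t D using that by (auto simp: open_chains_def open_ival_iff)
  have inj: "inj_on (insert t) (open_chains x t)" for t
    using notin by (auto intro!: inj_onI simp: insert_ident)
  have disj: "insert t ` open_chains x t \<inter> insert t' ` open_chains x t' = {}" if "t \<noteq> t'" for t t'
  proof (rule ccontr)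
    assume "\<not> ?thesis"
    then obtain D D' where D: "D \<in> open_chains x t" "D' \<in> open_chains x t'" "insert t D = insert t' D'" by blast
    hence "t \<in> D'" "t' \<in> D" using that by auto
    hence "(t, t') \<in> r" "(t', t) \<in> r" using D by (auto simp: open_chains_def open_ival_iff)
    thus False using rantisym that by blast
  qed
  have "Psi (ival r x y) = chain_wt ?n (?f {})
     + (\<Sum>C\<in>(\<Union>t\<in>open_ival r x y. insert t ` open_chains x t). chain_wt ?n (?f C))"
    unfolding Psi_chains[OF xy(1)] by (subst open_chains_by_top, subst sum.insert) (auto simp: finite_open_ival finite_open_chains)
  also have "(\<Sum>C\<in>(\<Union>t\<in>open_ival r x y. insert t ` open_chains x t). chain_wt ?n (?f C))
     = (\<Sum>t\<in>open_ival r x y. \<Sum>D\<in>open_chains x t. chain_wt ?n (?f (insert t D)))"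
    using disj by (subst sum.UNION_disjoint) (auto simp: finite_open_ival finite_open_chains sum.reindex[OF inj])
  also have "\<dots> = (\<Sum>t\<in>open_ival r x y. Psi (ival r x t) * var_b * E t y)"
  proof (rule sum.cong[OF HOL.refl])
    fix t assume "t \<in> open_ival r x y"
    hence t: "(x, t) \<in> r" "(t, y) \<in> r" "t \<noteq> x" "t \<noteq> y" by (auto simp: open_ival_iff)
    have r: "\<rho> x < \<rho> t" "\<rho> t < \<rho> y" using t rmono by auto
    have "chain_wt ?n (?f (insert t D)) = chain_wt (\<rho> t - \<rho> x - 1) (?f D) * var_b * E t y"
      if "D \<in> open_chains x t" for D
    proof -
      have "?f D \<subseteq> {1..<\<rho> t - \<rho> x}"
      proof clarsimp
        fix z assume "z \<in> D"
        hence "(x, z) \<in> r" "(z, t) \<in> r" "z \<noteq> x" "z \<noteq> t" using that by (auto simp: open_chains_def open_ival_iff)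
        thus "Suc 0 \<le> \<rho> z - \<rho> x \<and> \<rho> z - \<rho> x < \<rho> t - \<rho> x" using rmono[of x z] rmono[of z t] by auto
      qed
      thus ?thesis using chain_wt_insert[of "?f D" "\<rho> t - \<rho> x" ?n] r by (simp add: E_def)
    qed
    thus "(\<Sum>D\<in>open_chains x t. chain_wt ?n (?f (insert t D))) = Psi (ival r x t) * var_b * E t y"
      unfolding Psi_chains[OF t(1)] by (simp add: sum_distrib_right)
  qed
  finally show ?thesis by (simp add: chain_wt_empty E_def)
qed

end

text \<open>
  The hypotheses only concern the lower intervals \<open>[x,t]\<close>, which is all that the recursion for the
  \<open>ab\<close>-index refers to.
\<close>

lemma Psi_iso:
  assumes r: "graded_order r \<rho>" and r': "graded_order r' \<rho>'"
    and xy: "(x, y) \<in> r" and inj: "inj_on f (closed_ival r x y)"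
    and img: "\<And>t. t \<in> closed_ival r x y \<Longrightarrow> f ` closed_ival r x t = closed_ival r' (f x) (f t)"
    and rk: "\<And>t. t \<in> closed_ival r x y \<Longrightarrow> \<rho>' (f t) + \<rho> x = \<rho> t + \<rho>' (f x)"
  shows "Psi (ival r' (f x) (f y)) = Psi (ival r x y)"
proof -
  interpret R: graded_order r \<rho> by fact
  interpret R': graded_order r' \<rho>' by fact
  have "Psi (ival r' (f x) (f t)) = Psi (ival r x t)" if "t \<in> closed_ival r x y" for t
    using that
  proof (induction "\<rho> t" arbitrary: t rule: less_induct)
    case less
    have t: "(x, t) \<in> r" "(t, y) \<in> r" using less.prems by (auto simp: closed_ival_def)
    have "t \<in> closed_ival r x t" using R.rreflI t by (auto simp: closed_ival_def)
    hence ft: "(f x, f t) \<in> r'" using img[OF less.prems] by (auto simp: closed_ival_def)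
    have x: "x \<in> closed_ival r x y" using xy R.rreflI by (auto simp: closed_ival_def)
    have sub: "closed_ival r x t \<subseteq> closed_ival r x y" using t R.rtrans by (auto simp: closed_ival_def)
    show ?case
    proof (cases "t = x")
      case True
      thus ?thesis using R.Psi_point R'.Psi_point ft R.rreflI t by simp
    next
      case False
      hence ne: "f x \<noteq> f t" using inj less.prems x by (auto dest: inj_onD)
      have op: "open_ival r' (f x) (f t) = f ` open_ival r x t"
        unfolding open_ival_def img[OF less.prems, symmetric]
        using inj_on_image_set_diff[OF inj, of "closed_ival r x t" "{x, t}"] sub x less.prems by auto
      have inj': "inj_on f (open_ival r x t)" using inj sub by (rule_tac inj_on_subset) (auto simp: open_ival_def)
      have E: "R'.E (f a) (f b) = R.E a b" if "a \<in> closed_ival r x y" "b \<in> closed_ival r x y" for a b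
        using rk[OF that(1)] rk[OF that(2)] unfolding R.E_def R'.E_def by (intro arg_cong[of _ _ "\<lambda>n. var_e ^ n"]) linarith
      have "Psi (ival r' (f x) (f t)) = R'.E (f x) (f t) + (\<Sum>z\<in>open_ival r x t. Psi (ival r' (f x) (f z)) * var_b * R'.E (f z) (f t))"
        unfolding R'.Psi_rec[OF ft ne] op by (simp add: sum.reindex[OF inj'])
      also have "\<dots> = R.E x t + (\<Sum>z\<in>open_ival r x t. Psi (ival r x z) * var_b * R.E z t)"
      proof (intro arg_cong2[of _ _ _ _ "(+)"] sum.cong HOL.refl)
        show "R'.E (f x) (f t) = R.E x t" using E x less.prems by blast
        fix z assume z: "z \<in> open_ival r x t"
        have "z \<in> closed_ival r x y" using z sub by (auto simp: open_ival_def)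
        moreover have "\<rho> z < \<rho> t" using z R.rmono by (auto simp: R.open_ival_iff)
        ultimately show "Psi (ival r' (f x) (f z)) * var_b * R'.E (f z) (f t) = Psi (ival r x z) * var_b * R.E z t"
          using less.hyps[of z] E[of z t] less.prems by simp
      qed
      also have "\<dots> = Psi (ival r x t)" using R.Psi_rec[OF t(1)] False by auto
      finally show ?thesis .
    qed
  qed
  moreover have "y \<in> closed_ival r x y" using xy R.rreflI by (auto simp: closed_ival_def)
  ultimately show ?thesis by blast
qed

section \<open>Intervals under a doubling of the order\<close>

context graded_order
begin

abbreviation P :: "'a \<Rightarrow> 'a \<Rightarrow> ab_poly" where "P x y \<equiv> Psi (ival r x y)"

abbreviation lt :: "'a \<Rightarrow> 'a \<Rightarrow> bool" where "lt x y \<equiv> (x, y) \<in> r \<and> x \<noteq> y"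

lemma lt_trans: "lt x y \<Longrightarrow> lt y z \<Longrightarrow> lt x z"
  using rtrans[of x y z] rmono[of x y] rmono[of y z] by auto

lemma lt_le_trans: "lt x y \<Longrightarrow> (y, z) \<in> r \<Longrightarrow> lt x z"
  using lt_trans by blast

lemma le_lt_trans: "(x, y) \<in> r \<Longrightarrow> lt y z \<Longrightarrow> lt x z"
  using lt_trans by blast

lemma E_comm: "var_e * E x y = E x y * var_e"
  by (simp add: E_def power_commutes)

text \<open>
  The recursion for \<open>\<Psi>[x,y]\<close> is inserted under a sum over \<open>x\<close> and the two summations are exchanged.
\<close>

lemma sum_Psi_rec:
  assumes X: "finite X" "\<And>x t z. x \<in> X \<Longrightarrow> z \<in> X \<Longrightarrow> lt x t \<Longrightarrow> lt t z \<Longrightarrow> t \<in> X" and y: "y \<in> X"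
  shows "(\<Sum>x\<in>{x \<in> X. lt x y}. f x * P x y) =
    (\<Sum>x\<in>{x \<in> X. lt x y}. f x * E x y)
    + (\<Sum>t\<in>{t \<in> X. lt t y}. (\<Sum>x\<in>{x \<in> X. lt x t}. f x * P x t) * var_b * E t y)"
proof -
  let ?L = "{x \<in> X. lt x y}"
  have fin: "finite ?L" using X by simp
  have op: "open_ival r x y = {t \<in> ?L. lt x t}" if "x \<in> ?L" for x
    using that X(2)[of x y] y by (auto simp: open_ival_iff)
  have "(\<Sum>x\<in>?L. f x * P x y) = (\<Sum>x\<in>?L. f x * E x y + (\<Sum>t\<in>{t \<in> ?L. lt x t}. f x * P x t * var_b * E t y))"
  proof (rule sum.cong[OF HOL.refl])
    fix x assume x: "x \<in> ?L"
    hence "P x y = E x y + (\<Sum>t\<in>{t \<in> ?L. lt x t}. P x t * var_b * E t y)"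
      using Psi_rec[of x y] op[OF x] by simp
    thus "f x * P x y = f x * E x y + (\<Sum>t\<in>{t \<in> ?L. lt x t}. f x * P x t * var_b * E t y)"
      by (simp add: distrib_left sum_distrib_left mult.assoc)
  qed
  also have "\<dots> = (\<Sum>x\<in>?L. f x * E x y) + (\<Sum>x\<in>?L. \<Sum>t\<in>{t \<in> ?L. lt x t}. f x * P x t * var_b * E t y)"
    by (rule sum.distrib)
  also have "(\<Sum>x\<in>?L. \<Sum>t\<in>{t \<in> ?L. lt x t}. f x * P x t * var_b * E t y)
    = (\<Sum>t\<in>?L. \<Sum>x\<in>{x \<in> ?L. lt x t}. f x * P x t * var_b * E t y)"
    by (rule sum.swap_restrict[OF fin fin])
  also have "\<dots> = (\<Sum>t\<in>?L. (\<Sum>x\<in>{x \<in> X. lt x t}. f x * P x t) * var_b * E t y)"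
  proof (rule sum.cong[OF HOL.refl])
    fix t assume "t \<in> ?L"
    hence "{x \<in> ?L. lt x t} = {x \<in> X. lt x t}" using lt_trans by blast
    thus "(\<Sum>x\<in>{x \<in> ?L. lt x t}. f x * P x t * var_b * E t y) = (\<Sum>x\<in>{x \<in> X. lt x t}. f x * P x t) * var_b * E t y"
      by (simp only: sum_distrib_right)
  qed
  finally show ?thesis .
qed

text \<open>
  The element \<open>y\<close> of \<open>X\<close> stands for a possible pair \<open>(y,y')\<close> of a lower and an upper copy, where the
  \<open>y\<close> with \<open>D y\<close> (the descents) are not doubled. The value \<open>K y\<close> is the \<open>ab\<close>-index up to the
  upper copy \<open>y'\<close> and \<open>psi y\<close> the one up to the lower copy. In the recursion for \<open>K\<close>, the term
  \<open>psi x b e\<close> comes from chains whose last element is a lower copy, which is one rank further away from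
  \<open>y'\<close>, and \<open>K x b\<close> from those whose last element is an upper copy. The term \<open>eps\<close> collects
  what comes from the minimum.

  The proof rewrites the claimed expression by the recursions for \<open>\<Psi>[x,y]\<close> and for \<open>base\<close>. The
  induction hypothesis turns the coefficient of \<open>E(t,y)\<close> into \<open>K t b + psi t (ba - bb)\<close> at an
  element \<open>t\<close> that is not a descent and into \<open>psi t (cb - bb - ab) = 0\<close> at a descent.
\<close>

theorem doubling_formula:
  fixes base eps psi K :: "'a \<Rightarrow> ab_poly" and D :: "'a \<Rightarrow> bool"
  defines "g \<equiv> \<lambda>x. if D x then 0 else psi x * var_b * var_e + K x * var_b"
    and "f \<equiv> \<lambda>x. if D x then - (psi x * (var_a * var_b)) else psi x * (var_b * var_a)"
  assumes X: "finite X" "\<And>x t z. x \<in> X \<Longrightarrow> z \<in> X \<Longrightarrow> lt x t \<Longrightarrow> lt t z \<Longrightarrow> t \<in> X"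
    and base: "\<And>y. y \<in> X \<Longrightarrow> base y = eps y + (\<Sum>t\<in>{t \<in> X. lt t y}. base t * var_b * E t y)"
    and A: "\<And>y. y \<in> X \<Longrightarrow> \<not> D y \<Longrightarrow> K y = eps y + psi y * var_b + (\<Sum>x\<in>{x \<in> X. lt x y}. g x * E x y)"
    and D: "\<And>y. y \<in> X \<Longrightarrow> D y \<Longrightarrow> psi y * var_a = eps y + (\<Sum>x\<in>{x \<in> X. lt x y}. g x * E x y)"
    and y: "y \<in> X"
  shows "base y + psi y * var_b + (\<Sum>x\<in>{x \<in> X. lt x y}. f x * P x y) = (if D y then psi y * cd_c else K y)"
  using y
proof (induction "\<rho> y" arbitrary: y rule: less_induct)
  case less
  let ?L = "{x \<in> X. lt x y}"
  define S where "S t = (\<Sum>x\<in>{x \<in> X. lt x t}. f x * P x t)" for t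
  have IH: "base t + S t = (if D t then psi t * cd_c else K t) - psi t * var_b" if "t \<in> ?L" for t
    using less.hyps[of t] that rmono[of t y] unfolding S_def by (auto simp: algebra_simps)
  have step: "(base t + S t) * var_b + f t = g t" if "t \<in> ?L" for t
    unfolding IH[OF that] f_def g_def by (simp add: cd_c_def var_e_def algebra_simps)
  have rec: "S y = (\<Sum>t\<in>?L. f t * E t y) + (\<Sum>t\<in>?L. S t * var_b * E t y)"
    unfolding S_def by (rule sum_Psi_rec[OF X less.prems])
  have "base y + psi y * var_b + S y = eps y + psi y * var_b
      + ((\<Sum>t\<in>?L. base t * var_b * E t y) + ((\<Sum>t\<in>?L. f t * E t y) + (\<Sum>t\<in>?L. S t * var_b * E t y)))"
    unfolding base[OF less.prems] rec by (simp only: algebra_simps)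
  also have "(\<Sum>t\<in>?L. base t * var_b * E t y) + ((\<Sum>t\<in>?L. f t * E t y) + (\<Sum>t\<in>?L. S t * var_b * E t y))
      = (\<Sum>t\<in>?L. ((base t + S t) * var_b + f t) * E t y)"
    unfolding sum.distrib[symmetric] by (rule sum.cong[OF HOL.refl]) (simp only: algebra_simps)
  also have "\<dots> = (\<Sum>t\<in>?L. g t * E t y)"
    using step by (intro sum.cong HOL.refl) simp
  finally have "base y + psi y * var_b + S y = eps y + psi y * var_b + (\<Sum>t\<in>?L. g t * E t y)" .
  also have "\<dots> = (if D y then psi y * cd_c else K y)"
  proof (cases "D y")
    case True
    have "psi y * cd_c = psi y * var_a + psi y * var_b" by (simp add: cd_c_def distrib_left)
    thus ?thesis using D[OF less.prems True] True by (simp add: algebra_simps)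
  next
    case False
    thus ?thesis using A[OF less.prems False] by simp
  qed
  finally show ?case unfolding S_def .
qed

lemma finite_half_open: "finite {x. lt u x \<and> (x, w) \<in> r}"
  by (rule finite_subset[OF _ rfin[of u w]]) (auto simp: closed_ival_def)

text \<open>
  Equivalently, \<open>\<Sum>\<Psi>[u,x] (ba - ab) \<Psi>[x,y] = \<Psi>[u,y] e - e \<Psi>[u,y]\<close>, which is proved by induction on \<open>y\<close>:
  after inserting the recursion the coefficients cancel by \<open>eb - be = ab - ba\<close>.
\<close>

lemma Psi_flip:
  assumes "lt u y"
  shows "P u y * var_b + var_a * P u y + (\<Sum>x\<in>open_ival r u y. P u x * (var_b * var_a) * P x y)
    = var_b * P u y + P u y * var_a + (\<Sum>x\<in>open_ival r u y. P u x * (var_a * var_b) * P x y)"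
proof -
  define f where "f x = P u x * (var_b * var_a - var_a * var_b)" for x
  have key: "(\<Sum>x\<in>open_ival r u y. f x * P x y) = P u y * var_e - var_e * P u y" if "lt u y" for y
    using that
  proof (induction "\<rho> y" arbitrary: y rule: less_induct)
    case less
    let ?X = "{x. lt u x \<and> (x, y) \<in> r}"
    have op: "{x \<in> ?X. lt x t} = open_ival r u t" if "(t, y) \<in> r" for t
      using that rtrans[OF _ that] by (auto simp: open_ival_iff)
    have yX: "y \<in> ?X" using less.prems rreflI by auto
    have conv: "t \<in> ?X" if "x \<in> ?X" "z \<in> ?X" "lt x t" "lt t z" for x t z
      using that lt_trans[of u x t] rtrans[of t z y] by auto
    have "(\<Sum>x\<in>open_ival r u y. f x * P x y) = (\<Sum>t\<in>open_ival r u y. f t * E t y)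
       + (\<Sum>t\<in>open_ival r u y. (\<Sum>x\<in>{x \<in> ?X. lt x t}. f x * P x t) * var_b * E t y)"
      using sum_Psi_rec[of ?X y f, OF finite_half_open conv yX] op[of y] rreflI(2)[of u y] less.prems by simp
    also have "(\<Sum>t\<in>open_ival r u y. (\<Sum>x\<in>{x \<in> ?X. lt x t}. f x * P x t) * var_b * E t y)
       = (\<Sum>t\<in>open_ival r u y. (P u t * var_e - var_e * P u t) * var_b * E t y)"
    proof (rule sum.cong[OF HOL.refl])
      fix t assume "t \<in> open_ival r u y"
      hence t: "lt u t" "lt t y" by (auto simp: open_ival_iff)
      show "(\<Sum>x\<in>{x \<in> ?X. lt x t}. f x * P x t) * var_b * E t y = (P u t * var_e - var_e * P u t) * var_b * E t y"
        using op[of t] less.hyps[of t] t rmono[of t y] by simp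
    qed
    also have "(\<Sum>t\<in>open_ival r u y. f t * E t y) + \<dots>
      = (\<Sum>t\<in>open_ival r u y. P u t * var_b * var_e * E t y - var_e * P u t * var_b * E t y)"
      unfolding sum.distrib[symmetric] f_def
      by (rule sum.cong[OF HOL.refl]) (simp add: var_e_def algebra_simps)
    also have "\<dots> = (\<Sum>t\<in>open_ival r u y. P u t * var_b * E t y) * var_e - var_e * (\<Sum>t\<in>open_ival r u y. P u t * var_b * E t y)"
      unfolding sum_subtractf sum_distrib_left sum_distrib_right by (simp only: mult.assoc E_comm)
    also have "\<dots> = P u y * var_e - var_e * P u y"
      using Psi_rec[of u y] less.prems by (simp add: algebra_simps E_comm)
    finally show ?case .
  qed
  have "(\<Sum>x\<in>open_ival r u y. P u x * (var_b * var_a) * P x y)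
    = (\<Sum>x\<in>open_ival r u y. f x * P x y) + (\<Sum>x\<in>open_ival r u y. P u x * (var_a * var_b) * P x y)"
    unfolding sum.distrib[symmetric] f_def by (rule sum.cong[OF HOL.refl]) (simp add: algebra_simps)
  thus ?thesis unfolding key[OF assms] by (simp add: var_e_def algebra_simps)
qed

text \<open>
  The case in which the minimum \<open>u\<close> is doubled as well. Its upper copy contributes \<open>b E(u,y)\<close>, which
  together with \<open>e E(u,y)\<close> for the empty chain makes up \<open>a E(u,y)\<close>.
\<close>

lemma doubling_at_bottom:
  fixes K :: "'a \<Rightarrow> ab_poly" and D :: "'a \<Rightarrow> bool"
  defines "g \<equiv> \<lambda>u x. if D x then 0 else P u x * var_b * var_e + K x * var_b"
  assumes uw: "lt u w" "\<not> D w"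
    and A: "\<And>y. lt u y \<Longrightarrow> (y, w) \<in> r \<Longrightarrow> \<not> D y \<Longrightarrow>
      K y = var_a * E u y + P u y * var_b + (\<Sum>x\<in>open_ival r u y. g u x * E x y)"
    and D: "\<And>y. lt u y \<Longrightarrow> (y, w) \<in> r \<Longrightarrow> D y \<Longrightarrow>
      P u y * var_a = var_a * E u y + (\<Sum>x\<in>open_ival r u y. g u x * E x y)"
  shows "K w = var_a * P u w + P u w * var_b
    + (\<Sum>x\<in>open_ival r u w. (if D x then - (P u x * (var_a * var_b)) else P u x * (var_b * var_a)) * P x w)"
proof -
  let ?X = "{x. lt u x \<and> (x, w) \<in> r}"
  have op: "{x \<in> ?X. lt x t} = open_ival r u t" if "t \<in> ?X" for t
    using that rtrans[of _ t w] by (auto simp: open_ival_iff)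
  have wX: "w \<in> ?X" using uw rreflI by auto
  have conv: "t \<in> ?X" if "x \<in> ?X" "z \<in> ?X" "lt x t" "lt t z" for x t z
    using that lt_trans[of u x t] rtrans[of t z w] by auto
  have base: "var_a * P u y = var_a * E u y + (\<Sum>t\<in>{t \<in> ?X. lt t y}. var_a * P u t * var_b * E t y)" if "y \<in> ?X" for y
    unfolding op[OF that] using Psi_rec[of u y] that by (simp add: distrib_left sum_distrib_left mult.assoc)
  have "var_a * P u w + P u w * var_b + (\<Sum>x\<in>{x \<in> ?X. lt x w}. (if D x then - (P u x * (var_a * var_b)) else P u x * (var_b * var_a)) * P x w)
    = (if D w then P u w * cd_c else K w)"
  proof (rule doubling_formula[of ?X "\<lambda>y. var_a * P u y" "\<lambda>y. var_a * E u y" D K "\<lambda>y. P u y", OF finite_half_open conv base _ _ wX])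
    fix y assume y: "y \<in> ?X"
    show "K y = var_a * E u y + P u y * var_b + (\<Sum>x\<in>{x \<in> ?X. lt x y}. (if D x then 0 else P u x * var_b * var_e + K x * var_b) * E x y)"
      if "\<not> D y"
      unfolding op[OF y] using A[of y] that y unfolding g_def by blast
    show "P u y * var_a = var_a * E u y + (\<Sum>x\<in>{x \<in> ?X. lt x y}. (if D x then 0 else P u x * var_b * var_e + K x * var_b) * E x y)"
      if "D y"
      unfolding op[OF y] using D[of y] that y unfolding g_def by blast
  qed
  thus ?thesis unfolding op[OF wX] using uw(2) by simp
qed

text \<open>
  Below an upper copy the lower copies that occur are only those of elements above the atom \<open>p\<close>. The value
  zero elsewhere lets the sums run over all of \<open>[u,w]\<close>.
\<close>

definition Psi0 :: "'a \<Rightarrow> 'a \<Rightarrow> ab_poly" where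
  "Psi0 x y = (if lt x y then P x y else 0)"

text \<open>
  The case in which the minimum is not doubled, the atom \<open>p\<close> is left out, and lower copies exist only
  above \<open>p\<close>. Subtracting \<open>b Psi0 p y\<close> removes from \<open>\<Psi>[u,y]\<close> the chains that start with \<open>p\<close>.
\<close>

lemma doubling_at_atom:
  fixes K :: "'a \<Rightarrow> ab_poly" and D :: "'a \<Rightarrow> bool"
  defines "g \<equiv> \<lambda>p x. if D x then 0 else Psi0 p x * var_b * var_e + K x * var_b"
  assumes uw: "lt u w" "\<not> D w" "w \<noteq> p" and p: "lt u p" "\<rho> p = \<rho> u + 1"
    and A: "\<And>y. lt u y \<Longrightarrow> (y, w) \<in> r \<Longrightarrow> y \<noteq> p \<Longrightarrow> \<not> D y \<Longrightarrow>
      K y = E u y + Psi0 p y * var_b + (\<Sum>x\<in>open_ival r u y - {p}. g p x * E x y)"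
    and D: "\<And>y. lt u y \<Longrightarrow> (y, w) \<in> r \<Longrightarrow> y \<noteq> p \<Longrightarrow> D y \<Longrightarrow>
      Psi0 p y * var_a = E u y + (\<Sum>x\<in>open_ival r u y - {p}. g p x * E x y)"
  shows "K w = P u w - var_b * Psi0 p w + Psi0 p w * var_b
    + (\<Sum>x\<in>open_ival r p w. (if D x then - (P p x * (var_a * var_b)) else P p x * (var_b * var_a)) * P x w)"
proof -
  let ?X = "{x. lt u x \<and> (x, w) \<in> r} - {p}"
  let ?f = "\<lambda>x. if D x then - (Psi0 p x * (var_a * var_b)) else Psi0 p x * (var_b * var_a)"
  have finX: "finite ?X" using finite_half_open by simp
  have atom: "\<not> lt t p" if "lt u t" for t
    using rmono[of u t] rmono[of t p] that p by auto
  have op: "{x \<in> ?X. lt x t} = open_ival r u t - {p}" if "t \<in> ?X" for t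
    using that rtrans[of _ t w] by (auto simp: open_ival_iff)
  have wX: "w \<in> ?X" using uw rreflI by auto
  have conv: "t \<in> ?X" if "x \<in> ?X" "z \<in> ?X" "lt x t" "lt t z" for x t z
    using that lt_trans[of u x t] rtrans[of t z w] atom[of x] by auto
  \<comment> \<open>The term \<open>t = p\<close> of the recursion for \<open>\<Psi>[u,y]\<close> cancels against the term \<open>b E(p,y)\<close> of \<open>b \<Psi>[p,y]\<close>.\<close>
  have base: "P u y - var_b * Psi0 p y = E u y + (\<Sum>t\<in>{t \<in> ?X. lt t y}. (P u t - var_b * Psi0 p t) * var_b * E t y)"
    if "y \<in> ?X" for y
  proof -
    have uy: "lt u y" "y \<noteq> p" using that by auto
    have Pu: "P u y = E u y + (\<Sum>t\<in>open_ival r u y. P u t * var_b * E t y)" using Psi_rec uy by blast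
    have sub: "open_ival r p y \<subseteq> open_ival r u y - {p}"
    proof
      fix t assume "t \<in> open_ival r p y"
      hence "lt p t" "lt t y" by (auto simp: open_ival_iff)
      thus "t \<in> open_ival r u y - {p}" using lt_trans[OF p(1)] by (auto simp: open_ival_iff)
    qed
    have "(\<Sum>t\<in>open_ival r p y. Psi0 p t * var_b * E t y) = (\<Sum>t\<in>open_ival r u y - {p}. Psi0 p t * var_b * E t y)"
      by (rule sum.mono_neutral_left) (use sub in \<open>auto simp: finite_open_ival Psi0_def open_ival_iff\<close>)
    moreover have "(\<Sum>t\<in>open_ival r p y. Psi0 p t * var_b * E t y) = (\<Sum>t\<in>open_ival r p y. P p t * var_b * E t y)"
      by (rule sum.cong[OF HOL.refl]) (auto simp: Psi0_def open_ival_iff)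
    ultimately have S: "(\<Sum>t\<in>open_ival r u y - {p}. Psi0 p t * var_b * E t y) = (\<Sum>t\<in>open_ival r p y. P p t * var_b * E t y)"
      by simp
    show ?thesis
    proof (cases "lt p y")
      case True
      have pin: "p \<in> open_ival r u y" using True p by (auto simp: open_ival_iff)
      have "P u p = 1"
      proof -
        have "open_ival r u p = {}" using atom by (auto simp: open_ival_iff)
        thus ?thesis using Psi_rec[of u p] p by (simp add: E_def)
      qed
      hence "P u y = E u y + var_b * E p y + (\<Sum>t\<in>open_ival r u y - {p}. P u t * var_b * E t y)"
        unfolding Pu using sum.remove[OF finite_open_ival pin, of "\<lambda>t. P u t * var_b * E t y"] by (simp add: add.assoc)
      moreover have "Psi0 p y = E p y + (\<Sum>t\<in>open_ival r u y - {p}. Psi0 p t * var_b * E t y)"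
        unfolding S using Psi_rec[of p y] True by (simp add: Psi0_def)
      ultimately have "P u y - var_b * Psi0 p y = E u y + ((\<Sum>t\<in>open_ival r u y - {p}. P u t * var_b * E t y)
          - (\<Sum>t\<in>open_ival r u y - {p}. var_b * Psi0 p t * var_b * E t y))"
        by (simp add: distrib_left sum_distrib_left mult.assoc)
      also have "\<dots> = E u y + (\<Sum>t\<in>open_ival r u y - {p}. (P u t - var_b * Psi0 p t) * var_b * E t y)"
        unfolding sum_subtractf[symmetric] by (simp add: left_diff_distrib)
      finally show ?thesis unfolding op[OF that] .
    next
      case False
      hence "p \<notin> open_ival r u y" by (auto simp: open_ival_iff)
      hence del: "open_ival r u y - {p} = open_ival r u y" by blast
      have "Psi0 p t = 0" if "t \<in> open_ival r u y" for t
        using False that lt_trans[of p t y] by (auto simp: Psi0_def open_ival_iff)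
      moreover have "Psi0 p y = 0" unfolding Psi0_def by (rule if_not_P[OF False])
      ultimately show ?thesis unfolding op[OF that] del using Pu by simp
    qed
  qed
  have "P u w - var_b * Psi0 p w + Psi0 p w * var_b + (\<Sum>x\<in>{x \<in> ?X. lt x w}. ?f x * P x w)
    = (if D w then Psi0 p w * cd_c else K w)"
  proof (rule doubling_formula[of ?X "\<lambda>y. P u y - var_b * Psi0 p y" "\<lambda>y. E u y" D K "\<lambda>y. Psi0 p y", OF finX conv base _ _ wX])
    fix y assume y: "y \<in> ?X"
    show "K y = E u y + Psi0 p y * var_b + (\<Sum>x\<in>{x \<in> ?X. lt x y}. (if D x then 0 else Psi0 p x * var_b * var_e + K x * var_b) * E x y)"
      if "\<not> D y"
      unfolding op[OF y] using A[of y] that y unfolding g_def by blast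
    show "Psi0 p y * var_a = E u y + (\<Sum>x\<in>{x \<in> ?X. lt x y}. (if D x then 0 else Psi0 p x * var_b * var_e + K x * var_b) * E x y)"
      if "D y"
      unfolding op[OF y] using D[of y] that y unfolding g_def by blast
  qed
  moreover have "(\<Sum>x\<in>{x \<in> ?X. lt x w}. ?f x * P x w) = (\<Sum>x\<in>open_ival r p w. ?f x * P x w)"
    unfolding op[OF wX]
  proof (rule sum.mono_neutral_right)
    show "open_ival r p w \<subseteq> open_ival r u w - {p}"
    proof
      fix t assume "t \<in> open_ival r p w"
      hence "lt p t" "lt t w" by (auto simp: open_ival_iff)
      thus "t \<in> open_ival r u w - {p}" using lt_trans[OF p(1)] by (auto simp: open_ival_iff)
    qed
    show "\<forall>x\<in>open_ival r u w - {p} - open_ival r p w. ?f x * P x w = 0"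
      by (auto simp: Psi0_def open_ival_iff)
  qed (simp add: finite_open_ival)
  moreover have "(\<Sum>x\<in>open_ival r p w. ?f x * P x w)
    = (\<Sum>x\<in>open_ival r p w. (if D x then - (P p x * (var_a * var_b)) else P p x * (var_b * var_a)) * P x w)"
    by (rule sum.cong[OF HOL.refl]) (auto simp: Psi0_def open_ival_iff)
  ultimately show ?thesis using uw(2) by simp
qed

end

section \<open>Pyramids and shavings\<close>

context graded_order
begin

lemma E_Suc: "\<rho> x < \<rho> y \<Longrightarrow> var_e ^ (\<rho> y - \<rho> x) = var_e * E x y"
  unfolding E_def by (subst power_Suc[symmetric], rule arg_cong[of _ _ "\<lambda>n. var_e ^ n"]) auto

lemma Psi_cover: assumes "lt x y" "\<rho> y = \<rho> x + 1" shows "P x y = 1"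
proof -
  have "open_ival r x y = {}"
  proof (rule ccontr)
    assume "open_ival r x y \<noteq> {}"
    then obtain t where "t \<in> open_ival r x y" by blast
    hence "lt x t" "lt t y" by (auto simp: open_ival_iff)
    thus False using rmono[of x t] rmono[of t y] assms(2) by auto
  qed
  thus ?thesis using Psi_rec[of x y] assms by (simp add: E_def)
qed

definition pyr_rank :: "'a \<times> bool \<Rightarrow> nat" where
  "pyr_rank z = \<rho> (fst z) + of_bool (snd z)"

lemma Pyr_iff: "((x, i), (y, j)) \<in> Pyr r \<longleftrightarrow> (x, y) \<in> r \<and> i \<le> j"
  by (auto simp: Pyr_def rel_product_def)

lemma graded_order_Pyr: "graded_order (Pyr r) pyr_rank"
proof
  fix a b c :: "'a \<times> bool"
  obtain x i where a: "a = (x, i)" by (cases a)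
  obtain y j where b: "b = (y, j)" by (cases b)
  obtain z k where c: "c = (z, k)" by (cases c)
  show "(a, a) \<in> Pyr r" if "a \<in> Field (Pyr r)"
    using that rreflI unfolding a Field_def Pyr_iff by (auto simp: Pyr_iff)
  show "(a, c) \<in> Pyr r" if "(a, b) \<in> Pyr r" "(b, c) \<in> Pyr r"
    using that rtrans[of x y z] unfolding a b c Pyr_iff by auto
  show "pyr_rank a < pyr_rank b" if "(a, b) \<in> Pyr r" "a \<noteq> b"
    using that rmono[of x y] unfolding a b Pyr_iff pyr_rank_def by (cases "x = y") auto
  show "\<exists>z. (a, z) \<in> Pyr r \<and> (z, b) \<in> Pyr r \<and> z \<noteq> a \<and> z \<noteq> b"
    if ab: "(a, b) \<in> Pyr r" "pyr_rank a + 1 < pyr_rank b"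
  proof (cases "i = j")
    case True
    hence "\<rho> x + 1 < \<rho> y" "(x, y) \<in> r" using ab unfolding a b Pyr_iff pyr_rank_def by auto
    then obtain t where "lt x t" "lt t y" using rgap by metis
    thus ?thesis using True unfolding a b by (intro exI[of _ "(t, i)"]) (auto simp: Pyr_iff)
  next
    case False
    hence ij: "i = False" "j = True" "(x, y) \<in> r" "\<rho> x < \<rho> y"
      using ab unfolding a b Pyr_iff pyr_rank_def by auto
    thus ?thesis using rreflI(1)[of x y] unfolding a b by (intro exI[of _ "(x, True)"]) (auto simp: Pyr_iff)
  qed
  have "closed_ival (Pyr r) a b \<subseteq> closed_ival r x y \<times> UNIV"
    unfolding a b closed_ival_def by (auto simp: Pyr_iff)
  thus "finite (closed_ival (Pyr r) a b)" by (rule finite_subset) (simp add: rfin)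
qed

lemma Pyr_ival:
  assumes "(u, w) \<in> r" shows "Pyr (ival r u w) = ival (Pyr r) (u, False) (w, True)"
proof -
  interpret Y: graded_order "Pyr r" pyr_rank by (rule graded_order_Pyr)
  have "((x, i), (y, j)) \<in> Pyr (ival r u w) \<longleftrightarrow> ((x, i), (y, j)) \<in> ival (Pyr r) (u, False) (w, True)" for x i y j
    unfolding Y.ival_iff Pyr_iff by (auto simp: Pyr_def rel_product_def ival_iff)
  thus ?thesis by auto
qed

text \<open>
  The pyramid doubles every element, so that \<open>doubling_at_bottom\<close> applies without descents. The chains of
  the interval from \<open>(u,0)\<close> to \<open>(y,1)\<close> are classified by whether they end in a lower or an upper copy, the
  extreme cases being \<open>(y,0)\<close> and \<open>(u,1)\<close>.
\<close>

theorem Psi_Pyr: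
  assumes uw: "lt u w"
  shows "Psi (Pyr (ival r u w)) = var_a * P u w + P u w * var_b
    + (\<Sum>x\<in>open_ival r u w. P u x * (var_b * var_a) * P x w)"
proof -
  interpret Y: graded_order "Pyr r" pyr_rank by (rule graded_order_Pyr)
  let ?K = "\<lambda>y. Y.P (u, False) (y, True)"
  have "?K w = var_a * P u w + P u w * var_b
    + (\<Sum>x\<in>open_ival r u w. (if False then - (P u x * (var_a * var_b)) else P u x * (var_b * var_a)) * P x w)"
  proof (rule doubling_at_bottom[of u w "\<lambda>_. False" ?K, OF uw])
    fix y assume uy: "lt u y"
    let ?O = "open_ival r u y"
    let ?h = "\<lambda>z. Y.P (u, False) z * var_b * Y.E z (y, True)"
    have y1: "((u, False), (y, True)) \<in> Pyr r" using uy by (simp add: Pyr_iff)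
    have op: "open_ival (Pyr r) (u, False) (y, True) = (\<lambda>x. (x, False)) ` insert y ?O \<union> (\<lambda>x. (x, True)) ` insert u ?O"
      using uy rreflI[of u y] by (auto simp: open_ival_iff Y.open_ival_iff Pyr_iff image_iff)
    have notin: "y \<notin> ?O" "u \<notin> ?O" by (auto simp: open_ival_iff)
    have iso: "Y.P (u, False) (x, False) = P u x" if "(u, x) \<in> r" for x
    proof (rule Psi_iso[OF graded_order_axioms graded_order_Pyr that, of "\<lambda>x. (x, False)"])
      show "(\<lambda>x. (x, False)) ` closed_ival r u t = closed_ival (Pyr r) (u, False) (t, False)" for t
        by (auto simp: closed_ival_def Pyr_iff)
    qed (auto simp: inj_on_def pyr_rank_def)
    have O: "\<rho> u < \<rho> x" "\<rho> x < \<rho> y" "(u, x) \<in> r" if "x \<in> ?O" for x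
      using that rmono[of u x] rmono[of x y] by (auto simp: open_ival_iff)
    have uyr: "\<rho> u < \<rho> y" using rmono uy by blast
    have hF: "?h (x, False) = P u x * var_b * var_e * E x y" if "x \<in> ?O" for x
      using iso O[OF that] E_Suc[of x y] unfolding Y.E_def by (simp add: pyr_rank_def mult.assoc)
    have hT: "?h (x, True) = ?K x * var_b * E x y" if "x \<in> ?O" for x
      unfolding Y.E_def E_def by (simp add: pyr_rank_def)
    have hy: "?h (y, False) = P u y * var_b"
      using iso uy unfolding Y.E_def by (simp add: pyr_rank_def)
    have "?K u = 1" by (rule Y.Psi_cover) (use uy rreflI in \<open>auto simp: Pyr_iff pyr_rank_def\<close>)
    hence hu: "?h (u, True) = var_b * E u y"
      unfolding Y.E_def E_def by (simp add: pyr_rank_def)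
    have Eu: "Y.E (u, False) (y, True) = var_e * E u y"
      using E_Suc[OF uyr] unfolding Y.E_def by (simp add: pyr_rank_def)
    have "?K y = Y.E (u, False) (y, True)
      + ((\<Sum>x\<in>insert y ?O. ?h (x, False)) + (\<Sum>x\<in>insert u ?O. ?h (x, True)))"
    proof -
      have fin: "finite ((\<lambda>x. (x, False)) ` insert y ?O)" "finite ((\<lambda>x. (x, True)) ` insert u ?O)"
        by (simp_all add: finite_open_ival)
      have disj: "(\<lambda>x. (x, False)) ` insert y ?O \<inter> (\<lambda>x. (x, True)) ` insert u ?O = {}" by auto
      have inj: "inj_on (\<lambda>x. (x, i)) A" for i :: bool and A :: "'a set" by (simp add: inj_on_def)
      have "(u, False) \<noteq> (y, True)" by simp
      from Y.Psi_rec[OF y1 this] show ?thesis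
        unfolding op sum.union_disjoint[OF fin disj] sum.reindex[OF inj] by (simp only: o_def)
    qed
    also have "(\<Sum>x\<in>insert y ?O. ?h (x, False)) = P u y * var_b + (\<Sum>x\<in>?O. P u x * var_b * var_e * E x y)"
      using notin hF hy by (simp add: finite_open_ival)
    also have "(\<Sum>x\<in>insert u ?O. ?h (x, True)) = var_b * E u y + (\<Sum>x\<in>?O. ?K x * var_b * E x y)"
      using notin hT hu by (simp add: finite_open_ival)
    finally have "?K y = var_e * E u y + (P u y * var_b + (\<Sum>x\<in>?O. P u x * var_b * var_e * E x y)
       + (var_b * E u y + (\<Sum>x\<in>?O. ?K x * var_b * E x y)))" unfolding Eu .
    moreover have "(\<Sum>x\<in>?O. (if False then 0 else P u x * var_b * var_e + ?K x * var_b) * E x y)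
      = (\<Sum>x\<in>?O. P u x * var_b * var_e * E x y) + (\<Sum>x\<in>?O. ?K x * var_b * E x y)"
      unfolding sum.distrib[symmetric] by (simp add: distrib_right)
    ultimately show "?K y = var_a * E u y + P u y * var_b
      + (\<Sum>x\<in>?O. (if False then 0 else P u x * var_b * var_e + ?K x * var_b) * E x y)"
      by (simp add: var_e_def algebra_simps)
  qed auto
  thus ?thesis using Pyr_ival uw by simp
qed

text \<open>
  The chains below an upper copy \<open>y'\<close> that end in a lower copy \<open>x\<close>. The term \<open>x = y\<close> is the one that is
  present only if \<open>y\<close> itself lies above the atom.
\<close>

lemma sum_above_atom:
  assumes p: "lt u p" and uy: "lt u y" "y \<noteq> p" "\<not> D y"
  shows "(\<Sum>x\<in>{x. lt p x \<and> (x, y) \<in> r \<and> \<not> D x}. P p x * var_b * var_e ^ (\<rho> y - \<rho> x))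
    = Psi0 p y * var_b + (\<Sum>x\<in>open_ival r u y - {p}. (if D x then 0 else Psi0 p x * var_b * var_e) * E x y)"
proof -
  have "(\<Sum>x\<in>open_ival r u y - {p}. (if D x then 0 else Psi0 p x * var_b * var_e) * E x y)
    = (\<Sum>x\<in>{x \<in> open_ival r p y. \<not> D x}. (if D x then 0 else Psi0 p x * var_b * var_e) * E x y)"
  proof (rule sum.mono_neutral_right)
    show "{x \<in> open_ival r p y. \<not> D x} \<subseteq> open_ival r u y - {p}"
    proof
      fix t assume "t \<in> {x \<in> open_ival r p y. \<not> D x}"
      hence "lt p t" "lt t y" by (auto simp: open_ival_iff)
      thus "t \<in> open_ival r u y - {p}" using lt_trans[OF p] by (auto simp: open_ival_iff)
    qed
  qed (auto simp: finite_open_ival Psi0_def open_ival_iff)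
  also have "\<dots> = (\<Sum>x\<in>{x \<in> open_ival r p y. \<not> D x}. P p x * var_b * var_e ^ (\<rho> y - \<rho> x))"
  proof (rule sum.cong[OF HOL.refl])
    fix x assume "x \<in> {x \<in> open_ival r p y. \<not> D x}"
    hence x: "lt p x" "lt x y" "\<not> D x" by (auto simp: open_ival_iff)
    have "\<rho> x < \<rho> y" using x rmono by blast
    thus "(if D x then 0 else Psi0 p x * var_b * var_e) * E x y = P p x * var_b * var_e ^ (\<rho> y - \<rho> x)"
      using x E_Suc[of x y] by (auto simp: Psi0_def mult.assoc)
  qed
  finally have 1: "(\<Sum>x\<in>open_ival r u y - {p}. (if D x then 0 else Psi0 p x * var_b * var_e) * E x y)
    = (\<Sum>x\<in>{x \<in> open_ival r p y. \<not> D x}. P p x * var_b * var_e ^ (\<rho> y - \<rho> x))" .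
  show ?thesis
  proof (cases "lt p y")
    case True
    have "{x. lt p x \<and> (x, y) \<in> r \<and> \<not> D x} = insert y {x \<in> open_ival r p y. \<not> D x}"
      using True uy rreflI by (auto simp: open_ival_iff)
    moreover have "y \<notin> {x \<in> open_ival r p y. \<not> D x}" by (simp add: open_ival_iff)
    moreover have "Psi0 p y = P p y" unfolding Psi0_def by (rule if_P[OF True])
    ultimately show ?thesis unfolding 1 by (simp add: finite_open_ival)
  next
    case False
    have "\<not> (lt p x \<and> (x, y) \<in> r)" for x using False lt_le_trans[of p x y] by blast
    hence empty: "{x. lt p x \<and> (x, y) \<in> r \<and> \<not> D x} = {}" "{x \<in> open_ival r p y. \<not> D x} = {}"
      unfolding open_ival_iff by blast+
    have "Psi0 p y = 0" unfolding Psi0_def by (rule if_not_P[OF False])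
    thus ?thesis unfolding 1 empty by simp
  qed
qed

text \<open>
  The shaving at \<open>p\<close>: the upper copies are the pairs with second component \<open>p\<close>, the lower ones have
  second component \<open>u\<close>.
\<close>

definition Sh_carrier :: "'a \<Rightarrow> 'a \<Rightarrow> 'a \<Rightarrow> 'a \<Rightarrow> 'a \<Rightarrow> bool" where
  "Sh_carrier u p w x i \<longleftrightarrow> (i = p \<and> lt u x \<and> (x, w) \<in> r \<and> x \<noteq> p)
     \<or> (i = u \<and> lt p x \<and> (x, w) \<in> r) \<or> (i = u \<and> x = u)"

text \<open>
  Removing \<open>p\<close> lowers the rank of the lower copies above it by one. The upper copies keep their rank.
\<close>

definition sh_rank :: "'a \<Rightarrow> 'a \<Rightarrow> 'a \<times> 'a \<Rightarrow> nat" where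
  "sh_rank u p z = (if snd z = p then \<rho> (fst z) else if fst z = u then \<rho> u else \<rho> (fst z) - 1)"

lemma Sh_iff:
  assumes up: "lt u p" "(p, w) \<in> r"
  shows "((x, i), (y, j)) \<in> Sh p (ival r u w) \<longleftrightarrow>
    Sh_carrier u p w x i \<and> Sh_carrier u p w y j \<and> (x, y) \<in> r \<and> (i = u \<or> j = p)"
proof -
  have uw: "(u, w) \<in> r" using up rtrans by blast
  have c: "(x, i) \<in> (closed_ival r u w - {u, p}) \<times> {p} \<union> (closed_ival (ival r u w) p w - {p}) \<times> {u} \<union> {(u, u)}
     \<longleftrightarrow> Sh_carrier u p w x i" for x i
    using up rtrans[of u p x] rreflI[of u w] rreflI[of p w] rreflI[of p x]
    by (auto simp: Sh_carrier_def closed_ival_def ival_iff)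
  have ij: "Sh_carrier u p w x i \<Longrightarrow> i = p \<or> i = u" for x i by (auto simp: Sh_carrier_def)
  have 1: "(i, j) \<in> ival (ival r u w) u p \<longleftrightarrow> i = u \<or> j = p" if "i = p \<or> i = u" "j = p \<or> j = u"
    using that up uw rreflI[of u p] rantisym[of u p] by (auto simp: ival_iff ival_def[of "ival r u w"] closed_ival_def)
  have 2: "(x, y) \<in> ival r u w \<longleftrightarrow> (x, y) \<in> r" if "Sh_carrier u p w x i" "Sh_carrier u p w y j"
    using that uw rtrans[of u p x] up rreflI[of u w] by (auto simp: ival_iff Sh_carrier_def)
  have "((x, i), (y, j)) \<in> Sh p (ival r u w) \<longleftrightarrow>
    Sh_carrier u p w x i \<and> Sh_carrier u p w y j \<and> (x, y) \<in> ival r u w \<and> (i, j) \<in> ival (ival r u w) u p"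
    unfolding Sh_def Field_ival bot_of_ival[OF uw] top_of_ival[OF uw] Int_iff mem_Sigma_iff c rel_product_def by auto
  thus ?thesis using 1 2 ij by metis
qed

text \<open>
  Two comparisons need care: from the minimum to an upper copy \<open>y\<close> one passes through the lower copy of \<open>y\<close>
  if \<open>p < y\<close>, and otherwise through an element that automatically differs from \<open>p\<close>; from a
  lower copy \<open>x\<close> to an upper copy one passes through the upper copy of \<open>x\<close>.
\<close>

lemma graded_order_Sh:
  assumes up: "lt u p" "lt p w" "\<rho> p = \<rho> u + 1"
  shows "graded_order (Sh p (ival r u w)) (sh_rank u p)"
proof
  note Sh = Sh_iff[OF up(1) conjunct1[OF up(2)]]
  have atom: "\<not> lt t p" if "lt u t" for t
    using rmono[of u t] rmono[of t p] that up by auto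
  have nle: "\<not> lt x u" if "lt u x \<or> x = u \<or> lt p x" for x
  proof
    assume "lt x u"
    hence "\<rho> x < \<rho> u" using rmono by blast
    moreover have "\<rho> u \<le> \<rho> x" using that rmono[of u x] rmono[of p x] up(3) by auto
    ultimately show False by simp
  qed
  have pos: "\<rho> u + 1 < \<rho> x" if "lt p x" for x using rmono[of p x] that up by auto
  have above: "lt u x" if "lt p x" for x using lt_trans up that by blast
  fix a b c :: "'a \<times> 'a"
  obtain x i where a: "a = (x, i)" by (cases a)
  obtain y j where b: "b = (y, j)" by (cases b)
  obtain z k where c: "c = (z, k)" by (cases c)
  have carrier_refl: "(x, x) \<in> r" if "Sh_carrier u p w x i" for x i
    using that rreflI[of u p] rreflI(1)[of x w] up by (auto simp: Sh_carrier_def)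
  show "(a, a) \<in> Sh p (ival r u w)" if "a \<in> Field (Sh p (ival r u w))"
  proof -
    have "Sh_carrier u p w x i" using that unfolding a Field_def by (auto simp: Sh)
    thus ?thesis using carrier_refl[of x i] unfolding a Sh by (auto simp: Sh_carrier_def)
  qed
  show "(a, c) \<in> Sh p (ival r u w)" if "(a, b) \<in> Sh p (ival r u w)" "(b, c) \<in> Sh p (ival r u w)"
    using that rtrans[of x y z] up unfolding a b c Sh by (auto simp: Sh_carrier_def)
  have cases: thesis if "(a, b) \<in> Sh p (ival r u w)" "a \<noteq> b"
      "i = p \<Longrightarrow> j = p \<Longrightarrow> lt u x \<Longrightarrow> lt x y \<Longrightarrow> (y, w) \<in> r \<Longrightarrow> x \<noteq> p \<Longrightarrow> y \<noteq> p \<Longrightarrow> thesis"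
      "i = u \<Longrightarrow> x = u \<Longrightarrow> j = p \<Longrightarrow> lt u y \<Longrightarrow> (y, w) \<in> r \<Longrightarrow> y \<noteq> p \<Longrightarrow> thesis"
      "i = u \<Longrightarrow> x = u \<Longrightarrow> j = u \<Longrightarrow> lt p y \<Longrightarrow> (y, w) \<in> r \<Longrightarrow> thesis"
      "i = u \<Longrightarrow> lt p x \<Longrightarrow> j = u \<Longrightarrow> lt x y \<Longrightarrow> (y, w) \<in> r \<Longrightarrow> thesis"
      "i = u \<Longrightarrow> lt p x \<Longrightarrow> j = p \<Longrightarrow> (x, y) \<in> r \<Longrightarrow> (y, w) \<in> r \<Longrightarrow> y \<noteq> p \<Longrightarrow> thesis" for thesis
    using that(1,2) that(3-) nle[of x] above[of x] up(1) unfolding a b Sh Sh_carrier_def by blast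
  show "sh_rank u p a < sh_rank u p b" if ab: "(a, b) \<in> Sh p (ival r u w)" "a \<noteq> b"
    by (rule cases[OF ab]; unfold a b sh_rank_def)
      (use up rmono[of x y] rmono_le[of x y] pos[of x] pos[of y] rmono[of u y] in auto)
  show "\<exists>z. (a, z) \<in> Sh p (ival r u w) \<and> (z, b) \<in> Sh p (ival r u w) \<and> z \<noteq> a \<and> z \<noteq> b"
    if ab: "(a, b) \<in> Sh p (ival r u w)" "sh_rank u p a + 1 < sh_rank u p b"
  proof -
    have "a \<noteq> b" using ab by auto
    have M: "Sh_carrier u p w x i" "Sh_carrier u p w y j" using ab(1) unfolding a b Sh by auto
    have uu: "Sh_carrier u p w u u" by (simp add: Sh_carrier_def)
    have upne: "u \<noteq> p" using up by simp
    show ?thesis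
    proof (rule cases[OF ab(1) \<open>a \<noteq> b\<close>])
      assume c: "i = p" "j = p" "lt u x" "lt x y" "(y, w) \<in> r" "x \<noteq> p" "y \<noteq> p"
      hence "\<rho> x + 1 < \<rho> y" using ab(2) unfolding a b sh_rank_def by simp
      then obtain t where t: "lt x t" "lt t y" using rgap c by metis
      have "Sh_carrier u p w t p" using t c lt_trans[of u x t] rtrans[of t y w] atom[of x] by (auto simp: Sh_carrier_def)
      thus ?thesis using M t c unfolding a b by (intro exI[of _ "(t, p)"]) (auto simp: Sh)
    next
      assume c: "i = u" "x = u" "j = p" "lt u y" "(y, w) \<in> r" "y \<noteq> p"
      show ?thesis
      proof (cases "lt p y")
        case True
        hence "Sh_carrier u p w y u" using c by (auto simp: Sh_carrier_def)
        thus ?thesis using M c upne carrier_refl[OF M(2)] unfolding a b by (intro exI[of _ "(y, u)"]) (auto simp: Sh)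
      next
        case False
        have "\<rho> u + 1 < \<rho> y" using ab(2) c upne unfolding a b sh_rank_def by simp
        then obtain t where t: "lt u t" "lt t y" using rgap c by metis
        have "t \<noteq> p" using t False by blast
        hence "Sh_carrier u p w t p" using t c rtrans[of t y w] by (auto simp: Sh_carrier_def)
        thus ?thesis using M t c unfolding a b by (intro exI[of _ "(t, p)"]) (auto simp: Sh)
      qed
    next
      assume c: "i = u" "x = u" "j = u" "lt p y" "(y, w) \<in> r"
      have "y \<noteq> u" using above[of y] c by blast
      hence "\<rho> p + 1 < \<rho> y" using ab(2) c upne up(3) unfolding a b sh_rank_def by simp
      then obtain t where t: "lt p t" "lt t y" using rgap c by metis
      have "Sh_carrier u p w t u" using t c rtrans[of t y w] by (auto simp: Sh_carrier_def)
      thus ?thesis using M t c above[of t] unfolding a b by (intro exI[of _ "(t, u)"]) (auto simp: Sh)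
    next
      assume c: "i = u" "lt p x" "j = u" "lt x y" "(y, w) \<in> r"
      have "x \<noteq> u" "y \<noteq> u" using above[of x] above[of y] lt_trans[of p x y] c by blast+
      hence "\<rho> x + 1 < \<rho> y" using ab(2) c upne pos[of x] unfolding a b sh_rank_def by simp
      then obtain t where t: "lt x t" "lt t y" using rgap c by metis
      have "Sh_carrier u p w t u" using t c rtrans[of t y w] lt_trans[of p x t] by (auto simp: Sh_carrier_def)
      thus ?thesis using M t c unfolding a b by (intro exI[of _ "(t, u)"]) (auto simp: Sh)
    next
      assume c: "i = u" "lt p x" "j = p" "(x, y) \<in> r" "(y, w) \<in> r" "y \<noteq> p"
      have "x \<noteq> u" using above[of x] c by blast
      hence "x \<noteq> y" using ab(2) c upne unfolding a b sh_rank_def by auto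
      have "Sh_carrier u p w x p" using c above[of x] rtrans[of x y w] by (auto simp: Sh_carrier_def)
      thus ?thesis using M c upne carrier_refl[OF M(1)] \<open>x \<noteq> y\<close> unfolding a b by (intro exI[of _ "(x, p)"]) (auto simp: Sh)
    qed
  qed
  have "closed_ival (Sh p (ival r u w)) a b \<subseteq> closed_ival r x y \<times> {u, p}"
    unfolding a b closed_ival_def by (auto simp: Sh Sh_carrier_def)
  thus "finite (closed_ival (Sh p (ival r u w)) a b)" by (rule finite_subset) (simp add: rfin)
qed

text \<open>
  The lower copies above \<open>p\<close> together with the minimum form a copy of \<open>[p,w]\<close>, which identifies the
  \<open>ab\<close>-indices of the intervals ending at lower copies.
\<close>

theorem Psi_Sh:
  assumes up: "lt u p" "lt p w" "\<rho> p = \<rho> u + 1"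
  shows "Psi (Sh p (ival r u w)) = P u w - var_b * P p w + P p w * var_b
    + (\<Sum>x\<in>open_ival r p w. P p x * (var_b * var_a) * P x w)"
proof -
  let ?q = "Sh p (ival r u w)"
  note Sh = Sh_iff[OF up(1) conjunct1[OF up(2)]]
  interpret Y: graded_order ?q "sh_rank u p" by (rule graded_order_Sh[OF up])
  have upne: "u \<noteq> p" using up by simp
  have above: "lt u x" if "lt p x" for x using lt_trans up that by blast
  have uw: "lt u w" "w \<noteq> p" using above up by auto
  have ww: "(w, w) \<in> r" using rreflI up by blast
  have uu: "(u, u) \<in> r" using rreflI up by blast
  have pos: "\<rho> u + 1 < \<rho> x" if "lt p x" for x using rmono[of p x] that up by auto
  have top: "ival ?q (u, u) (w, p) = ?q"
  proof -
    have "((x, i), (y, j)) \<in> ival ?q (u, u) (w, p) \<longleftrightarrow> ((x, i), (y, j)) \<in> ?q" for x i y j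
      unfolding Y.ival_iff Sh using uw ww uu above by (auto simp: Sh_carrier_def)
    thus ?thesis by auto
  qed
  let ?K = "\<lambda>y. Y.P (u, u) (y, p)"
  have "?K w = P u w - var_b * Psi0 p w + Psi0 p w * var_b
    + (\<Sum>x\<in>open_ival r p w. (if False then - (P p x * (var_a * var_b)) else P p x * (var_b * var_a)) * P x w)"
  proof (rule doubling_at_atom[of u w "\<lambda>_. False" p ?K, OF uw(1) _ uw(2) up(1,3)])
    fix y assume y: "lt u y" "(y, w) \<in> r" "y \<noteq> p"
    let ?O = "open_ival r u y - {p}" and ?A = "{x. lt p x \<and> (x, y) \<in> r \<and> \<not> False}"
    let ?h = "\<lambda>z. Y.P (u, u) z * var_b * Y.E z (y, p)"
    have Cy: "Sh_carrier u p w y p" using y by (simp add: Sh_carrier_def)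
    have y1: "((u, u), (y, p)) \<in> ?q" "(u, u) \<noteq> (y, p)" using y upne Cy by (auto simp: Sh Sh_carrier_def)
    have op: "open_ival ?q (u, u) (y, p) = (\<lambda>x. (x, u)) ` ?A \<union> (\<lambda>x. (x, p)) ` ?O"
    proof (intro Set.set_eqI)
      fix z :: "'a \<times> 'a"
      obtain x i where z: "z = (x, i)" by (cases z)
      show "z \<in> open_ival ?q (u, u) (y, p) \<longleftrightarrow> z \<in> (\<lambda>x. (x, u)) ` ?A \<union> (\<lambda>x. (x, p)) ` ?O"
        unfolding z Y.open_ival_iff Sh
        using y upne above[of x] Cy rtrans[of x y w] uu
        by (auto simp: Sh_carrier_def open_ival_iff image_iff)
    qed
    have finA: "finite ?A" by (rule finite_subset[OF _ rfin[of p y]]) (auto simp: closed_ival_def)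
    have iso: "Y.P (u, u) (x, u) = P p x" if x: "lt p x" "(x, w) \<in> r" for x
    proof -
      let ?f = "\<lambda>t. if t = p then (u, u) else (t, u)"
      have "Psi (ival ?q (?f p) (?f x)) = P p x"
      proof (rule Psi_iso[OF graded_order_axioms Y.graded_order_axioms])
        show "(p, x) \<in> r" using x by simp
        show "inj_on ?f (closed_ival r p x)"
          using above by (auto simp: inj_on_def closed_ival_def split: if_splits)
        fix t assume "t \<in> closed_ival r p x"
        hence t: "(p, t) \<in> r" "(t, x) \<in> r" by (auto simp: closed_ival_def)
        have tw: "(t, w) \<in> r" using rtrans[OF t(2) x(2)] .
        show "sh_rank u p (?f t) + \<rho> p = \<rho> t + sh_rank u p (?f p)"
          using pos[of t] t up(3) upne above[of t] by (auto simp: sh_rank_def)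
        show "?f ` closed_ival r p t = closed_ival ?q (?f p) (?f t)"
        proof (intro Set.set_eqI)
          fix z :: "'a \<times> 'a"
          obtain v i where z: "z = (v, i)" by (cases z)
          have "(v, i) \<in> ?f ` closed_ival r p t \<longleftrightarrow> i = u \<and> (v = u \<or> lt p v \<and> (v, t) \<in> r)"
            using t rreflI[of p t] above[of v] by (auto simp: image_iff closed_ival_def)
          also have "\<dots> \<longleftrightarrow> (v, i) \<in> closed_ival ?q (?f p) (?f t)"
            using t tw upne above[of v] above[of t] rtrans[of v t w] uu rantisym[of v u] rantisym[of t p] rantisym[of v p] up(1)
            by (auto simp: closed_ival_def Sh Sh_carrier_def)
          finally show "z \<in> ?f ` closed_ival r p t \<longleftrightarrow> z \<in> closed_ival ?q (?f p) (?f t)" unfolding z .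
        qed
      qed
      moreover have "?f p = (u, u)" "?f x = (x, u)" using x by auto
      ultimately show ?thesis by (simp only:)
    qed
    have hA: "?h (x, u) = P p x * var_b * var_e ^ (\<rho> y - \<rho> x)" if "x \<in> ?A" for x
    proof -
      have x: "lt p x" "(x, y) \<in> r" using that by auto
      have "(x, w) \<in> r" using rtrans[OF x(2) y(2)] .
      moreover have "x \<noteq> u" using above[OF x(1)] by blast
      ultimately show ?thesis using iso[OF x(1)] pos[OF x(1)] upne unfolding Y.E_def by (simp add: sh_rank_def)
    qed
    have hO: "?h (x, p) = ?K x * var_b * E x y" for x
      unfolding Y.E_def E_def by (simp add: sh_rank_def)
    have Eu: "Y.E (u, u) (y, p) = E u y"
      using upne unfolding Y.E_def E_def by (simp add: sh_rank_def)
    have "?K y = E u y + ((\<Sum>x\<in>?A. ?h (x, u)) + (\<Sum>x\<in>?O. ?h (x, p)))"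
      unfolding Y.Psi_rec[OF y1] op Eu
      using upne finA by (subst sum.union_disjoint) (auto simp: finite_open_ival sum.reindex inj_on_def)
    also have "(\<Sum>x\<in>?A. ?h (x, u)) = (\<Sum>x\<in>?A. P p x * var_b * var_e ^ (\<rho> y - \<rho> x))"
      using hA by (rule sum.cong[OF HOL.refl])
    also have "\<dots> = Psi0 p y * var_b + (\<Sum>x\<in>?O. (if False then 0 else Psi0 p x * var_b * var_e) * E x y)"
      by (rule sum_above_atom[of u p y "\<lambda>_. False"]) (use up y in auto)
    also have "(\<Sum>x\<in>?O. ?h (x, p)) = (\<Sum>x\<in>?O. ?K x * var_b * E x y)"
      using hO by (rule sum.cong[OF HOL.refl])
    finally have "?K y = E u y + (Psi0 p y * var_b + (\<Sum>x\<in>?O. (if False then 0 else Psi0 p x * var_b * var_e) * E x y)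
      + (\<Sum>x\<in>?O. ?K x * var_b * E x y))" .
    moreover have "(\<Sum>x\<in>?O. (if False then 0 else Psi0 p x * var_b * var_e + ?K x * var_b) * E x y)
      = (\<Sum>x\<in>?O. (if False then 0 else Psi0 p x * var_b * var_e) * E x y) + (\<Sum>x\<in>?O. ?K x * var_b * E x y)"
      unfolding sum.distrib[symmetric] by (simp add: distrib_right)
    ultimately show "?K y = E u y + Psi0 p y * var_b
      + (\<Sum>x\<in>?O. (if False then 0 else Psi0 p x * var_b * var_e + ?K x * var_b) * E x y)"
      by (simp only: add.assoc)
  qed auto
  moreover have "Psi0 p w = P p w" unfolding Psi0_def by (rule if_P[OF up(2)])
  ultimately show ?thesis unfolding top by simp
qed

end

section \<open>Bruhat intervals as doublings\<close>

context graded_order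
begin

text \<open>
  The hypothesis of \<open>doubling_formula\<close> at a descent \<open>y\<close> is the recursion at \<open>z = ys\<close>, multiplied by \<open>e\<close>: this
  shifts every \<open>E(x,z)\<close> to \<open>E(x,y)\<close>, and the term for \<open>z\<close> itself is supplied by \<open>a = e + b\<close>.
\<close>

lemma descent_step:
  assumes "finite A" "z \<notin> A" and less: "\<And>x. x \<in> A \<Longrightarrow> \<rho> x < \<rho> z" and yz: "\<rho> y = \<rho> z + 1"
    and K: "q = eps + m * var_b + (\<Sum>x\<in>A. g x * E x z)" and g: "g z = m * var_b * var_e + q * var_b"
  shows "q * var_a = eps * var_e + (\<Sum>x\<in>insert z A. g x * E x y)"
proof -
  have E: "E x y = E x z * var_e" if "x \<in> A" for x
    using E_Suc[of x z] less[OF that] yz unfolding E_comm[symmetric] by (simp add: E_def)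
  have "(\<Sum>x\<in>insert z A. g x * E x y) = g z * E z y + (\<Sum>x\<in>A. g x * E x y)"
    using assms by simp
  also have "E z y = 1" using yz by (simp add: E_def)
  also have "(\<Sum>x\<in>A. g x * E x y) = (\<Sum>x\<in>A. g x * E x z) * var_e"
    using E by (simp add: sum_distrib_right mult.assoc)
  also have "(\<Sum>x\<in>A. g x * E x z) = q - eps - m * var_b" using K by (simp add: algebra_simps)
  finally show ?thesis using g by (simp add: var_e_def algebra_simps)
qed

lemma sum_if_filter:
  "finite A \<Longrightarrow> (\<Sum>x\<in>A. (if D x then 0 else h x) * k x) = (\<Sum>x\<in>{x \<in> A. \<not> D x}. h x * k x :: ab_poly)"
  by (rule sum.mono_neutral_cong_right) auto

end

context coxeter_system
begin

lemma graded_order_bruhat: "graded_order B len"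
proof
  show "(x, x) \<in> B" if "x \<in> Field B" for x
    using that bruhat_closed bruhat_refl by (auto simp: Field_def)
  show "finite (closed_ival B x y)" for x y
    by (rule finite_subset[OF _ finite_bruhat_below[of y]]) (auto simp: closed_ival_def)
  show "(x, z) \<in> B" if "(x, y) \<in> B" "(y, z) \<in> B" for x y z using that by (rule bruhat_trans)
  show "len x < len y" if "(x, y) \<in> B" "x \<noteq> y" for x y using bruhat_len that by blast
  show "\<exists>z. (x, z) \<in> B \<and> (z, y) \<in> B \<and> z \<noteq> x \<and> z \<noteq> y" if "(x, y) \<in> B" "len x + 1 < len y" for x y
    using that by (rule bruhat_gap)
qed

sublocale Br: graded_order B len by (rule graded_order_bruhat)

abbreviation descent :: "'a \<Rightarrow> 'a \<Rightarrow> bool" where "descent s x \<equiv> len (x \<otimes> s) < len x"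

lemma not_descent: "x \<in> carrier W \<Longrightarrow> s \<in> S \<Longrightarrow> \<not> descent s x \<Longrightarrow> len (x \<otimes> s) = len x + 1"
  using len_gen_cases[of x s] by linarith

lemma descent_len: "x \<in> carrier W \<Longrightarrow> s \<in> S \<Longrightarrow> descent s x \<Longrightarrow> len x = len (x \<otimes> s) + 1"
  using len_gen_cases[of x s] by linarith

lemma descent_mult: "x \<in> carrier W \<Longrightarrow> s \<in> S \<Longrightarrow> descent s (x \<otimes> s) \<longleftrightarrow> \<not> descent s x"
  using len_gen_cases[of x s] by auto

text \<open>
  Lifting: an ascent below \<open>ys\<close> is already below \<open>y\<close>, and a descent below \<open>ys\<close> is \<open>xs\<close> for an ascent
  \<open>x\<close> below \<open>y\<close>.
\<close>

lemma open_ival_lifted_bottom: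
  assumes s: "s \<in> S" and u: "\<not> descent s u" and y: "Br.lt u y" "\<not> descent s y"
  shows "open_ival B u (y \<otimes> s) = insert y {x \<in> open_ival B u y. \<not> descent s x}
    \<union> (\<lambda>x. x \<otimes> s) ` insert u {x \<in> open_ival B u y. \<not> descent s x}"
proof (intro Set.set_eqI iffI)
  let ?O = "{x \<in> open_ival B u y. \<not> descent s x}"
  have c: "u \<in> carrier W" "y \<in> carrier W" using y bruhat_closed by auto
  have up: "len y < len (y \<otimes> s)" "(y \<otimes> s) \<otimes> s = y" "len u < len (u \<otimes> s)"
    using not_descent[OF c(2) s y(2)] not_descent[OF c(1) s u] c s by auto
  have yB: "Br.lt y (y \<otimes> s)" using bruhat_up[OF c(2) s up(1)] up(1) by auto
  {
    fix z assume "z \<in> open_ival B u (y \<otimes> s)"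
    hence z: "Br.lt u z" "Br.lt z (y \<otimes> s)" unfolding Br.open_ival_iff by auto
    have zc: "z \<in> carrier W" using z bruhat_closed by blast
    show "z \<in> insert y ?O \<union> (\<lambda>x. x \<otimes> s) ` insert u ?O"
    proof (cases "descent s z")
      case False
      hence "(z, y) \<in> B" using bruhat_lift_down[of z "y \<otimes> s" s] z s up not_descent[OF zc s False] by auto
      thus ?thesis using z False unfolding Br.open_ival_iff by auto
    next
      case True
      have 1: "(z \<otimes> s, y) \<in> B" using bruhat_lift_both[of z "y \<otimes> s" s] z s up True by auto
      have 2: "(u, z \<otimes> s) \<in> B" using bruhat_lift_down[of u z s] z s True up by blast
      have 3: "z \<otimes> s \<noteq> y" using z zc s by auto
      have "z \<otimes> s \<in> insert u ?O" using 1 2 3 True zc s unfolding Br.open_ival_iff by auto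
      moreover have "z = z \<otimes> s \<otimes> s" using zc s by simp
      ultimately show ?thesis by blast
    qed
  }
  fix z assume "z \<in> insert y ?O \<union> (\<lambda>x. x \<otimes> s) ` insert u ?O"
  thus "z \<in> open_ival B u (y \<otimes> s)"
  proof
    assume "z \<in> insert y ?O"
    hence "Br.lt u z" "(z, y) \<in> B" using y(1) Br.rreflI unfolding Br.open_ival_iff by auto
    thus ?thesis using Br.le_lt_trans[of z y "y \<otimes> s"] yB up unfolding Br.open_ival_iff by auto
  next
    assume "z \<in> (\<lambda>x. x \<otimes> s) ` insert u ?O"
    then obtain x where x: "z = x \<otimes> s" "x \<in> insert u ?O" by blast
    have x2: "(u, x) \<in> B" "Br.lt x y" "\<not> descent s x"
      using x(2) y(1) u Br.rreflI unfolding Br.open_ival_iff by auto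
    have xc: "x \<in> carrier W" using x2 bruhat_closed by blast
    have xs: "len x < len (x \<otimes> s)" using not_descent[OF xc s x2(3)] by simp
    have "Br.lt x (x \<otimes> s)" using bruhat_up[OF xc s xs] xs by auto
    hence "Br.lt u (x \<otimes> s)" using Br.le_lt_trans[OF x2(1)] by blast
    moreover have "(x \<otimes> s, y \<otimes> s) \<in> B" using bruhat_mult[of x y s] x2 s up by blast
    moreover have "x \<otimes> s \<noteq> y \<otimes> s" using x2 xc c s by simp
    ultimately show ?thesis unfolding x(1) Br.open_ival_iff by auto
  qed
qed

text \<open>
  As before, except that the lower copies now have to lie above \<open>us\<close>, whereas \<open>xs\<close> lies above \<open>us\<close> as
  soon as \<open>x\<close> lies above \<open>u\<close>.
\<close>

lemma open_ival_lifted_atom: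
  assumes s: "s \<in> S" and u: "\<not> descent s u" and y: "Br.lt u y" "\<not> descent s y"
  shows "open_ival B (u \<otimes> s) (y \<otimes> s) = {x. Br.lt (u \<otimes> s) x \<and> (x, y) \<in> B \<and> \<not> descent s x}
    \<union> (\<lambda>x. x \<otimes> s) ` {x \<in> open_ival B u y. \<not> descent s x}"
proof (intro Set.set_eqI iffI)
  let ?O = "{x \<in> open_ival B u y. \<not> descent s x}" and ?p = "u \<otimes> s"
  let ?A = "{x. Br.lt ?p x \<and> (x, y) \<in> B \<and> \<not> descent s x}"
  have c: "u \<in> carrier W" "y \<in> carrier W" using y bruhat_closed by auto
  have up: "len y < len (y \<otimes> s)" "(y \<otimes> s) \<otimes> s = y" "len u < len (u \<otimes> s)" "?p \<otimes> s = u"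
    using not_descent[OF c(2) s y(2)] not_descent[OF c(1) s u] c s by auto
  have yB: "Br.lt y (y \<otimes> s)" using bruhat_up[OF c(2) s up(1)] up(1) by auto
  {
    fix z assume "z \<in> open_ival B ?p (y \<otimes> s)"
    hence z: "Br.lt ?p z" "Br.lt z (y \<otimes> s)" unfolding Br.open_ival_iff by auto
    have zc: "z \<in> carrier W" using z bruhat_closed by blast
    show "z \<in> ?A \<union> (\<lambda>x. x \<otimes> s) ` ?O"
    proof (cases "descent s z")
      case False
      hence "(z, y) \<in> B" using bruhat_lift_down[of z "y \<otimes> s" s] z s up not_descent[OF zc s False] by auto
      thus ?thesis using z False by auto
    next
      case True
      have 1: "(z \<otimes> s, y) \<in> B" using bruhat_lift_both[of z "y \<otimes> s" s] z s up True by auto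
      have 2: "(u, z \<otimes> s) \<in> B" using bruhat_lift_both[of ?p z s] z s True up by auto
      have 3: "z \<otimes> s \<noteq> y" "z \<otimes> s \<noteq> u" using z zc s by auto
      have "z \<otimes> s \<in> ?O" using 1 2 3 True zc s unfolding Br.open_ival_iff by auto
      moreover have "z = z \<otimes> s \<otimes> s" using zc s by simp
      ultimately show ?thesis by blast
    qed
  }
  fix z assume "z \<in> ?A \<union> (\<lambda>x. x \<otimes> s) ` ?O"
  thus "z \<in> open_ival B ?p (y \<otimes> s)"
  proof
    assume "z \<in> ?A"
    thus ?thesis using Br.le_lt_trans[of z y "y \<otimes> s"] yB up unfolding Br.open_ival_iff by auto
  next
    assume "z \<in> (\<lambda>x. x \<otimes> s) ` ?O"
    then obtain x where x: "z = x \<otimes> s" "x \<in> ?O" by blast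
    have x2: "Br.lt u x" "Br.lt x y" "\<not> descent s x"
      using x(2) unfolding Br.open_ival_iff by auto
    have xc: "x \<in> carrier W" using x2 bruhat_closed by blast
    have xs: "len x < len (x \<otimes> s)" using not_descent[OF xc s x2(3)] by simp
    have "(?p, x \<otimes> s) \<in> B" using bruhat_mult[of u x s] x2 s xs by blast
    moreover have "(x \<otimes> s, y \<otimes> s) \<in> B" using bruhat_mult[of x y s] x2 s up by blast
    moreover have "x \<otimes> s \<noteq> y \<otimes> s" "?p \<noteq> x \<otimes> s" using x2 xc c s by auto
    ultimately show ?thesis unfolding x(1) Br.open_ival_iff by auto
  qed
qed

lemma ascents_below_descent:
  assumes s: "s \<in> S" and y: "(u, y) \<in> B" "descent s y" and z: "Br.lt u (y \<otimes> s)"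
  shows "{x \<in> open_ival B u y. \<not> descent s x} = insert (y \<otimes> s) {x \<in> open_ival B u (y \<otimes> s). \<not> descent s x}"
proof (intro Set.set_eqI iffI)
  have yc: "y \<in> carrier W" using y bruhat_closed by blast
  have zy: "Br.lt (y \<otimes> s) y" using bruhat_down[OF yc s y(2)] y(2) by auto
  have nd: "\<not> descent s (y \<otimes> s)" using y yc s by simp
  {
    fix x assume "x \<in> {x \<in> open_ival B u y. \<not> descent s x}"
    hence x: "Br.lt u x" "Br.lt x y" "\<not> descent s x" unfolding Br.open_ival_iff by auto
    have xc: "x \<in> carrier W" using x bruhat_closed by blast
    have "(x, y \<otimes> s) \<in> B"
      using bruhat_lift_down[of x y s] x y s not_descent[OF xc s x(3)] by auto
    thus "x \<in> insert (y \<otimes> s) {x \<in> open_ival B u (y \<otimes> s). \<not> descent s x}"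
      using x unfolding Br.open_ival_iff by auto
  }
  fix x assume "x \<in> insert (y \<otimes> s) {x \<in> open_ival B u (y \<otimes> s). \<not> descent s x}"
  hence "(x, y \<otimes> s) \<in> B" "Br.lt u x" "\<not> descent s x"
    using z nd Br.rreflI unfolding Br.open_ival_iff by auto
  thus "x \<in> {x \<in> open_ival B u y. \<not> descent s x}"
    using Br.le_lt_trans[of x "y \<otimes> s" y] zy unfolding Br.open_ival_iff by auto
qed

lemma inj_on_mult: "s \<in> S \<Longrightarrow> A \<subseteq> carrier W \<Longrightarrow> inj_on (\<lambda>x. x \<otimes> s) A"
  by (rule inj_onI) (auto simp: subset_iff)

text \<open>
  An instance of \<open>doubling_at_bottom\<close> in which the upper copy of an ascent \<open>x\<close> is \<open>xs\<close>. At a descent \<open>y\<close>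
  the lower copy is itself the upper copy of \<open>ys\<close>, hence \<open>\<Psi>[u,y] = K(ys)\<close>.
\<close>

theorem Psi_lifted_bottom:
  assumes s: "s \<in> S" and u: "\<not> descent s u" and w: "Br.lt u w" "\<not> descent s w"
  shows "Psi (ival B u (w \<otimes> s)) = var_a * Psi (ival B u w) + Psi (ival B u w) * var_b
    + (\<Sum>x\<in>open_ival B u w. (if descent s x then - (Psi (ival B u x) * (var_a * var_b))
         else Psi (ival B u x) * (var_b * var_a)) * Psi (ival B x w))"
proof -
  let ?K = "\<lambda>y. Br.P u (y \<otimes> s)"
  let ?g = "\<lambda>x. Br.P u x * var_b * var_e + ?K x * var_b"
  have uc: "u \<in> carrier W" using w bruhat_closed by blast
  have us: "len (u \<otimes> s) = len u + 1" by (rule not_descent[OF uc s u])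
  have A: "?K y = var_a * Br.E u y + Br.P u y * var_b + (\<Sum>x\<in>{x \<in> open_ival B u y. \<not> descent s x}. ?g x * Br.E x y)"
    if y: "Br.lt u y" "\<not> descent s y" for y
  proof -
    let ?O = "{x \<in> open_ival B u y. \<not> descent s x}"
    let ?h = "\<lambda>z. Br.P u z * var_b * Br.E z (y \<otimes> s)"
    have yc: "y \<in> carrier W" using y bruhat_closed by blast
    have ys: "len (y \<otimes> s) = len y + 1" by (rule not_descent[OF yc s y(2)])
    have yB: "Br.lt y (y \<otimes> s)" using bruhat_up[OF yc s] ys by auto
    have uys: "(u, y \<otimes> s) \<in> B" "u \<noteq> y \<otimes> s" using Br.lt_trans[OF y(1) yB] by auto
    have finO: "finite ?O" using Br.finite_open_ival by simp
    have O: "x \<in> carrier W" "len (x \<otimes> s) = len x + 1" "len x < len y" "x \<noteq> y" "x \<noteq> u" if "x \<in> ?O" for x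
    proof -
      have x: "Br.lt u x" "Br.lt x y" "\<not> descent s x" using that unfolding Br.open_ival_iff by auto
      show 1: "x \<in> carrier W" using x bruhat_closed by blast
      show "len (x \<otimes> s) = len x + 1" by (rule not_descent[OF 1 s x(3)])
      show "len x < len y" using bruhat_len[of x y] x by blast
      show "x \<noteq> y" "x \<noteq> u" using x by auto
    qed
    have c: "insert u ?O \<subseteq> carrier W" using O(1) uc by blast
    have inj: "inj_on (\<lambda>x. x \<otimes> s) (insert u ?O)" by (rule inj_on_mult[OF s c])
    have fin: "finite (insert y ?O)" "finite ((\<lambda>x. x \<otimes> s) ` insert u ?O)" using finO by simp_all
    have disj: "insert y ?O \<inter> (\<lambda>x. x \<otimes> s) ` insert u ?O = {}"
    proof (rule ccontr)
      assume "insert y ?O \<inter> (\<lambda>x. x \<otimes> s) ` insert u ?O \<noteq> {}"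
      then obtain x where x: "x \<otimes> s \<in> insert y ?O" "x \<in> insert u ?O" by blast
      hence "\<not> descent s (x \<otimes> s)" "\<not> descent s x" using y u by auto
      thus False using descent_mult[of x s] x(2) c s by blast
    qed
    have hF: "?h x = Br.P u x * var_b * var_e * Br.E x y" if "x \<in> ?O" for x
      using Br.E_Suc[of x y] O[OF that] ys unfolding Br.E_def by (simp add: mult.assoc)
    have hT: "?h (x \<otimes> s) = ?K x * var_b * Br.E x y" if "x \<in> ?O" for x
      using O[OF that] ys unfolding Br.E_def by simp
    have hy: "?h y = Br.P u y * var_b" using ys unfolding Br.E_def by simp
    have "?K u = 1" by (rule Br.Psi_cover) (use us bruhat_up[OF uc s] in auto)
    hence hu: "?h (u \<otimes> s) = var_b * Br.E u y" using ys us unfolding Br.E_def by simp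
    have uy: "len u < len y" using bruhat_len[of u y] y by blast
    have Eu: "Br.E u (y \<otimes> s) = var_e * Br.E u y"
      using Br.E_Suc[OF uy] ys unfolding Br.E_def by simp
    have "?K y = Br.E u (y \<otimes> s) + ((\<Sum>x\<in>insert y ?O. ?h x) + (\<Sum>x\<in>insert u ?O. ?h (x \<otimes> s)))"
      unfolding Br.Psi_rec[OF uys] open_ival_lifted_bottom[OF s u y]
        sum.union_disjoint[OF fin disj] sum.reindex[OF inj] by (simp only: o_def)
    also have "(\<Sum>x\<in>insert y ?O. ?h x) = Br.P u y * var_b + (\<Sum>x\<in>?O. Br.P u x * var_b * var_e * Br.E x y)"
    proof -
      have "y \<notin> ?O" using O by blast
      hence "(\<Sum>x\<in>insert y ?O. ?h x) = ?h y + (\<Sum>x\<in>?O. ?h x)" by (rule sum.insert[OF finO])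
      thus ?thesis using hy hF by (simp only: sum.cong[OF HOL.refl hF])
    qed
    also have "(\<Sum>x\<in>insert u ?O. ?h (x \<otimes> s)) = var_b * Br.E u y + (\<Sum>x\<in>?O. ?K x * var_b * Br.E x y)"
    proof -
      have "u \<notin> ?O" using O by blast
      hence "(\<Sum>x\<in>insert u ?O. ?h (x \<otimes> s)) = ?h (u \<otimes> s) + (\<Sum>x\<in>?O. ?h (x \<otimes> s))" by (rule sum.insert[OF finO])
      thus ?thesis using hu by (simp only: sum.cong[OF HOL.refl hT])
    qed
    finally have "?K y = var_e * Br.E u y + (Br.P u y * var_b + (\<Sum>x\<in>?O. Br.P u x * var_b * var_e * Br.E x y)
       + (var_b * Br.E u y + (\<Sum>x\<in>?O. ?K x * var_b * Br.E x y)))" unfolding Eu .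
    moreover have "(\<Sum>x\<in>?O. ?g x * Br.E x y)
      = (\<Sum>x\<in>?O. Br.P u x * var_b * var_e * Br.E x y) + (\<Sum>x\<in>?O. ?K x * var_b * Br.E x y)"
      unfolding sum.distrib[symmetric] by (simp only: distrib_right)
    ultimately show ?thesis by (simp add: var_e_def algebra_simps)
  qed
  show ?thesis
  proof (rule Br.doubling_at_bottom[of u w "descent s" ?K, OF w])
    fix y assume y: "Br.lt u y" "(y, w) \<in> B"
    let ?O = "{x \<in> open_ival B u y. \<not> descent s x}"
    have sum: "(\<Sum>x\<in>open_ival B u y. (if descent s x then 0 else ?g x) * Br.E x y) = (\<Sum>x\<in>?O. ?g x * Br.E x y)"
      by (rule Br.sum_if_filter[OF Br.finite_open_ival])
    show "?K y = var_a * Br.E u y + Br.P u y * var_b + (\<Sum>x\<in>open_ival B u y. (if descent s x then 0 else ?g x) * Br.E x y)"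
      if "\<not> descent s y"
      unfolding sum by (rule A[OF y(1) that])
    show "Br.P u y * var_a = var_a * Br.E u y + (\<Sum>x\<in>open_ival B u y. (if descent s x then 0 else ?g x) * Br.E x y)"
      if d: "descent s y"
    proof -
      let ?z = "y \<otimes> s"
      have yc: "y \<in> carrier W" using y bruhat_closed by blast
      have zs: "?z \<otimes> s = y" "?z \<in> carrier W" using yc s by auto
      have ly: "len y = len ?z + 1" by (rule descent_len[OF yc s d])
      have uz: "(u, ?z) \<in> B" using bruhat_lift_down[of u y s] y s d us by auto
      show ?thesis
      proof (cases "u = ?z")
        case True
        have empty: "?O = {}"
        proof (rule ccontr)
          assume "?O \<noteq> {}"
          then obtain x where "x \<in> ?O" by blast
          hence "Br.lt u x" "Br.lt x y" unfolding Br.open_ival_iff by auto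
          hence "len u < len x" "len x < len y" using bruhat_len by blast+
          thus False using ly True by simp
        qed
        have "Br.P u y = 1" using Br.Psi_cover[of u y] y ly True by auto
        moreover have "Br.E u y = 1" using ly True unfolding Br.E_def by simp
        ultimately show ?thesis unfolding sum empty by simp
      next
        case False
        let ?Oz = "{x \<in> open_ival B u ?z. \<not> descent s x}"
        have uz': "Br.lt u ?z" using uz False by blast
        have nd: "\<not> descent s ?z" using d zs by simp
        have "Br.P u y * var_a = var_a * Br.E u ?z * var_e + (\<Sum>x\<in>insert ?z ?Oz. ?g x * Br.E x y)"
        proof (rule Br.descent_step)
          show "finite ?Oz" using Br.finite_open_ival by simp
          show "?z \<notin> ?Oz" by (simp add: Br.open_ival_iff)
          show "len x < len ?z" if "x \<in> ?Oz" for x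
            using that bruhat_len[of x ?z] by (auto simp: Br.open_ival_iff)
          show "Br.P u y = var_a * Br.E u ?z + Br.P u ?z * var_b + (\<Sum>x\<in>?Oz. ?g x * Br.E x ?z)"
            using A[OF uz' nd] zs by simp
        qed (use ly zs in simp_all)
        moreover have "Br.E u ?z * var_e = Br.E u y"
          using Br.E_Suc[of u ?z] bruhat_len[OF uz] False ly unfolding Br.E_comm[symmetric] by (simp add: Br.E_def)
        ultimately show ?thesis unfolding sum ascents_below_descent[OF s conjunct1[OF y(1)] d uz'] by (simp only: mult.assoc)
      qed
    qed
  qed
qed

text \<open>
  An instance of \<open>doubling_at_atom\<close> with \<open>p = us\<close>, which is a descent and therefore never among the
  ascents. The formula covers both cases of the final theorem: if \<open>us\<close> is not below \<open>w\<close>, all terms except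
  \<open>\<Psi>[u,w]\<close> vanish.
\<close>

theorem Psi_lifted_atom:
  assumes s: "s \<in> S" and u: "\<not> descent s u" and w: "Br.lt u w" "\<not> descent s w"
  shows "Psi (ival B (u \<otimes> s) (w \<otimes> s)) = Psi (ival B u w) - var_b * Br.Psi0 (u \<otimes> s) w + Br.Psi0 (u \<otimes> s) w * var_b
    + (\<Sum>x\<in>open_ival B (u \<otimes> s) w. (if descent s x then - (Psi (ival B (u \<otimes> s) x) * (var_a * var_b))
         else Psi (ival B (u \<otimes> s) x) * (var_b * var_a)) * Psi (ival B x w))"
proof -
  let ?p = "u \<otimes> s"
  let ?K = "\<lambda>y. Br.P ?p (y \<otimes> s)"
  let ?g = "\<lambda>x. Br.Psi0 ?p x * var_b * var_e + ?K x * var_b"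
  have uc: "u \<in> carrier W" using w bruhat_closed by blast
  have us: "len ?p = len u + 1" by (rule not_descent[OF uc s u])
  have up: "Br.lt u ?p" using bruhat_up[OF uc s] us by auto
  have pd: "descent s ?p" using descent_mult[OF uc s] u by blast
  have wp: "w \<noteq> ?p" using w pd by blast
  have A: "?K y = Br.E u y + Br.Psi0 ?p y * var_b + (\<Sum>x\<in>{x \<in> open_ival B u y - {?p}. \<not> descent s x}. ?g x * Br.E x y)"
    if y: "Br.lt u y" "\<not> descent s y" for y
  proof -
    let ?O = "{x \<in> open_ival B u y. \<not> descent s x}" and ?A = "{x. Br.lt ?p x \<and> (x, y) \<in> B \<and> \<not> descent s x}"
    let ?h = "\<lambda>z. Br.P ?p z * var_b * Br.E z (y \<otimes> s)"
    have Op: "{x \<in> open_ival B u y - {?p}. \<not> descent s x} = ?O" using pd by blast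
    have yc: "y \<in> carrier W" using y bruhat_closed by blast
    have yp: "y \<noteq> ?p" using y pd by blast
    have ys: "len (y \<otimes> s) = len y + 1" by (rule not_descent[OF yc s y(2)])
    have pys: "(?p, y \<otimes> s) \<in> B" "?p \<noteq> y \<otimes> s" using bruhat_mult[of u y s] y s ys uc yc by auto
    have finO: "finite ?O" using Br.finite_open_ival by simp
    have finA: "finite ?A" by (rule finite_subset[OF _ Br.rfin[of ?p y]]) (auto simp: closed_ival_def)
    have O: "x \<in> carrier W" "len (x \<otimes> s) = len x + 1" if "x \<in> ?O" for x
    proof -
      have x: "Br.lt u x" "Br.lt x y" "\<not> descent s x" using that unfolding Br.open_ival_iff by auto
      show 1: "x \<in> carrier W" using x bruhat_closed by blast
      show "len (x \<otimes> s) = len x + 1" by (rule not_descent[OF 1 s x(3)])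
    qed
    have c: "?O \<subseteq> carrier W" using O(1) by blast
    have inj: "inj_on (\<lambda>x. x \<otimes> s) ?O" by (rule inj_on_mult[OF s c])
    have fin: "finite ((\<lambda>x. x \<otimes> s) ` ?O)" using finO by simp
    have disj: "?A \<inter> (\<lambda>x. x \<otimes> s) ` ?O = {}"
    proof (rule ccontr)
      assume "?A \<inter> (\<lambda>x. x \<otimes> s) ` ?O \<noteq> {}"
      then obtain x where x: "x \<otimes> s \<in> ?A" "x \<in> ?O" by blast
      hence "\<not> descent s (x \<otimes> s)" "\<not> descent s x" by auto
      thus False using descent_mult[of x s] x(2) c s by blast
    qed
    have hA: "?h x = Br.P ?p x * var_b * var_e ^ (len y - len x)" for x
      using ys unfolding Br.E_def by simp
    have hO: "?h (x \<otimes> s) = ?K x * var_b * Br.E x y" if "x \<in> ?O" for x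
      using O[OF that] ys unfolding Br.E_def by simp
    have Eu: "Br.E ?p (y \<otimes> s) = Br.E u y" using ys us unfolding Br.E_def by simp
    have "?K y = Br.E u y + ((\<Sum>x\<in>?A. ?h x) + (\<Sum>x\<in>?O. ?h (x \<otimes> s)))"
      unfolding Br.Psi_rec[OF pys] open_ival_lifted_atom[OF s u y]
        sum.union_disjoint[OF finA fin disj] sum.reindex[OF inj] Eu by (simp only: o_def)
    also have "(\<Sum>x\<in>?A. ?h x) = Br.Psi0 ?p y * var_b
      + (\<Sum>x\<in>open_ival B u y - {?p}. (if descent s x then 0 else Br.Psi0 ?p x * var_b * var_e) * Br.E x y)"
      unfolding hA by (rule Br.sum_above_atom[where D = "descent s", OF up y(1) yp y(2)])
    also have "(\<Sum>x\<in>open_ival B u y - {?p}. (if descent s x then 0 else Br.Psi0 ?p x * var_b * var_e) * Br.E x y)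
      = (\<Sum>x\<in>{x \<in> open_ival B u y - {?p}. \<not> descent s x}. Br.Psi0 ?p x * var_b * var_e * Br.E x y)"
      by (rule Br.sum_if_filter) (simp add: Br.finite_open_ival)
    also have "(\<Sum>x\<in>?O. ?h (x \<otimes> s)) = (\<Sum>x\<in>?O. ?K x * var_b * Br.E x y)"
      by (rule sum.cong[OF HOL.refl hO])
    finally have "?K y = Br.E u y + (Br.Psi0 ?p y * var_b + (\<Sum>x\<in>?O. Br.Psi0 ?p x * var_b * var_e * Br.E x y)
       + (\<Sum>x\<in>?O. ?K x * var_b * Br.E x y))" unfolding Op .
    moreover have "(\<Sum>x\<in>?O. ?g x * Br.E x y)
      = (\<Sum>x\<in>?O. Br.Psi0 ?p x * var_b * var_e * Br.E x y) + (\<Sum>x\<in>?O. ?K x * var_b * Br.E x y)"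
      unfolding sum.distrib[symmetric] by (simp only: distrib_right)
    ultimately show ?thesis unfolding Op by (simp only: add.assoc)
  qed
  show ?thesis
  proof (rule Br.doubling_at_atom[of u w "descent s" ?p ?K, OF w wp up us])
    fix y assume y: "Br.lt u y" "(y, w) \<in> B" "y \<noteq> ?p"
    let ?O = "{x \<in> open_ival B u y - {?p}. \<not> descent s x}"
    have sum: "(\<Sum>x\<in>open_ival B u y - {?p}. (if descent s x then 0 else ?g x) * Br.E x y) = (\<Sum>x\<in>?O. ?g x * Br.E x y)"
      by (rule Br.sum_if_filter) (simp add: Br.finite_open_ival)
    show "?K y = Br.E u y + Br.Psi0 ?p y * var_b + (\<Sum>x\<in>open_ival B u y - {?p}. (if descent s x then 0 else ?g x) * Br.E x y)"
      if "\<not> descent s y"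
      unfolding sum by (rule A[OF y(1) that])
    show "Br.Psi0 ?p y * var_a = Br.E u y + (\<Sum>x\<in>open_ival B u y - {?p}. (if descent s x then 0 else ?g x) * Br.E x y)"
      if d: "descent s y"
    proof -
      let ?z = "y \<otimes> s"
      let ?Oz = "{x \<in> open_ival B u ?z - {?p}. \<not> descent s x}"
      have yc: "y \<in> carrier W" using y bruhat_closed by blast
      have zs: "?z \<otimes> s = y" "?z \<in> carrier W" using yc s by auto
      have ly: "len y = len ?z + 1" by (rule descent_len[OF yc s d])
      have "u \<noteq> ?z" using y(3) zs by auto
      hence uz: "Br.lt u ?z" using bruhat_lift_down[of u y s] y s d us by auto
      have nd: "\<not> descent s ?z" using d zs by simp
      have "Br.lt ?p y" using bruhat_mult_below[of u y s] y s d by auto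
      hence Py: "Br.Psi0 ?p y = Br.P ?p y" unfolding Br.Psi0_def by (rule if_P)
      have Oeq: "?O = insert ?z ?Oz"
        using ascents_below_descent[OF s conjunct1[OF y(1)] d uz] pd nd by blast
      have "Br.Psi0 ?p y * var_a = Br.E u ?z * var_e + (\<Sum>x\<in>insert ?z ?Oz. ?g x * Br.E x y)"
      proof (rule Br.descent_step)
        show "finite ?Oz" using Br.finite_open_ival by simp
        show "?z \<notin> ?Oz" by (simp add: Br.open_ival_iff)
        show "len x < len ?z" if "x \<in> ?Oz" for x
          using that bruhat_len[of x ?z] by (auto simp: Br.open_ival_iff)
        show "Br.Psi0 ?p y = Br.E u ?z + Br.Psi0 ?p ?z * var_b + (\<Sum>x\<in>?Oz. ?g x * Br.E x ?z)"
          using A[OF uz nd] zs unfolding Py by simp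
      qed (use ly zs Py in simp_all)
      moreover have "Br.E u ?z * var_e = Br.E u y"
        using Br.E_Suc[of u ?z] bruhat_len[of u ?z] uz ly unfolding Br.E_comm[symmetric] by (simp add: Br.E_def)
      ultimately show ?thesis unfolding sum Oeq by (simp only:)
    qed
  qed
qed

end

section \<open>The formulas symmetric in c and d\<close>

lemma ab_const_half: "ab_const (1 / 2) * (x + x) = x"
proof -
  have "ab_const (1 / 2) + ab_const (1 / 2) = (1 :: ab_poly)"
    by (simp add: ab_const_def Poly_Mapping.single_add[symmetric])
  thus ?thesis by (metis distrib_left distrib_right mult_1)
qed

context graded_order
begin

text \<open>
  The doubling with descents differs from the one without by \<open>ba + ab = d\<close> at each descent.
\<close>

lemma signed_sum_split:
  assumes "finite A"
  shows "(\<Sum>x\<in>A. (if D x then - (P u x * (var_a * var_b)) else P u x * (var_b * var_a)) * P x w)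
    = (\<Sum>x\<in>A. P u x * (var_b * var_a) * P x w) - (\<Sum>x\<in>{x \<in> A. D x}. P u x * cd_d * P x w)"
proof -
  have filter: "(\<Sum>x\<in>{x \<in> A. D x}. P u x * cd_d * P x w) = (\<Sum>x\<in>A. if D x then P u x * cd_d * P x w else 0)"
    using assms by (rule sum.inter_filter)
  show ?thesis unfolding filter sum_subtractf[symmetric]
    by (rule sum.cong[OF HOL.refl]) (simp add: cd_d_def algebra_simps)
qed

text \<open>
  Adding the signed sum to itself produces the sum with signs and \<open>d\<close>, up to the difference of the full
  sums over \<open>ba\<close> and \<open>ab\<close>, which \<open>Psi_flip\<close> evaluates.
\<close>

lemma signed_sum_double:
  assumes uw: "lt u w" and sg: "\<And>x. x \<in> open_ival r u w \<Longrightarrow> sg x = (if D x then - 1 else 1 :: int)"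
    and F: "F = (\<Sum>x\<in>open_ival r u w. (if D x then - (P u x * (var_a * var_b)) else P u x * (var_b * var_a)) * P x w)"
    and T: "T = (\<Sum>x\<in>open_ival r u w. of_int (sg x) * P u x * cd_d * P x w)"
  shows "F + F = P u w * var_a + var_b * P u w - P u w * var_b - var_a * P u w + T"
proof -
  let ?AB = "\<Sum>x\<in>open_ival r u w. P u x * (var_a * var_b) * P x w"
  let ?BA = "\<Sum>x\<in>open_ival r u w. P u x * (var_b * var_a) * P x w"
  have "F + F = T + ?BA - ?AB"
    unfolding F T sum.distrib[symmetric] sum_subtractf[symmetric]
    by (rule sum.cong[OF HOL.refl]) (simp add: sg cd_d_def algebra_simps)
  moreover have "?BA - ?AB = var_b * P u w + P u w * var_a - P u w * var_b - var_a * P u w"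
    using Psi_flip[OF uw] by (simp add: algebra_simps)
  ultimately have "F + F = T + (var_b * P u w + P u w * var_a - P u w * var_b - var_a * P u w)"
    by (simp only: add_diff_eq[symmetric])
  thus ?thesis by (simp add: algebra_simps)
qed

end

theorem theorem6p1:
  fixes W :: "('a, 'b) monoid_scheme" (structure)
    and S :: "'a set" and s u w :: 'a
  defines "B \<equiv> bruhat W S"
  assumes "coxeter_system W S"
    and "s \<in> S" and "u \<in> carrier W" and "w \<in> carrier W"
    and "bruhat_less W S u (u \<otimes> s)"
    and "bruhat_less W S w (w \<otimes> s)"
    and "bruhat_less W S u w"
  shows "(u \<otimes> s \<notin> closed_ival B u w \<longrightarrow>
            Psi (ival B u (w \<otimes> s)) = Psi (Pyr (ival B u w))
          \<and> Psi (ival B (u \<otimes> s) (w \<otimes> s)) = Psi (ival B u w))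
       \<and> (u \<otimes> s \<in> closed_ival B u w \<longrightarrow>
            Psi (ival B u (w \<otimes> s))
              = Psi (Pyr (ival B u w))
                - (\<Sum>v\<in>{v \<in> open_ival B u w. bruhat_less W S (v \<otimes> s) v}.
                     Psi (ival B u v) * cd_d * Psi (ival B v w))
          \<and> Psi (ival B u (w \<otimes> s))
              = ab_const (1 / 2) *
                (Psi (ival B u w) * cd_c + cd_c * Psi (ival B u w)
                 + (\<Sum>v\<in>open_ival B u w.
                      of_int (cox_sign W S s v) * Psi (ival B u v) * cd_d * Psi (ival B v w)))
          \<and> Psi (ival B (u \<otimes> s) (w \<otimes> s))
              = Psi (Sh (u \<otimes> s) (ival B u w))
                - (\<Sum>v\<in>{v \<in> open_ival B (u \<otimes> s) w. bruhat_less W S (v \<otimes> s) v}.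
                     Psi (ival B (u \<otimes> s) v) * cd_d * Psi (ival B v w))
          \<and> Psi (ival B (u \<otimes> s) (w \<otimes> s))
              = Psi (ival B u w)
                + ab_const (1 / 2) *
                  (Psi (ival B (u \<otimes> s) w) * cd_c - cd_c * Psi (ival B (u \<otimes> s) w)
                   + (\<Sum>v\<in>open_ival B (u \<otimes> s) w.
                        of_int (cox_sign W S s v) * Psi (ival B (u \<otimes> s) v) * cd_d
                          * Psi (ival B v w))))"
proof -
  interpret coxeter_system W S by fact
  note s = \<open>s \<in> S\<close> and uc = \<open>u \<in> carrier W\<close>
  have u: "\<not> len (u \<otimes> s) < len u" and w: "\<not> len (w \<otimes> s) < len w" and uw: "Br.lt u w"
    using assms(6-8) bruhat_len by fastforce+
  have lp: "len (u \<otimes> s) = len u + 1" by (rule not_descent[OF uc s u])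
  have up: "Br.lt u (u \<otimes> s)" using assms(6) by simp
  have wp: "w \<noteq> u \<otimes> s" using descent_mult[OF uc s] u w by blast
  have desc: "bruhat_less W S (v \<otimes> s) v \<longleftrightarrow> len (v \<otimes> s) < len v" if "v \<in> carrier W" for v
    using bruhat_len[of "v \<otimes> s" v] bruhat_down[OF that s] by auto
  have opc: "v \<in> carrier W" if "v \<in> open_ival (bruhat W S) x y" for v x y
    using that bruhat_closed unfolding Br.open_ival_iff by blast
  have sets: "{v \<in> open_ival (bruhat W S) x y. bruhat_less W S (v \<otimes> s) v}
     = {v \<in> open_ival (bruhat W S) x y. len (v \<otimes> s) < len v}" for x y
    using desc opc by blast
  have sgn: "cox_sign W S s v = (if len (v \<otimes> s) < len v then - 1 else 1)"
    if "v \<in> open_ival (bruhat W S) x y" for v x y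
    using len_gen_cases[OF opc[OF that] s] by (auto simp: cox_sign_def)
  note bot = Psi_lifted_bottom[OF s u uw w] and atom = Psi_lifted_atom[OF s u uw w]
  have bot_pyr: "Psi (ival (bruhat W S) u (w \<otimes> s)) = Psi (Pyr (ival (bruhat W S) u w))
      - (\<Sum>v\<in>{v \<in> open_ival (bruhat W S) u w. bruhat_less W S (v \<otimes> s) v}.
           Psi (ival (bruhat W S) u v) * cd_d * Psi (ival (bruhat W S) v w))"
    unfolding bot Br.Psi_Pyr[OF uw] sets Br.signed_sum_split[OF Br.finite_open_ival]
    by (simp only: add_diff_eq)
  show ?thesis unfolding B_def
  proof (intro conjI impI)
    assume "u \<otimes> s \<notin> closed_ival (bruhat W S) u w"
    hence np: "(u \<otimes> s, w) \<notin> bruhat W S" using up by (simp add: closed_ival_def)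
    \<comment> \<open>A descent \<open>v\<close> above \<open>u\<close> would satisfy \<open>us \<le> v \<le> w\<close>.\<close>
    have "\<not> bruhat_less W S (v \<otimes> s) v" if v: "v \<in> open_ival (bruhat W S) u w" for v
    proof
      assume "bruhat_less W S (v \<otimes> s) v"
      hence "len (v \<otimes> s) < len v" using desc opc[OF v] by blast
      hence "(u \<otimes> s, v) \<in> bruhat W S"
        using bruhat_mult_below[of u v s] v s unfolding Br.open_ival_iff by blast
      thus False using np v bruhat_trans unfolding Br.open_ival_iff by blast
    qed
    hence "{v \<in> open_ival (bruhat W S) u w. bruhat_less W S (v \<otimes> s) v} = {}" by blast
    thus "Psi (ival (bruhat W S) u (w \<otimes> s)) = Psi (Pyr (ival (bruhat W S) u w))"
      using bot_pyr by (simp only: sum.empty diff_0_right)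
    have "open_ival (bruhat W S) (u \<otimes> s) w = {}"
      using np bruhat_trans unfolding open_ival_def closed_ival_def by blast
    moreover have "Br.Psi0 (u \<otimes> s) w = 0" unfolding Br.Psi0_def using np by simp
    ultimately show "Psi (ival (bruhat W S) (u \<otimes> s) (w \<otimes> s)) = Psi (ival (bruhat W S) u w)"
      using atom by simp
  next
    assume "u \<otimes> s \<in> closed_ival (bruhat W S) u w"
    hence pw: "Br.lt (u \<otimes> s) w" using wp by (auto simp: closed_ival_def)
    have P0: "Br.Psi0 (u \<otimes> s) w = Br.P (u \<otimes> s) w" unfolding Br.Psi0_def by (rule if_P[OF pw])
    show "Psi (ival (bruhat W S) u (w \<otimes> s)) = Psi (Pyr (ival (bruhat W S) u w))
      - (\<Sum>v\<in>{v \<in> open_ival (bruhat W S) u w. bruhat_less W S (v \<otimes> s) v}.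
           Psi (ival (bruhat W S) u v) * cd_d * Psi (ival (bruhat W S) v w))"
      by (rule bot_pyr)
    let ?U = "Psi (ival (bruhat W S) u (w \<otimes> s))" and ?V = "Psi (ival (bruhat W S) (u \<otimes> s) (w \<otimes> s))"
    have "Br.P u w * cd_c + cd_c * Br.P u w
       + (\<Sum>v\<in>open_ival (bruhat W S) u w. of_int (cox_sign W S s v) * Br.P u v * cd_d * Br.P v w) = ?U + ?U"
      using Br.signed_sum_double[OF uw sgn HOL.refl HOL.refl] unfolding bot by (simp add: cd_c_def algebra_simps)
    thus "?U = ab_const (1 / 2) * (Br.P u w * cd_c + cd_c * Br.P u w
       + (\<Sum>v\<in>open_ival (bruhat W S) u w. of_int (cox_sign W S s v) * Br.P u v * cd_d * Br.P v w))"
      by (simp only: ab_const_half)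
    show "?V = Psi (Sh (u \<otimes> s) (ival (bruhat W S) u w))
      - (\<Sum>v\<in>{v \<in> open_ival (bruhat W S) (u \<otimes> s) w. bruhat_less W S (v \<otimes> s) v}.
           Br.P (u \<otimes> s) v * cd_d * Br.P v w)"
      unfolding atom P0 Br.Psi_Sh[OF up pw lp] sets Br.signed_sum_split[OF Br.finite_open_ival]
      by (simp only: add_diff_eq)
    have "Br.P (u \<otimes> s) w * cd_c - cd_c * Br.P (u \<otimes> s) w
       + (\<Sum>v\<in>open_ival (bruhat W S) (u \<otimes> s) w. of_int (cox_sign W S s v) * Br.P (u \<otimes> s) v * cd_d * Br.P v w)
       = (?V - Br.P u w) + (?V - Br.P u w)"
      using Br.signed_sum_double[OF pw sgn HOL.refl HOL.refl] unfolding atom P0 by (simp add: cd_c_def algebra_simps)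
    thus "?V = Br.P u w + ab_const (1 / 2) * (Br.P (u \<otimes> s) w * cd_c - cd_c * Br.P (u \<otimes> s) w
       + (\<Sum>v\<in>open_ival (bruhat W S) (u \<otimes> s) w. of_int (cox_sign W S s v) * Br.P (u \<otimes> s) v * cd_d * Br.P v w))"
      by (simp only: ab_const_half) simp
  qed
qed

end
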